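(* Let $a\colon\mathbb N_0\to\mathbb C$ be a $k$-automatic sequence produced by a strongly connected, prolongable $k$-automaton. Then there exists a decomposition $a=a_{\mathrm{str}}+a_{\mathrm{uni}}$, where $a_{\mathrm{str}}$ is strongly structured and $a_{\mathrm{uni}}$ is highly Gowers uniform.
   Context: $\Sigma_k=\{0,\dots,k-1\}$; $(n)_k$ is the base-$k$ expansion of $n$ without leading zeros. A $k$-automaton $(S,s_0,\Sigma_k,\delta,\Omega,\tau)$ (finite $S$, $\delta\colon S\times\Sigma_k\to S$ extended to words by $\delta(s,\mathbf{uv})=\delta(\delta(s,\mathbf u),\mathbf v)$, $\tau\colon S\to\Omega$) produces $n\mapsto\tau(\delta(s_0,(n)_k))$. It is prolongable if $\delta(s_0,0)=s_0$, strongly connected if for all $s,s'\in S$ some word $\mathbf w$ has $\delta(s,\mathbf w)=s'$, synchronising if some word $\mathbf w$ makes $\delta(s,\mathbf w)$ independent of $s$. A forwards synchronising $k$-automatic sequence is one produced by a synchronising $k$-automaton (reading from the most significant digit). A $k$-automatic sequence $a\colon\mathbb N_0\to\Omega$ is strongly structured if there exist a periodic sequence $a_{\mathrm{per}}\colon\mathbb N_0\to\Omega_{\mathrm{per}}$ with period coprime to $k$, a forwards synchronising $k$-automatic sequence $a_{\mathrm{fs}}\colon\mathbb N_0\to\Omega_{\mathrm{fs}}$ and a map $F\colon\Omega_{\mathrm{per}}\times\Omega_{\mathrm{fs}}\to\Omega$ with $a(n)=F(a_{\mathrm{per}}(n),a_{\mathrm{fs}}(n))$ for all $n$. Gowers norms: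 for a finite abelian group $Z$, $\|f\|_{U^d(Z)}^{2^d}=\mathbb{E}_{(n_0,\dots,n_d)\in Z^{d+1}}\prod_{\omega\in\{0,1\}^d}\mathcal{C}^{|\omega|}f(n_0+\sum_i\omega_in_i)$ ($\mathcal C$ complex conjugation, $|\omega|$ number of ones); $[N]=\{0,\dots,N-1\}$, $\|a\|_{U^d[N]}=\|1_{[N]}a\|_{U^d(\mathbb Z/\tilde N\mathbb Z)}/\|1_{[N]}\|_{U^d(\mathbb Z/\tilde N\mathbb Z)}$ with $\tilde N$ the least prime $>2dN$. A bounded $a$ is highly Gowers uniform if for every $d\ge1$ there is $c_d>0$ with $\|a\|_{U^d[N]}\ll N^{-c_d}$. *)

theory Defs
  imports Complex_Main "HOL-Algebra.FiniteProduct" "HOL-Algebra.Elementary_Groups" "HOL-Library.FuncSet"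
    "HOL-Library.Landau_Symbols" "HOL-Computational_Algebra.Primes"
begin

section \<open>Automata and automatic sequences\<close>

text \<open>The states form a carrier set and the output alphabet is the type \<^typ>\<open>'o\<close>;
  the letters of the input alphabet are the numbers below \<open>k\<close>.\<close>

record ('s, 'o) automaton =
  states :: "'s set"
  init :: 's
  delta :: "'s \<Rightarrow> nat \<Rightarrow> 's"
  out :: "'s \<Rightarrow> 'o"

definition k_automaton :: "nat \<Rightarrow> ('s, 'o) automaton \<Rightarrow> bool" where
  "k_automaton k A \<longleftrightarrow>
     finite (states A) \<and> init A \<in> states A \<and> delta A \<in> states A \<rightarrow> {..<k} \<rightarrow> states A"

definition delta_word :: "('s, 'o) automaton \<Rightarrow> 's \<Rightarrow> nat list \<Rightarrow> 's" where
  "delta_word A = foldl (delta A)"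

text \<open>Most significant digit first; the expansion of \<open>0\<close> is the empty word.\<close>

fun base_expansion :: "nat \<Rightarrow> nat \<Rightarrow> nat list" where
  "base_expansion k n =
     (if n = 0 \<or> k \<le> 1 then [] else base_expansion k (n div k) @ [n mod k])"

declare base_expansion.simps [simp del]

definition produced_sequence :: "nat \<Rightarrow> ('s, 'o) automaton \<Rightarrow> nat \<Rightarrow> 'o" where
  "produced_sequence k A n = out A (delta_word A (init A) (base_expansion k n))"

definition prolongable :: "('s, 'o) automaton \<Rightarrow> bool" where
  "prolongable A \<longleftrightarrow> delta A (init A) 0 = init A"

definition strongly_connected :: "nat \<Rightarrow> ('s, 'o) automaton \<Rightarrow> bool" where
  "strongly_connected k A \<longleftrightarrow>
     (\<forall>s\<in>states A. \<forall>s'\<in>states A. \<exists>w\<in>lists {..<k}. delta_word A s w = s')"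

definition synchronising :: "nat \<Rightarrow> ('s, 'o) automaton \<Rightarrow> bool" where
  "synchronising k A \<longleftrightarrow>
     (\<exists>w\<in>lists {..<k}. \<forall>s\<in>states A. \<forall>s'\<in>states A. delta_word A s w = delta_word A s' w)"

text \<open>Every finite automaton is isomorphic to one whose states are natural numbers, so
  quantifying over automata with state type \<^typ>\<open>nat\<close> loses no sequences.\<close>

definition k_automatic :: "nat \<Rightarrow> (nat \<Rightarrow> 'o) \<Rightarrow> bool" where
  "k_automatic k a \<longleftrightarrow>
     (\<exists>A :: (nat, 'o) automaton. k_automaton k A \<and> a = produced_sequence k A)"

definition forwards_synchronising :: "nat \<Rightarrow> (nat \<Rightarrow> 'o) \<Rightarrow> bool" where
  "forwards_synchronising k a \<longleftrightarrow>
     (\<exists>A :: (nat, 'o) automaton.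
        k_automaton k A \<and> synchronising k A \<and> a = produced_sequence k A)"

text \<open>Periodic sequences and automatic sequences take only finitely many values, so the
  auxiliary sequences may be taken with values in \<^typ>\<open>nat\<close>.\<close>

definition strongly_structured :: "nat \<Rightarrow> (nat \<Rightarrow> 'o) \<Rightarrow> bool" where
  "strongly_structured k a \<longleftrightarrow> k_automatic k a \<and>
     (\<exists>(a_per :: nat \<Rightarrow> nat) (a_fs :: nat \<Rightarrow> nat) (F :: nat \<times> nat \<Rightarrow> 'o).
        (\<exists>m>0. coprime m k \<and> (\<forall>n. a_per (n + m) = a_per n)) \<and>
        forwards_synchronising k a_fs \<and>
        (\<forall>n. a n = F (a_per n, a_fs n)))"


section \<open>Gowers norms\<close>

text \<open>The group \<open>Z\<close> is written multiplicatively.  The average is a nonnegative real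
  number whenever \<open>Z\<close> is a finite abelian group and \<open>d \<ge> 1\<close>, so taking its real part
  is harmless.\<close>

definition gowers_norm :: "('g, 'b) monoid_scheme \<Rightarrow> nat \<Rightarrow> ('g \<Rightarrow> complex) \<Rightarrow> real" where
  "gowers_norm Z d f =
     root (2 ^ d) (Re (
       (\<Sum>n \<in> {..d} \<rightarrow>\<^sub>E carrier Z.
          \<Prod>\<omega> \<in> {1..d} \<rightarrow>\<^sub>E {0, 1 :: nat}.
            (cnj ^^ (\<Sum>i=1..d. \<omega> i))
              (f (n 0 \<otimes>\<^bsub>Z\<^esub> (\<Otimes>\<^bsub>Z\<^esub>i\<in>{1..d}. n i [^]\<^bsub>Z\<^esub> \<omega> i))))
       / of_nat (card (carrier Z)) ^ (d + 1)))"

text \<open>The residues modulo \<open>m\<close> are represented by the integers in \<open>{0..<m}\<close>.\<close>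

definition restrict_interval :: "nat \<Rightarrow> (nat \<Rightarrow> complex) \<Rightarrow> int \<Rightarrow> complex" where
  "restrict_interval N a x = (if x \<in> {0..<int N} then a (nat x) else 0)"

definition ambient_prime :: "nat \<Rightarrow> nat \<Rightarrow> nat" where
  "ambient_prime d N = (LEAST p. prime p \<and> p > 2 * d * N)"

definition gowers_norm_interval :: "nat \<Rightarrow> nat \<Rightarrow> (nat \<Rightarrow> complex) \<Rightarrow> real" where
  "gowers_norm_interval d N a =
     gowers_norm (integer_mod_group (ambient_prime d N)) d (restrict_interval N a) /
     gowers_norm (integer_mod_group (ambient_prime d N)) d (restrict_interval N (\<lambda>_. 1))"

definition highly_gowers_uniform :: "(nat \<Rightarrow> complex) \<Rightarrow> bool" where
  "highly_gowers_uniform a \<longleftrightarrow> Bseq a \<and>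
     (\<forall>d\<ge>1. \<exists>c>0. (\<lambda>N. gowers_norm_interval d N a) \<in> O(\<lambda>N. real N powr (- c)))"

end

theory Submission imports Defs begin

text \<open>Let \<open>u\<close> be a word whose action on the states has minimal rank.  The maps \<open>y\<close> given by words
  that start with \<open>u\<close> are the states of a transitive automaton \<open>Y\<close> which extends the given one;
  its automorphisms act freely, and reading \<open>u\<close> sends \<open>Y\<close> into a single orbit.

  Call an automorphism \<open>h\<close> free if, for every dimension and every vertex \<open>\<omega>\<close>, from all starting states there are
  two parallelepipeds of words of equal length leading to the same states at all vertices, except that
  at \<open>\<omega>\<close> they differ by \<open>h\<close>.  These form a normal subgroup \<open>H\<close>.  If the output \<open>b\<close>
  has mean zero over every \<open>H\<close>-orbit, the averages over parallelepipeds contract at each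
  scale, which is Gowers uniformity with a power saving.  So \<open>a_uni\<close> comes from the output
  minus its average over \<open>H\<close>, and \<open>a_str\<close> from this average.

  A parallelepiped of numbers whose vertex \<open>\<omega>\<close> alone lies beyond a carry shows that, modulo \<open>H\<close>,
  the state after reading \<open>s + 1\<close> is determined by the state after reading \<open>s\<close>.  Hence the state
  modulo \<open>H\<close> is periodic in \<open>s\<close> up to what a synchronising automaton sees; comparing words of lengths
  \<open>L\<close> and \<open>L + 1\<close> makes the period coprime to \<open>k\<close>.\<close>

section \<open>Automata and their automorphisms\<close>

text \<open>The given automaton may have no symmetry at all, and a symmetry with fixed points is not
  determined by its effect on one state. Passing to \<open>Y\<close> supplies a free action: the
  automorphism relating two states is unique, so it can be recovered after any amount of further
  reading. Two obstacles shape the rest. Digits are read from the top while carries come from below,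
  so a vertex of a parallelepiped has no single state: its state is recorded for each of the carries
  0, ..., \<open>d\<close>, and a free shift has to act in the same way for all of them. And
  prolongability holds only for the given automaton: the digit 0 need not fix the starting state of
  \<open>Y\<close>, so leading zeros matter there. Normality of \<open>H\<close> makes the
  \<open>H\<close>-average insensitive to them. Finiteness enters through the automorphism group:
  finitely many dimensions decide membership in \<open>H\<close>, so finitely many predecessors of a
  number suffice to carry information past it.\<close>

primrec run :: "nat \<Rightarrow> ('y \<Rightarrow> nat \<Rightarrow> 'y) \<Rightarrow> nat \<Rightarrow> nat \<Rightarrow> 'y \<Rightarrow> 'y" where
  "run k \<delta> 0 x y = y"
| "run k \<delta> (Suc L) x y = \<delta> (run k \<delta> L (x div k) y) (x mod k)"

lemma run_add:
  "run k \<delta> (L + L') x y = run k \<delta> L' x (run k \<delta> L (x div k ^ L') y)"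
proof (induction L' arbitrary: x)
  case (Suc L')
  then show ?case by (simp add: div_mult2_eq)
qed simp

lemma run_shift:
  assumes "k > 0"
  shows "run k \<delta> L (x + c * k ^ L) y = run k \<delta> L x y"
proof (induction L arbitrary: x)
  case (Suc L)
  have e: "x + c * k ^ Suc L = x + k * (c * k ^ L)" by simp
  have "(x + c * k ^ Suc L) div k = x div k + c * k ^ L" "(x + c * k ^ Suc L) mod k = x mod k"
    unfolding e using assms by (simp_all only: div_mult_self2 mod_mult_self2 add.commute)
  with Suc show ?case by simp
qed simp

lemma run_mod:
  assumes "k > 0"
  shows "run k \<delta> L (x mod k ^ L) y = run k \<delta> L x y"
  using run_shift[OF assms, of \<delta> L "x mod k ^ L" "x div k ^ L" y] by (simp add: mod_div_mult_eq)

text \<open>Words are pairs of a length and a number, so that they can be added with carries.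
  Concatenation is then a shift by \<open>L'\<close> digits, and whatever lies above the lowest
  digits is ignored.\<close>

lemma run_append:
  assumes "k > 0" "x' < k ^ L'"
  shows "run k \<delta> (L + L') (x * k ^ L' + x') y = run k \<delta> L' x' (run k \<delta> L x y)"
  using run_shift[OF assms(1), of \<delta> L' x' x] assms by (simp add: run_add add.commute)

lemma number_append_less:
  fixes k x x' :: nat
  assumes "x < k ^ L" "x' < k ^ L'"
  shows "x * k ^ L' + x' < k ^ (L + L')"
proof -
  have "x * k ^ L' + x' < Suc x * k ^ L'" using assms by simp
  also have "\<dots> \<le> k ^ L * k ^ L'" using assms(1) by (intro mult_right_mono) auto
  finally show ?thesis by (simp add: power_add)
qed

locale transitive_automaton =
  fixes k :: nat and Y :: "'y set" and \<delta> :: "'y \<Rightarrow> nat \<Rightarrow> 'y"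
  assumes k_ge_2: "k \<ge> 2"
    and finite_Y: "finite Y"
    and \<delta>_closed: "\<And>y j. y \<in> Y \<Longrightarrow> j < k \<Longrightarrow> \<delta> y j \<in> Y"
    and transitive: "\<And>y y'. y \<in> Y \<Longrightarrow> y' \<in> Y \<Longrightarrow> \<exists>L x. x < k ^ L \<and> run k \<delta> L x y = y'"
begin

abbreviation "R \<equiv> run k \<delta>"

lemma k_pos: "k > 0" using k_ge_2 by simp

lemma power_k_pos: "k ^ L > 0" using k_pos by simp

lemma run_closed: "y \<in> Y \<Longrightarrow> R L x y \<in> Y"
  by (induction L arbitrary: x) (auto intro!: \<delta>_closed simp: k_pos)

section \<open>Automorphisms and the freeness of their action\<close>

definition Aut :: "('y \<Rightarrow> 'y) set" where
  "Aut = {\<phi> \<in> Y \<rightarrow>\<^sub>E Y. \<forall>y\<in>Y. \<forall>j<k. \<phi> (\<delta> y j) = \<delta> (\<phi> y) j}"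

lemma finite_Aut: "finite Aut"
  by (rule finite_subset[of _ "Y \<rightarrow>\<^sub>E Y"]) (auto simp: Aut_def finite_PiE finite_Y)

lemma Aut_closed: "\<phi> \<in> Aut \<Longrightarrow> y \<in> Y \<Longrightarrow> \<phi> y \<in> Y"
  by (auto simp: Aut_def)

lemma Aut_run: "\<phi> \<in> Aut \<Longrightarrow> y \<in> Y \<Longrightarrow> \<phi> (R L x y) = R L x (\<phi> y)"
  by (induction L arbitrary: x) (auto simp: Aut_def k_pos run_closed)

lemma Aut_extensional: "\<phi> \<in> Aut \<Longrightarrow> \<phi> \<in> extensional Y"
  by (auto simp: Aut_def PiE_def)

text \<open>The action is free: by transitivity every state is read from \<open>y\<close> by some
  word, and automorphisms commute with reading.\<close>

lemma Aut_eqI: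
  assumes "\<phi> \<in> Aut" "\<psi> \<in> Aut" "y \<in> Y" "\<phi> y = \<psi> y"
  shows "\<phi> = \<psi>"
proof (rule extensionalityI[of _ Y])
  fix y' assume "y' \<in> Y"
  then obtain L x where "R L x y = y'" using transitive assms(3) by blast
  then show "\<phi> y' = \<psi> y'" using assms by (metis Aut_run)
qed (use assms in \<open>auto intro: Aut_extensional\<close>)

text \<open>The image contains whatever can be reached from one of its members, hence all of
  \<open>Y\<close>; finiteness does the rest.\<close>

lemma Aut_bij:
  assumes "\<phi> \<in> Aut"
  shows "bij_betw \<phi> Y Y"
proof (cases "Y = {}")
  case False
  then obtain y where y: "y \<in> Y" by blast
  have "Y \<subseteq> \<phi> ` Y"
  proof
    fix y' assume "y' \<in> Y"
    then obtain L x where "R L x (\<phi> y) = y'" using transitive Aut_closed[OF assms y] by blast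
    then show "y' \<in> \<phi> ` Y" using assms y by (metis Aut_run run_closed imageI)
  qed
  moreover have "\<phi> ` Y \<subseteq> Y" using assms Aut_closed by blast
  ultimately have "\<phi> ` Y = Y" by blast
  then show ?thesis by (simp add: bij_betw_def finite_Y eq_card_imp_inj_on)
qed (simp add: bij_betw_def)

text \<open>Group elements are extensional on \<open>Y\<close>, so that equality in the group is
  plain equality of functions.\<close>

definition one :: "'y \<Rightarrow> 'y" where "one = (\<lambda>y\<in>Y. y)"

definition minv :: "('y \<Rightarrow> 'y) \<Rightarrow> 'y \<Rightarrow> 'y" where "minv \<phi> = (\<lambda>y\<in>Y. inv_into Y \<phi> y)"

abbreviation mul (infixl \<open>\<cdot>\<close> 70) where "\<phi> \<cdot> \<psi> \<equiv> compose Y \<phi> \<psi>"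

lemma one_apply [simp]: "y \<in> Y \<Longrightarrow> one y = y"
  by (simp add: one_def)

lemma mul_apply: "y \<in> Y \<Longrightarrow> (\<phi> \<cdot> \<psi>) y = \<phi> (\<psi> y)"
  by (simp add: compose_def)

lemma one_Aut [simp]: "one \<in> Aut"
  by (auto simp: Aut_def one_def \<delta>_closed)

lemma mul_Aut: "\<phi> \<in> Aut \<Longrightarrow> \<psi> \<in> Aut \<Longrightarrow> \<phi> \<cdot> \<psi> \<in> Aut"
  by (auto simp: Aut_def compose_def \<delta>_closed Pi_iff PiE_iff extensional_def)

lemma minv_left: "\<phi> \<in> Aut \<Longrightarrow> y \<in> Y \<Longrightarrow> minv \<phi> (\<phi> y) = y"
  using Aut_bij[of \<phi>] Aut_closed[of \<phi> y] by (simp add: minv_def bij_betw_def)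

lemma minv_right: "\<phi> \<in> Aut \<Longrightarrow> y \<in> Y \<Longrightarrow> \<phi> (minv \<phi> y) = y"
  using Aut_bij[of \<phi>] by (simp add: minv_def bij_betw_def f_inv_into_f)

lemma minv_closed: "\<phi> \<in> Aut \<Longrightarrow> y \<in> Y \<Longrightarrow> minv \<phi> y \<in> Y"
  using Aut_bij[of \<phi>] by (simp add: minv_def bij_betw_def inv_into_into)

lemma minv_Aut: 
  assumes "\<phi> \<in> Aut"
  shows "minv \<phi> \<in> Aut"
proof -
  have "minv \<phi> (\<delta> y j) = \<delta> (minv \<phi> y) j" if "y \<in> Y" "j < k" for y j
  proof -
    have "minv \<phi> (\<delta> (\<phi> (minv \<phi> y)) j) = minv \<phi> (\<phi> (\<delta> (minv \<phi> y) j))"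
      using assms minv_closed[OF assms that(1)] that by (simp add: Aut_def)
    then show ?thesis using assms that by (simp add: minv_right minv_left minv_closed \<delta>_closed)
  qed
  then show ?thesis using minv_closed[OF assms] by (auto simp: Aut_def minv_def)
qed

end

section \<open>Parallelepipeds of words\<close>

definition cube :: "nat \<Rightarrow> (nat \<Rightarrow> nat) set" where
  "cube d = {1..d} \<rightarrow>\<^sub>E {0, 1}"

definition box :: "nat \<Rightarrow> nat \<Rightarrow> (nat \<Rightarrow> nat) set" where
  "box d K = {..d} \<rightarrow>\<^sub>E {..<K}"

definition vert :: "nat \<Rightarrow> (nat \<Rightarrow> nat) \<Rightarrow> (nat \<Rightarrow> nat) \<Rightarrow> nat" where
  "vert d m \<omega> = m 0 + (\<Sum>i=1..d. \<omega> i * m i)"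

lemma finite_cube: "finite (cube d)"
  by (simp add: cube_def finite_PiE)

lemma finite_box: "finite (box d K)"
  by (simp add: box_def finite_PiE)

lemma card_box: "card (box d K) = K ^ (d + 1)"
  by (simp add: box_def card_PiE)

lemma box_less: "m \<in> box d K \<Longrightarrow> i \<le> d \<Longrightarrow> m i < K"
  by (auto simp: box_def)

lemma cube_le_1: "\<omega> \<in> cube d \<Longrightarrow> i \<in> {1..d} \<Longrightarrow> \<omega> i \<le> 1"
  using PiE_mem[of \<omega> "{1..d}" "\<lambda>_. {0, 1}" i] by (auto simp: cube_def)

lemma vert_restrict: "vert d (restrict m {..d}) \<omega> = vert d m \<omega>"
  by (simp add: vert_def)

lemma vert_append: "vert d (\<lambda>i. m i * K + m' i) \<omega> = vert d m \<omega> * K + vert d m' \<omega>"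
  by (simp add: vert_def algebra_simps sum.distrib sum_distrib_left)

text \<open>The \<open>d + 1\<close> summands are at most \<open>K - 1\<close> each and the incoming
  carry is at most \<open>d\<close>, which together stay below \<open>(d + 1) * K\<close>. So the
  bound \<open>d\<close> on carries reproduces itself.\<close>

lemma vert_carry_le:
  assumes "m \<in> box d K" "\<omega> \<in> cube d" "r \<le> d"
  shows "(vert d m \<omega> + r) div K \<le> d"
proof -
  have K: "K > 0" using box_less[OF assms(1), of 0] by simp
  have "(\<Sum>i=1..d. \<omega> i * m i) \<le> (\<Sum>i=1..d. K - 1)"
  proof (rule sum_mono)
    fix i assume i: "i \<in> {1..d}"
    have "\<omega> i * m i \<le> 1 * (K - 1)"
      using cube_le_1[OF assms(2) i] box_less[OF assms(1), of i] i by (intro mult_mono) auto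
    then show "\<omega> i * m i \<le> K - 1" by simp
  qed
  moreover have "m 0 \<le> K - 1" using box_less[OF assms(1), of 0] by simp
  ultimately have "vert d m \<omega> + r \<le> (K - 1) + d * (K - 1) + d"
    using assms(3) by (simp add: vert_def)
  also have "\<dots> = (K - 1) + d * K" using K by (cases K) (auto simp: algebra_simps)
  also have "\<dots> < (d + 1) * K" using K by simp
  finally show ?thesis using K by (metis Suc_eq_plus1 less_Suc_eq_le less_mult_imp_div_less)
qed

context transitive_automaton
begin

text \<open>By \<open>vert_carry_le\<close> only carries up to \<open>d\<close> occur. Up to the
  irrelevant values there are therefore finitely many configurations, which later gives a uniform
  number of digits.\<close>

definition config :: "nat \<Rightarrow> ((nat \<Rightarrow> nat) \<Rightarrow> nat \<Rightarrow> 'y) \<Rightarrow> bool" where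
  "config d z \<longleftrightarrow> (\<forall>\<omega>\<in>cube d. \<forall>r\<le>d. z \<omega> r \<in> Y)"

text \<open>\<open>z \<omega> r\<close> is the state reached at vertex \<open>\<omega>\<close> when the carry from the digits still to
  be read is \<open>r\<close>; a step reads \<open>L\<close> further digits of all the \<open>n\<^sub>i\<close>.\<close>

definition step ::
  "nat \<Rightarrow> nat \<Rightarrow> (nat \<Rightarrow> nat) \<Rightarrow> ((nat \<Rightarrow> nat) \<Rightarrow> nat \<Rightarrow> 'y) \<Rightarrow> (nat \<Rightarrow> nat) \<Rightarrow> nat \<Rightarrow> 'y" where
  "step d L m z \<omega> r = R L (vert d m \<omega> + r) (z \<omega> ((vert d m \<omega> + r) div k ^ L))"

lemma step_config: "config d z \<Longrightarrow> m \<in> box d (k ^ L) \<Longrightarrow> config d (step d L m z)"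
  by (auto simp: config_def step_def intro!: run_closed vert_carry_le)

definition pathcat :: "nat \<Rightarrow> nat \<Rightarrow> (nat \<Rightarrow> nat) \<Rightarrow> (nat \<Rightarrow> nat) \<Rightarrow> nat \<Rightarrow> nat" where
  "pathcat d L' m m' = (\<lambda>i\<in>{..d}. m i * k ^ L' + m' i)"

lemma pathcat_box:
  "m \<in> box d (k ^ L) \<Longrightarrow> m' \<in> box d (k ^ L') \<Longrightarrow> pathcat d L' m m' \<in> box d (k ^ (L + L'))"
  by (auto simp: box_def pathcat_def intro!: number_append_less)

text \<open>The carry out of the lower block enters the upper block as its \<open>r\<close>, so two
  steps amount to one step along the coordinatewise concatenation.\<close>

lemma step_step:
  "step d L' m' (step d L m z) \<omega> r = step d (L + L') (pathcat d L' m m') z \<omega> r"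
proof -
  define v where "v = vert d m' \<omega> + r"
  define V where "V = vert d m \<omega> * k ^ L' + v"
  have V: "vert d (pathcat d L' m m') \<omega> + r = V"
    by (simp add: pathcat_def vert_restrict vert_append V_def v_def)
  have 1: "V div k ^ L' = vert d m \<omega> + v div k ^ L'"
    using power_k_pos[of L'] by (simp add: V_def)
  have 2: "V div k ^ (L + L') = (vert d m \<omega> + v div k ^ L') div k ^ L"
    by (simp add: power_add mult.commute[of "k ^ L"] div_mult2_eq 1)
  have 3: "R L' V y = R L' v y" for y
    using run_shift[OF k_pos, of \<delta> L' v "vert d m \<omega>"] by (simp add: V_def add.commute)
  show ?thesis
    by (simp add: step_def V run_add 1 2 3 v_def[symmetric])
qed

lemma step_cong:
  assumes "m \<in> box d (k ^ L)" "\<And>\<omega> r. \<omega> \<in> cube d \<Longrightarrow> r \<le> d \<Longrightarrow> z \<omega> r = z' \<omega> r"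
    "\<omega> \<in> cube d" "r \<le> d"
  shows "step d L m z \<omega> r = step d L m z' \<omega> r"
  using assms vert_carry_le[OF assms(1,3,4)] by (simp add: step_def)

text \<open>A step mixes the carries but never the vertices, so a different automorphism is allowed
  at each vertex.\<close>

lemma step_equivariant:
  assumes "config d z" "m \<in> box d (k ^ L)" "\<gamma> \<omega> \<in> Aut" "\<omega> \<in> cube d" "r \<le> d"
  shows "step d L m (\<lambda>\<omega> r. \<gamma> \<omega> (z \<omega> r)) \<omega> r = \<gamma> \<omega> (step d L m z \<omega> r)"
  using assms vert_carry_le[OF assms(2,4,5)] by (simp add: step_def Aut_run config_def)

section \<open>Free shifts and their group structure\<close>

definition differ ::
  "nat \<Rightarrow> ((nat \<Rightarrow> nat) \<Rightarrow> nat \<Rightarrow> 'y) \<Rightarrow> ((nat \<Rightarrow> nat) \<Rightarrow> 'y \<Rightarrow> 'y) \<Rightarrow> bool" where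
  "differ d z \<gamma> \<longleftrightarrow> (\<exists>L. \<exists>m\<in>box d (k ^ L). \<exists>m'\<in>box d (k ^ L). \<forall>\<omega>\<in>cube d. \<forall>r\<le>d.
     step d L m' z \<omega> r = \<gamma> \<omega> (step d L m z \<omega> r))"

text \<open>One \<open>\<gamma> \<omega>\<close> serves all carries \<open>r\<close>: only then does
  the relation survive further steps, whatever carries they bring.\<close>

definition free_shift :: "nat \<Rightarrow> ((nat \<Rightarrow> nat) \<Rightarrow> 'y \<Rightarrow> 'y) \<Rightarrow> bool" where
  "free_shift d \<gamma> \<longleftrightarrow> (\<forall>\<omega>\<in>cube d. \<gamma> \<omega> \<in> Aut) \<and> (\<forall>z. config d z \<longrightarrow> differ d z \<gamma>)"

lemma differ_cong:
  assumes "config d z" "differ d z \<gamma>" "\<And>\<omega> y. \<omega> \<in> cube d \<Longrightarrow> y \<in> Y \<Longrightarrow> \<gamma> \<omega> y = \<gamma>' \<omega> y"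
  shows "differ d z \<gamma>'"
proof -
  obtain L m m' where m: "m \<in> box d (k ^ L)" "m' \<in> box d (k ^ L)"
    and e: "\<forall>\<omega>\<in>cube d. \<forall>r\<le>d. step d L m' z \<omega> r = \<gamma> \<omega> (step d L m z \<omega> r)"
    using assms(2) by (auto simp: differ_def)
  have "config d (step d L m z)" using assms(1) m by (simp add: step_config)
  then have "\<forall>\<omega>\<in>cube d. \<forall>r\<le>d. step d L m' z \<omega> r = \<gamma>' \<omega> (step d L m z \<omega> r)"
    using e assms(3) by (simp add: config_def)
  then show ?thesis using m by (auto simp: differ_def)
qed

text \<open>Continue the two paths for \<open>\<gamma>\<close> by paths for \<open>\<gamma>'\<close>
  chosen at the end of the first one; equivariance moves \<open>\<gamma>\<close> past the second
  block. Only \<open>\<gamma>'\<close> has to be free: \<open>\<gamma>\<close> may be special to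
  \<open>z\<close>, as it is in \<open>vertex_group_rule\<close>.\<close>

lemma differ_mul:
  assumes "config d z" "\<forall>\<omega>\<in>cube d. \<gamma> \<omega> \<in> Aut" "differ d z \<gamma>" "free_shift d \<gamma>'"
  shows "differ d z (\<lambda>\<omega>. \<gamma> \<omega> \<cdot> \<gamma>' \<omega>)"
proof -
  obtain L m m' where m: "m \<in> box d (k ^ L)" "m' \<in> box d (k ^ L)"
    and e: "\<And>\<omega> r. \<omega> \<in> cube d \<Longrightarrow> r \<le> d \<Longrightarrow> step d L m' z \<omega> r = \<gamma> \<omega> (step d L m z \<omega> r)"
    using assms(3) by (auto simp: differ_def)
  have z1: "config d (step d L m z)" using assms(1) m by (simp add: step_config)
  then obtain L' p p' where p: "p \<in> box d (k ^ L')" "p' \<in> box d (k ^ L')"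
    and e': "\<And>\<omega> r. \<omega> \<in> cube d \<Longrightarrow> r \<le> d \<Longrightarrow>
      step d L' p' (step d L m z) \<omega> r = \<gamma>' \<omega> (step d L' p (step d L m z) \<omega> r)"
    using assms(4) unfolding free_shift_def differ_def by blast
  have "step d (L + L') (pathcat d L' m' p') z \<omega> r
      = (\<gamma> \<omega> \<cdot> \<gamma>' \<omega>) (step d (L + L') (pathcat d L' m p) z \<omega> r)"
    if w: "\<omega> \<in> cube d" "r \<le> d" for \<omega> r
  proof -
    have "step d (L + L') (pathcat d L' m' p') z \<omega> r = step d L' p' (step d L m' z) \<omega> r"
      by (simp add: step_step)
    also have "\<dots> = step d L' p' (\<lambda>\<omega> r. \<gamma> \<omega> (step d L m z \<omega> r)) \<omega> r"
      using e by (intro step_cong p w) auto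
    also have "\<dots> = \<gamma> \<omega> (step d L' p' (step d L m z) \<omega> r)"
      using assms(2) w by (intro step_equivariant z1 p) auto
    also have "\<dots> = \<gamma> \<omega> (\<gamma>' \<omega> (step d L' p (step d L m z) \<omega> r))" using e' w by simp
    also have "\<dots> = (\<gamma> \<omega> \<cdot> \<gamma>' \<omega>) (step d L' p (step d L m z) \<omega> r)"
      using step_config[OF z1 p(1)] w by (simp add: mul_apply config_def)
    finally show ?thesis by (simp add: step_step)
  qed
  then show ?thesis using pathcat_box[OF m(1) p(1)] pathcat_box[OF m(2) p(2)]
    unfolding differ_def by blast
qed

lemma free_shift_mul:
  assumes "free_shift d \<gamma>" "free_shift d \<gamma>'"
  shows "free_shift d (\<lambda>\<omega>. \<gamma> \<omega> \<cdot> \<gamma>' \<omega>)"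
  using assms differ_mul[of d _ \<gamma> \<gamma>'] by (auto simp: free_shift_def mul_Aut)

lemma free_shift_cong:
  assumes "free_shift d \<gamma>" "\<And>\<omega>. \<omega> \<in> cube d \<Longrightarrow> \<gamma> \<omega> = \<gamma>' \<omega>"
  shows "free_shift d \<gamma>'"
  using assms differ_cong[of d _ \<gamma> \<gamma>'] by (auto simp: free_shift_def)

lemma free_shift_one: "free_shift d (\<lambda>\<omega>. one)"
proof -
  have "differ d z (\<lambda>\<omega>. one)" if "config d z" for z
    unfolding differ_def
    by (rule exI[of _ 0], rule bexI[of _ "\<lambda>i\<in>{..d}. 0"], rule bexI[of _ "\<lambda>i\<in>{..d}. 0"])
      (use that in \<open>auto simp: step_def config_def vert_restrict box_def vert_def\<close>)
  then show ?thesis by (simp add: free_shift_def)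
qed

lemma differ_minv:
  assumes "config d z" "\<forall>\<omega>\<in>cube d. \<gamma> \<omega> \<in> Aut" "differ d z \<gamma>"
  shows "differ d z (\<lambda>\<omega>. minv (\<gamma> \<omega>))"
proof -
  obtain L m m' where m: "m \<in> box d (k ^ L)" "m' \<in> box d (k ^ L)"
    and e: "\<And>\<omega> r. \<omega> \<in> cube d \<Longrightarrow> r \<le> d \<Longrightarrow> step d L m' z \<omega> r = \<gamma> \<omega> (step d L m z \<omega> r)"
    using assms(3) by (auto simp: differ_def)
  have "\<forall>\<omega>\<in>cube d. \<forall>r\<le>d. step d L m z \<omega> r = minv (\<gamma> \<omega>) (step d L m' z \<omega> r)"
    using e assms(2) step_config[OF assms(1) m(1)] by (simp add: minv_left config_def)
  with m show ?thesis unfolding differ_def by blast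
qed

lemma free_shift_minv: "free_shift d \<gamma> \<Longrightarrow> free_shift d (\<lambda>\<omega>. minv (\<gamma> \<omega>))"
  using differ_minv[of d _ \<gamma>] by (auto simp: free_shift_def minv_Aut)

text \<open>Freeness holds from every configuration, in particular from the translate of
  \<open>z\<close> by \<open>minv \<phi>\<close>; translating back conjugates the shift. This gives
  normality of \<open>H\<close>.\<close>

lemma free_shift_conj:
  assumes "free_shift d \<gamma>" "\<phi> \<in> Aut"
  shows "free_shift d (\<lambda>\<omega>. \<phi> \<cdot> (\<gamma> \<omega> \<cdot> minv \<phi>))"
  unfolding free_shift_def
proof (intro conjI allI impI ballI)
  show "\<phi> \<cdot> (\<gamma> \<omega> \<cdot> minv \<phi>) \<in> Aut" if "\<omega> \<in> cube d" for \<omega>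
    using assms that by (auto simp: free_shift_def mul_Aut minv_Aut)
  fix z assume z: "config d z"
  define z' where "z' = (\<lambda>\<omega> r. minv \<phi> (z \<omega> r))"
  have "config d z'" using z assms(2) by (auto simp: config_def z'_def minv_closed)
  then obtain L m m' where m: "m \<in> box d (k ^ L)" "m' \<in> box d (k ^ L)"
    and e: "\<And>\<omega> r. \<omega> \<in> cube d \<Longrightarrow> r \<le> d \<Longrightarrow> step d L m' z' \<omega> r = \<gamma> \<omega> (step d L m z' \<omega> r)"
    using assms(1) unfolding free_shift_def differ_def by blast
  have s: "step d L p z' \<omega> r = minv \<phi> (step d L p z \<omega> r)"
    if "p \<in> box d (k ^ L)" "\<omega> \<in> cube d" "r \<le> d" for p \<omega> r
    using step_equivariant[OF z that(1), of "\<lambda>_. minv \<phi>"] assms(2) that by (simp add: z'_def minv_Aut)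
  have "step d L m' z \<omega> r = (\<phi> \<cdot> (\<gamma> \<omega> \<cdot> minv \<phi>)) (step d L m z \<omega> r)"
    if w: "\<omega> \<in> cube d" "r \<le> d" for \<omega> r
  proof -
    have c: "step d L m z \<omega> r \<in> Y" "step d L m' z \<omega> r \<in> Y"
      using step_config[OF z] m w by (auto simp: config_def)
    have "step d L m' z \<omega> r = \<phi> (minv \<phi> (step d L m' z \<omega> r))"
      using c assms by (simp add: minv_right)
    also have "\<dots> = \<phi> (\<gamma> \<omega> (minv \<phi> (step d L m z \<omega> r)))"
      using e[OF w] s[OF m(1) w] s[OF m(2) w] by simp
    finally show ?thesis using c by (simp add: mul_apply)
  qed
  then show "differ d z (\<lambda>\<omega>. \<phi> \<cdot> (\<gamma> \<omega> \<cdot> minv \<phi>))" using m unfolding differ_def by blast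
qed

section \<open>The normal subgroup \<open>H\<close>\<close>

definition single :: "(nat \<Rightarrow> nat) \<Rightarrow> ('y \<Rightarrow> 'y) \<Rightarrow> (nat \<Rightarrow> nat) \<Rightarrow> 'y \<Rightarrow> 'y" where
  "single \<omega>' g \<omega> = (if \<omega> = \<omega>' then g else one)"

definition vertex_group :: "nat \<Rightarrow> ('y \<Rightarrow> 'y) set" where
  "vertex_group d = {g \<in> Aut. \<forall>\<omega>\<in>cube d. free_shift d (single \<omega> g)}"

text \<open>One group has to serve the Gowers norms of all orders, hence the intersection over all
  dimensions.\<close>

definition H :: "('y \<Rightarrow> 'y) set" where
  "H = {g \<in> Aut. \<forall>d. g \<in> vertex_group d}"

lemma mul_one [simp]: "g \<in> Aut \<Longrightarrow> one \<cdot> g = g" "g \<in> Aut \<Longrightarrow> g \<cdot> one = g"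
  by (auto intro!: extensionalityI[of _ Y] simp: Aut_extensional mul_apply Aut_closed)

lemma minv_one [simp]: "minv one = one"
proof (rule extensionalityI[of _ Y])
  fix y assume "y \<in> Y"
  then show "minv one y = one y" using minv_left[OF one_Aut, of y] by simp
qed (auto simp: minv_def one_def)

lemma conj_one: "\<phi> \<in> Aut \<Longrightarrow> \<phi> \<cdot> (one \<cdot> minv \<phi>) = one"
  by (rule extensionalityI[of _ Y]) (auto simp: mul_apply minv_right minv_closed one_def)

lemma H_Aut: "g \<in> H \<Longrightarrow> g \<in> Aut"
  by (simp add: H_def)

lemma finite_H: "finite H"
  using finite_Aut by (rule finite_subset[rotated]) (auto simp: H_def)

lemma one_H: "one \<in> H"
proof -
  have "free_shift d (single \<omega> one)" for d \<omega>
    by (rule free_shift_cong[OF free_shift_one]) (simp add: single_def)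
  then show ?thesis by (simp add: H_def vertex_group_def)
qed

lemma mul_H: "g \<in> H \<Longrightarrow> h \<in> H \<Longrightarrow> g \<cdot> h \<in> H"
proof -
  assume a: "g \<in> H" "h \<in> H"
  have "free_shift d (single \<omega> (g \<cdot> h))" if "\<omega> \<in> cube d" for d \<omega>
    by (rule free_shift_cong[OF free_shift_mul[of d "single \<omega> g" "single \<omega> h"]])
      (use a that in \<open>auto simp: single_def H_def vertex_group_def\<close>)
  then show ?thesis using a by (simp add: H_def vertex_group_def mul_Aut)
qed

lemma minv_H: "g \<in> H \<Longrightarrow> minv g \<in> H"
proof -
  assume a: "g \<in> H"
  have "free_shift d (single \<omega> (minv g))" if "\<omega> \<in> cube d" for d \<omega>
    by (rule free_shift_cong[OF free_shift_minv[of d "single \<omega> g"]])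
      (use a that in \<open>auto simp: single_def H_def vertex_group_def\<close>)
  then show ?thesis using a by (simp add: H_def vertex_group_def minv_Aut)
qed

lemma conj_H: "g \<in> H \<Longrightarrow> \<phi> \<in> Aut \<Longrightarrow> \<phi> \<cdot> (g \<cdot> minv \<phi>) \<in> H"
proof -
  assume a: "g \<in> H" "\<phi> \<in> Aut"
  have "free_shift d (single \<omega> (\<phi> \<cdot> (g \<cdot> minv \<phi>)))" if "\<omega> \<in> cube d" for d \<omega>
    by (rule free_shift_cong[OF free_shift_conj[of d "single \<omega> g" \<phi>]])
      (use a that in \<open>auto simp: single_def H_def vertex_group_def conj_one\<close>)
  then show ?thesis using a by (simp add: H_def vertex_group_def mul_Aut minv_Aut)
qed

text \<open>The family is a product of shifts at single vertices, so elements of \<open>H\<close>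
  can be prescribed independently at all vertices.\<close>

lemma free_shift_H:
  assumes "\<And>\<omega>. \<omega> \<in> cube d \<Longrightarrow> \<eta> \<omega> \<in> H"
  shows "free_shift d \<eta>"
proof -
  have "free_shift d (\<lambda>\<omega>. if \<omega> \<in> F then \<eta> \<omega> else one)" if "F \<subseteq> cube d" for F
    using finite_subset[OF that finite_cube] that
  proof (induction F rule: finite_induct)
    case empty
    then show ?case using free_shift_one by simp
  next
    case (insert \<omega>' F)
    have 1: "free_shift d (single \<omega>' (\<eta> \<omega>'))"
      using assms[of \<omega>'] insert by (simp add: H_def vertex_group_def)
    have 2: "free_shift d (\<lambda>\<omega>. if \<omega> \<in> F then \<eta> \<omega> else one)" using insert by simp
    show ?case
      by (rule free_shift_cong[OF free_shift_mul[OF 1 2]])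
        (use insert assms in \<open>auto simp: single_def H_def\<close>)
  qed
  from this[of "cube d"] show ?thesis by (rule free_shift_cong) auto
qed

text \<open>Take one failing dimension for each of the finitely many automorphisms outside
  \<open>H\<close>. The bound tells \<open>approx_Suc\<close> how many predecessors to
  control.\<close>

lemma H_bounded: "\<exists>D. \<forall>g\<in>Aut. (\<forall>d\<le>D. g \<in> vertex_group d) \<longrightarrow> g \<in> H"
proof -
  have "\<forall>g\<in>Aut. \<exists>d. g \<notin> H \<longrightarrow> g \<notin> vertex_group d" by (auto simp: H_def)
  then obtain d where d: "\<And>g. g \<in> Aut \<Longrightarrow> g \<notin> H \<Longrightarrow> g \<notin> vertex_group (d g)" by metis
  have "d g \<le> Max (d ` Aut)" if "g \<in> Aut" for g using that finite_Aut by simp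
  then show ?thesis using d by blast
qed

end

section \<open>Carries and periodicity\<close>

lemma less_power_self: "2 \<le> k \<Longrightarrow> n < (k::nat) ^ n"
  using less_exp[of n] power_mono[of 2 k n] by linarith

locale synchronising_extension = transitive_automaton +
  fixes lu xu :: nat
  assumes sync: "\<And>y y'. y \<in> Y \<Longrightarrow> y' \<in> Y \<Longrightarrow> \<exists>\<phi>\<in>Aut. R lu xu y' = \<phi> (R lu xu y)"
    and xu_less: "xu < k ^ lu"
begin

text \<open>Equality modulo \<open>H\<close> cannot be asked of \<open>y1\<close> and
  \<open>y2\<close> themselves, as they may lie in different orbits of \<open>Aut\<close>; after the
  synchronising word they do not. Allowing any word before it makes the relation a congruence for
  reading.\<close>

definition approx :: "'a \<Rightarrow> 'a \<Rightarrow> bool" (infix \<open>\<approx>\<close> 50) where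
  "y1 \<approx> y2 \<longleftrightarrow> (\<forall>b x. x < k ^ b \<longrightarrow> (\<exists>h\<in>H. R lu xu (R b x y2) = h (R lu xu (R b x y1))))"

lemma approxD:
  "y1 \<approx> y2 \<Longrightarrow> x < k ^ b \<Longrightarrow> \<exists>h\<in>H. R lu xu (R b x y2) = h (R lu xu (R b x y1))"
  by (simp add: approx_def)

lemma approx_refl: "y \<in> Y \<Longrightarrow> y \<approx> y"
  unfolding approx_def by (intro allI impI bexI[of _ one]) (simp_all add: one_H run_closed)

lemma approx_sym:
  assumes "y1 \<in> Y" "y1 \<approx> y2" shows "y2 \<approx> y1"
  unfolding approx_def
proof (intro allI impI)
  fix b x assume "x < k ^ b"
  then obtain h where h: "h \<in> H" "R lu xu (R b x y2) = h (R lu xu (R b x y1))"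
    using assms(2) unfolding approx_def by blast
  then have "R lu xu (R b x y1) = minv h (R lu xu (R b x y2))"
    using assms(1) minv_left[OF H_Aut[OF h(1)]] run_closed by presburger
  then show "\<exists>h\<in>H. R lu xu (R b x y1) = h (R lu xu (R b x y2))"
    using minv_H[OF h(1)] by blast
qed

lemma approx_trans:
  assumes "y1 \<in> Y" "y1 \<approx> y2" "y2 \<approx> y3" shows "y1 \<approx> y3"
  unfolding approx_def
proof (intro allI impI)
  fix b x assume x: "x < k ^ b"
  obtain h where h: "h \<in> H" "R lu xu (R b x y2) = h (R lu xu (R b x y1))"
    using x assms(2) unfolding approx_def by blast
  obtain h' where h': "h' \<in> H" "R lu xu (R b x y3) = h' (R lu xu (R b x y2))"
    using x assms(3) unfolding approx_def by blast
  have "R lu xu (R b x y3) = (h' \<cdot> h) (R lu xu (R b x y1))"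
    by (simp add: h h' mul_apply run_closed assms(1))
  then show "\<exists>h\<in>H. R lu xu (R b x y3) = h (R lu xu (R b x y1))"
    using mul_H[OF h'(1) h(1)] by blast
qed

lemma approx_run:
  assumes "y1 \<approx> y2" shows "R L x y1 \<approx> R L x y2"
  unfolding approx_def
proof (intro allI impI)
  fix b x' assume x': "x' < k ^ b"
  have "x mod k ^ L * k ^ b + x' < k ^ (L + b)"
    using x' power_k_pos by (intro number_append_less) auto
  moreover have "R b x' (R L x y) = R (L + b) (x mod k ^ L * k ^ b + x') y" for y
    using x' by (simp add: run_append k_pos run_mod)
  ultimately show "\<exists>h\<in>H. R lu xu (R b x' (R L x y2)) = h (R lu xu (R b x' (R L x y1)))"
    using assms unfolding approx_def by presburger
qed

text \<open>Since the automorphisms act freely, the one relating \<open>R lu xu (R b x y1)\<close> to \<open>R lu xu (R b x y2)\<close>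
  can be read off after any longer word.\<close>

lemma approx_if_extensions:
  assumes "y1 \<in> Y" "y2 \<in> Y" "\<And>w. w < k ^ c \<Longrightarrow> R c w y1 \<approx> R c w y2"
  shows "y1 \<approx> y2"
  unfolding approx_def
proof (intro allI impI)
  fix b x assume x: "x < k ^ b"
  obtain g where g: "g \<in> Aut" "R lu xu (R b x y2) = g (R lu xu (R b x y1))"
    using sync[of "R b x y1" "R b x y2"] assms run_closed by blast
  \<comment> \<open>The digits of \<open>x\<close>, the synchronising word and \<open>c\<close>
    zeros, to be split again after the first \<open>c\<close> digits: those form the extension
    \<open>w\<close> to which the hypothesis applies.\<close>
  define V where "V = (x * k ^ lu + xu) * k ^ c"
  have len: "b + lu + c = c + (b + lu)" by simp
  have V: "R c 0 (R lu xu (R b x y)) = R (b + lu) V (R c (V div k ^ (b + lu) mod k ^ c) y)" for y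
  proof -
    have "R c 0 (R lu xu (R b x y)) = R (b + lu + c) V y"
      using run_append[OF k_pos, of 0 c \<delta> "b + lu" "x * k ^ lu + xu" y] xu_less power_k_pos[of c]
      by (simp add: V_def run_append k_pos)
    also have "\<dots> = R (b + lu) V (R c (V div k ^ (b + lu) mod k ^ c) y)"
      unfolding len by (simp add: run_add run_mod k_pos)
    finally show ?thesis .
  qed
  have "R c (V div k ^ (b + lu) mod k ^ c) y1 \<approx> R c (V div k ^ (b + lu) mod k ^ c) y2"
    using power_k_pos by (intro assms(3)) auto
  then have "R c 0 (R lu xu (R b x y1)) \<approx> R c 0 (R lu xu (R b x y2))"
    unfolding V by (rule approx_run)
  then obtain h where h: "h \<in> H" "R lu xu (R c 0 (R lu xu (R b x y2))) = h (R lu xu (R c 0 (R lu xu (R b x y1))))"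
    using approxD[of _ _ 0 0] by auto
  have "R lu xu (R c 0 (R lu xu (R b x y2))) = g (R lu xu (R c 0 (R lu xu (R b x y1))))"
    using g assms by (simp add: Aut_run run_closed)
  then have "g = h"
    using h g assms by (intro Aut_eqI[of g h "R lu xu (R c 0 (R lu xu (R b x y1)))"])
      (auto simp: run_closed H_Aut)
  with g h show "\<exists>h\<in>H. R lu xu (R b x y2) = h (R lu xu (R b x y1))" by blast
qed

text \<open>Vertex \<open>\<omega>\<close> of the constructed parallelepiped reads the digits of \<open>s - j\<close> with
  \<open>j\<close> the Hamming distance from \<open>\<omega>\<close> to \<open>\<omega>'\<close>, so only the vertex \<open>\<omega>'\<close> notices the effect of \<open>g\<close>.\<close>

lemma vertex_group_rule:
  assumes y: "y \<in> Y" and s: "s < k ^ l" "s' < k ^ l" "d \<le> s" "d \<le> s'"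
    and near: "\<And>j. 1 \<le> j \<Longrightarrow> j \<le> d \<Longrightarrow> R l (s - j) y \<approx> R l (s' - j) y"
    and g: "g \<in> Aut" and x: "x < k ^ b"
    and eq: "R lu xu (R b x (R l s' y)) = g (R lu xu (R b x (R l s y)))"
  shows "g \<in> vertex_group d"
proof -
  have "differ d z (single \<omega>' g)" if \<omega>': "\<omega>' \<in> cube d" and z: "config d z" for \<omega>' z
  proof -
    have z0: "z \<omega>' 0 \<in> Y" using \<omega>' z by (simp add: config_def)
    \<comment> \<open>Once the synchronising word has been read, this word leads to \<open>y\<close>
      at \<open>\<omega>'\<close>, and hence to an automorphic image of \<open>y\<close> at every
      other vertex.\<close>
    obtain l1 V where V: "V < k ^ l1" "R l1 V (R lu xu (z \<omega>' 0)) = y"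
      using transitive y run_closed[OF z0] by blast
    define lp U where "lp = lu + l1" and "U = xu * k ^ l1 + V"
    have U: "U < k ^ lp" using V xu_less by (simp add: U_def lp_def number_append_less)
    \<comment> \<open>\<open>N \<omega>\<close> will be the carry out of the top digit at
      \<open>\<omega>\<close>, so it is the index at which \<open>z\<close> is consulted
      there.\<close>
    define N j where "N \<omega> = (\<Sum>i=1..d. if \<omega> i = 1 \<and> \<omega>' i = 0 then 1 else 0 :: nat)"
      and "j \<omega> = (\<Sum>i=1..d. if \<omega> i \<noteq> \<omega>' i then 1 else 0 :: nat)" for \<omega> :: "nat \<Rightarrow> nat"
    have N_le: "N \<omega> \<le> d" for \<omega>
      using sum_mono[of "{1..d}" "\<lambda>i. if \<omega> i = 1 \<and> \<omega>' i = 0 then 1 else 0 :: nat" "\<lambda>_. 1"] by (simp add: N_def)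
    have j_le: "j \<omega> \<le> d" for \<omega>
      using sum_mono[of "{1..d}" "\<lambda>i. if \<omega> i \<noteq> \<omega>' i then 1 else 0 :: nat" "\<lambda>_. 1"] by (simp add: j_def)
    have N0: "N \<omega>' = 0" and j0: "j \<omega>' = 0" by (auto simp: N_def j_def)
    have j_pos: "1 \<le> j \<omega>" if "\<omega> \<in> cube d" "\<omega> \<noteq> \<omega>'" for \<omega>
    proof (rule ccontr)
      assume "\<not> 1 \<le> j \<omega>"
      then have "j \<omega> = 0" by simp
      then have "\<And>i. i \<in> {1..d} \<Longrightarrow> \<omega> i = \<omega>' i"
        unfolding j_def by (subst (asm) sum_eq_0_iff) (auto split: if_splits)
      then have "\<omega> = \<omega>'" using that(1) \<omega>' unfolding cube_def by (rule PiE_ext[rotated 2]) auto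
      then show False using that by simp
    qed
    have "\<forall>\<omega>. \<exists>\<phi>. \<omega> \<in> cube d \<longrightarrow> \<phi> \<in> Aut \<and> R lu xu (z \<omega> (N \<omega>)) = \<phi> (R lu xu (z \<omega>' 0))"
      using sync[OF z0] z N_le unfolding config_def by blast
    then obtain \<phi> where \<phi>: "\<And>\<omega>. \<omega> \<in> cube d \<Longrightarrow> \<phi> \<omega> \<in> Aut"
      "\<And>\<omega>. \<omega> \<in> cube d \<Longrightarrow> R lu xu (z \<omega> (N \<omega>)) = \<phi> \<omega> (R lu xu (z \<omega>' 0))" by metis
    have \<phi>1: "\<phi> \<omega>' = one"
      using \<phi>[OF \<omega>'] z0 N0 by (intro Aut_eqI[of _ one "R lu xu (z \<omega>' 0)"]) (auto simp: run_closed)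
    have pre: "R lp U (z \<omega> (N \<omega>)) = \<phi> \<omega> y" if "\<omega> \<in> cube d" for \<omega>
    proof -
      have "R lp U (z \<omega> (N \<omega>)) = R l1 V (\<phi> \<omega> (R lu xu (z \<omega>' 0)))"
        using V \<phi>(2)[OF that] by (simp add: lp_def U_def run_append k_pos)
      also have "\<dots> = \<phi> \<omega> y"
        using Aut_run[OF \<phi>(1)[OF that] run_closed[OF z0], of l1 V lu xu] V by simp
      finally show ?thesis .
    qed
    define B L where "B = b + lu + d" and "L = lp + l + b + lu + d"
    \<comment> \<open>The last \<open>d\<close> digits absorb the incoming carry
      \<open>r \<le> d < k ^ d\<close>, so it never reaches the digits of \<open>xu\<close>. One
      unit of \<open>t\<close> weighs \<open>k ^ B\<close>.\<close>
    define num where "num t r = (((U * k ^ l + t) * k ^ b + x) * k ^ lu + xu) * k ^ d + r" for t r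
    have r_less: "r < k ^ d" if "r \<le> d" for r
      using less_power_self[OF k_ge_2, of d] that by simp
    have num_less: "num t r < k ^ L" if "t < k ^ l" "r \<le> d" for t r
      unfolding num_def L_def using U x xu_less that r_less by (intro number_append_less) auto
    have num_read: "R L (num t r) y' = R d r (R lu xu (R b x (R l t (R lp U y'))))"
      if "t < k ^ l" "r \<le> d" for t r y'
      unfolding num_def L_def using x xu_less that r_less by (simp add: run_append k_pos)
    have num_diff: "num (t - i) r + i * k ^ B = num t r" if "i \<le> t" for t i r
    proof -
      have "num t r = (((U * k ^ l + (t - i + i)) * k ^ b + x) * k ^ lu + xu) * k ^ d + r"
        using that by (simp add: num_def)
      then show ?thesis by (simp add: num_def B_def algebra_simps power_add)
    qed
    define W where "W = (\<Sum>i=1..d. \<omega>' i)"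
    have W_le: "W \<le> d"
      using sum_mono[of "{1..d}" \<omega>' "\<lambda>_. 1"] cube_le_1[OF \<omega>'] by (simp add: W_def)
    \<comment> \<open>Modulo \<open>k ^ L\<close> every edge is plus or minus one unit of
      \<open>t\<close>, with the sign that makes \<open>t\<close> grow towards
      \<open>\<omega>'\<close>. Starting at \<open>t - W\<close> puts \<open>\<omega>'\<close>
      itself at \<open>t\<close>; the negative edges cause the carry
      \<open>N \<omega>\<close>.\<close>
    define m where "m t = (\<lambda>i\<in>{..d}. if i = 0 then num (t - W) 0 else if \<omega>' i = 1 then k ^ B else k ^ L - k ^ B)" for t
    have BL: "k ^ B \<le> k ^ L" unfolding B_def L_def using k_pos by (intro power_increasing) auto
    have m_box: "m t \<in> box d (k ^ L)" if "t < k ^ l" "d \<le> t" for t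
    proof -
      have "k ^ B < k ^ L" if "1 \<le> d"
      proof -
        have "l \<noteq> 0" using \<open>t < k ^ l\<close> \<open>d \<le> t\<close> that by (intro notI) simp
        then show ?thesis unfolding B_def L_def using k_ge_2 by (intro power_strict_increasing) auto
      qed
      moreover have "k ^ L - k ^ B < k ^ L" using power_k_pos by simp
      moreover have "num (t - W) 0 < k ^ L" using that by (intro num_less) auto
      ultimately show ?thesis by (auto simp: box_def m_def)
    qed
    have vert: "vert d (m t) \<omega> + r = num (t - j \<omega>) r + N \<omega> * k ^ L"
      if \<omega>: "\<omega> \<in> cube d" and t: "d \<le> t" for t \<omega> r
    proof -
      have "\<omega> i * m t i + (if \<omega> i \<noteq> \<omega>' i then 1 else 0) * k ^ B
        = \<omega>' i * k ^ B + (if \<omega> i = 1 \<and> \<omega>' i = 0 then 1 else 0) * k ^ L" if i: "i \<in> {1..d}" for i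
        using cube_le_1[OF \<omega> i] cube_le_1[OF \<omega>' i] i BL by (auto simp: m_def le_Suc_eq)
      then have "(\<Sum>i=1..d. \<omega> i * m t i + (if \<omega> i \<noteq> \<omega>' i then 1 else 0) * k ^ B)
        = (\<Sum>i=1..d. \<omega>' i * k ^ B + (if \<omega> i = 1 \<and> \<omega>' i = 0 then 1 else 0) * k ^ L)"
        by (intro sum.cong refl)
      then have "(\<Sum>i=1..d. \<omega> i * m t i) + j \<omega> * k ^ B = W * k ^ B + N \<omega> * k ^ L"
        by (simp only: sum.distrib j_def N_def W_def sum_distrib_right)
      moreover have "m t 0 + W * k ^ B = num t 0"
        using num_diff[of W t 0] W_le t by (simp add: m_def)
      moreover have "num (t - j \<omega>) r + j \<omega> * k ^ B = num t 0 + r"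
        using num_diff[of "j \<omega>" t r] j_le[of \<omega>] t by (simp add: num_def)
      ultimately show ?thesis by (simp add: vert_def)
    qed
    have st: "step d L (m t) z \<omega> r = \<phi> \<omega> (R d r (R lu xu (R b x (R l (t - j \<omega>) y))))"
      if \<omega>: "\<omega> \<in> cube d" and t: "t < k ^ l" "d \<le> t" and r: "r \<le> d" for t \<omega> r
    proof -
      have tj: "t - j \<omega> < k ^ l" using t by simp
      have "step d L (m t) z \<omega> r = R L (num (t - j \<omega>) r) (z \<omega> (N \<omega>))"
        using num_less[OF tj r] power_k_pos[of L] by (simp add: step_def vert[OF \<omega> t(2)] run_shift k_pos)
      also have "\<dots> = R d r (R lu xu (R b x (R l (t - j \<omega>) (\<phi> \<omega> y))))"
        by (simp add: num_read[OF tj r] pre[OF \<omega>])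
      finally show ?thesis using y by (simp add: Aut_run[OF \<phi>(1)[OF \<omega>]] run_closed)
    qed
    have "\<forall>\<omega>. \<exists>h. \<omega> \<in> cube d \<and> \<omega> \<noteq> \<omega>' \<longrightarrow> h \<in> H \<and>
       R lu xu (R b x (R l (s' - j \<omega>) y)) = h (R lu xu (R b x (R l (s - j \<omega>) y)))"
      using approxD[OF near[OF j_pos j_le] x] by blast
    then obtain h where h: "\<And>\<omega>. \<omega> \<in> cube d \<Longrightarrow> \<omega> \<noteq> \<omega>' \<Longrightarrow> h \<omega> \<in> H"
       "\<And>\<omega>. \<omega> \<in> cube d \<Longrightarrow> \<omega> \<noteq> \<omega>' \<Longrightarrow>
          R lu xu (R b x (R l (s' - j \<omega>) y)) = h \<omega> (R lu xu (R b x (R l (s - j \<omega>) y)))" by metis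
    \<comment> \<open>The difference \<open>h \<omega>\<close> is known for paths from
      \<open>y\<close>; at \<open>\<omega>\<close> they start at \<open>\<phi> \<omega> y\<close>,
      whence the conjugation.\<close>
    define \<eta> where "\<eta> \<omega> = (if \<omega> = \<omega>' then g else \<phi> \<omega> \<cdot> (h \<omega> \<cdot> minv (\<phi> \<omega>)))" for \<omega>
    have \<eta>H: "\<eta> \<omega> \<in> H" if "\<omega> \<in> cube d" "\<omega> \<noteq> \<omega>'" for \<omega>
      using that h \<phi> by (simp add: \<eta>_def conj_H)
    have \<eta>A: "\<forall>\<omega>\<in>cube d. \<eta> \<omega> \<in> Aut" using \<eta>H g H_Aut by (metis \<eta>_def)
    have "step d L (m s') z \<omega> r = \<eta> \<omega> (step d L (m s) z \<omega> r)"
      if \<omega>: "\<omega> \<in> cube d" and r: "r \<le> d" for \<omega> r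
    proof (cases "\<omega> = \<omega>'")
      case True
      then show ?thesis using eq y \<phi>1 s
        unfolding st[OF \<omega> s(2,4) r] st[OF \<omega> s(1,3) r]
        by (simp add: j0 \<eta>_def run_closed Aut_closed[OF g] Aut_run[OF g])
    next
      case False
      then show ?thesis using h(2)[OF \<omega> False] y \<phi>(1)[OF \<omega>]
        unfolding st[OF \<omega> s(2,4) r] st[OF \<omega> s(1,3) r]
        by (simp add: \<eta>_def run_closed mul_apply minv_left Aut_closed
          Aut_run[OF H_Aut[OF h(1)[OF \<omega> False]]])
    qed
    then have 1: "differ d z \<eta>" using m_box[OF s(1,3)] m_box[OF s(2,4)] unfolding differ_def by blast
    \<comment> \<open>Away from \<open>\<omega>'\<close> the values of \<open>\<eta>\<close> are in
      \<open>H\<close> by normality, so their inverses form a free shift; multiplying by it leaves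
      \<open>g\<close> at \<open>\<omega>'\<close> alone.\<close>
    define \<eta>' where "\<eta>' \<omega> = (if \<omega> = \<omega>' then one else minv (\<eta> \<omega>))" for \<omega>
    have "free_shift d \<eta>'"
      using \<eta>H by (intro free_shift_H) (auto simp: \<eta>'_def one_H minv_H)
    from differ_mul[OF z \<eta>A 1 this] show ?thesis
    proof (rule differ_cong[OF z])
      fix \<omega> y assume "\<omega> \<in> cube d" "y \<in> Y"
      then show "(\<eta> \<omega> \<cdot> \<eta>' \<omega>) y = single \<omega>' g \<omega> y"
        using \<eta>A by (auto simp: \<eta>'_def single_def mul_apply minv_right) (simp add: \<eta>_def)
    qed
  qed
  then show ?thesis using g by (auto simp: vertex_group_def free_shift_def single_def)
qed

text \<open>Append \<open>D\<close> digits to \<open>s\<close> and \<open>s'\<close>, with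
  \<open>D\<close> from \<open>H_bounded\<close>. Beyond \<open>k ^ D\<close> the relation spreads
  from the preceding \<open>D\<close> numbers by \<open>vertex_group_rule\<close>, and
  \<open>approx_if_extensions\<close> strips the digits again.\<close>

lemma approx_Suc:
  assumes y: "y \<in> Y" and l: "s + 1 < k ^ l" "s' + 1 < k ^ l" and e: "R l s y \<approx> R l s' y"
  shows "R l (s + 1) y \<approx> R l (s' + 1) y"
proof -
  obtain D where D: "\<And>g. g \<in> Aut \<Longrightarrow> (\<forall>d\<le>D. g \<in> vertex_group d) \<Longrightarrow> g \<in> H"
    using H_bounded by blast
  have kD: "D < k ^ D" using less_power_self k_ge_2 by simp
  have less: "t * k ^ D + i < k ^ (l + D)" if "t + 1 < k ^ l" "i < 2 * k ^ D" for t i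
  proof -
    have "t * k ^ D + i < (t + 2) * k ^ D" using that by (simp add: algebra_simps)
    also have "\<dots> \<le> k ^ l * k ^ D" using that by (intro mult_right_mono) auto
    finally show ?thesis by (simp add: power_add)
  qed
  \<comment> \<open>For \<open>i < k ^ D\<close> these numbers extend \<open>s\<close> and
    \<open>s'\<close>, for larger \<open>i\<close> their successors. In the second range
    \<open>D < k ^ D \<le> i\<close>, so subtracting up to \<open>D\<close> stays within the
    induction.\<close>
  have run: "R (l + D) (s * k ^ D + i) y \<approx> R (l + D) (s' * k ^ D + i) y" if "i < 2 * k ^ D" for i
    using that
  proof (induction i rule: less_induct)
    case (less i)
    show ?case
    proof (cases "i < k ^ D")
      case True
      then show ?thesis using e by (simp add: run_append k_pos approx_run)
    next
      case False
      show ?thesis unfolding approx_def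
      proof (intro allI impI)
        fix b x assume x: "x < k ^ b"
        let ?A = "R (l + D) (s * k ^ D + i) y" and ?B = "R (l + D) (s' * k ^ D + i) y"
        obtain g where g: "g \<in> Aut" "R lu xu (R b x ?B) = g (R lu xu (R b x ?A))"
          using sync[of "R b x ?A" "R b x ?B"] y run_closed by blast
        have "g \<in> vertex_group d" if d: "d \<le> D" for d
        proof (rule vertex_group_rule[OF y _ _ _ _ _ g(1) x g(2)])
          show "R (l + D) (s * k ^ D + i - j) y \<approx> R (l + D) (s' * k ^ D + i - j) y"
            if "1 \<le> j" "j \<le> d" for j
            using less.IH[of "i - j"] less.prems False that d kD by simp
        qed (use \<open>\<And>t i. t + 1 < k ^ l \<Longrightarrow> i < 2 * k ^ D \<Longrightarrow> t * k ^ D + i < k ^ (l + D)\<close> l less.prems False d kD in auto)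
        with D g show "\<exists>h\<in>H. R lu xu (R b x ?B) = h (R lu xu (R b x ?A))" by blast
      qed
    qed
  qed
  show ?thesis
  proof (rule approx_if_extensions[where c = D])
    fix w assume "w < k ^ D"
    then show "R D w (R l (s + 1) y) \<approx> R D w (R l (s' + 1) y)"
      using run[of "k ^ D + w"] by (simp add: algebra_simps flip: run_append[OF k_pos, of w D])
  qed (use y run_closed in auto)
qed

end

section \<open>Eventual periodicity of the classes\<close>

context synchronising_extension
begin

lemma approx_shift:
  assumes "y \<in> Y" "R L s y \<approx> R L s' y" "s + t < k ^ L" "s' + t < k ^ L"
  shows "R L (s + t) y \<approx> R L (s' + t) y"
  using assms(3,4)
proof (induction t)
  case (Suc t)
  then show ?case using approx_Suc[of y "s + t" L "s' + t"] assms(1) by simp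
qed (use assms in simp)

lemma approx_multiples:
  assumes y: "y \<in> Y" and e: "R L c y \<approx> R L (c + q) y" and x: "c \<le> x" "x + t * q < k ^ L"
  shows "R L x y \<approx> R L (x + t * q) y"
  using x(2)
proof (induction t)
  case 0
  show ?case using y by (simp add: approx_refl run_closed)
next
  case (Suc t)
  have "R L (c + (x - c + t * q)) y \<approx> R L (c + q + (x - c + t * q)) y"
    using Suc.prems x(1) by (intro approx_shift y e) auto
  then have "R L (x + t * q) y \<approx> R L (x + Suc t * q) y"
    using x(1) by (simp add: algebra_simps)
  then show ?case using Suc y by (auto intro: approx_trans[OF run_closed[OF y]])
qed

text \<open>\<open>approx_shift\<close> passes from the last digit 0 to any last digit
  \<open>w\<close>, and one further digit can be stripped by
  \<open>approx_if_extensions\<close>.\<close>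

lemma approx_if_next_level:
  assumes y: "y \<in> Y" and x: "x < k ^ L" "x' < k ^ L"
    and e: "R (Suc L) (x * k) y \<approx> R (Suc L) (x' * k) y"
  shows "R L x y \<approx> R L x' y"
proof (rule approx_if_extensions[where c = 1])
  fix w assume w: "w < k ^ 1"
  have "R (Suc L) (x * k + w) y \<approx> R (Suc L) (x' * k + w) y"
    using number_append_less[OF x(1) w] number_append_less[OF x(2) w]
    by (intro approx_shift y e) auto
  then show "R 1 w (R L x y) \<approx> R 1 w (R L x' y)"
    using w run_append[OF k_pos w, of \<delta> L x y] run_append[OF k_pos w, of \<delta> L x' y] by simp
qed (use y run_closed in auto)

text \<open>By \<open>approx_Suc\<close> the \<open>\<approx>\<close>-class of \<open>R L s y\<close> determines that of \<open>R L (s + 1) y\<close>, so the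
  classes are eventually periodic in \<open>s\<close>.  The minimal periods do not decrease with \<open>L\<close>,
  and a stable one is coprime to \<open>k\<close> since otherwise the previous level had a smaller one.\<close>

lemma approx_periodic:
  assumes y: "y \<in> Y"
  shows "\<exists>q>0. coprime q k \<and> (\<exists>l. \<forall>L\<ge>l. \<forall>s s'. card Y \<le> s \<and> card Y \<le> s' \<and>
    s < k ^ L \<and> s' < k ^ L \<and> s mod q = s' mod q \<longrightarrow> R L s y \<approx> R L s' y)"
proof -
  \<comment> \<open>Among \<open>0, ..., C\<close> two numbers lead to the same state, so a period
    of at most \<open>C\<close> has set in by \<open>C\<close>. From level \<open>l0\<close> on,
    \<open>2 * C < k ^ L\<close> keeps \<open>C\<close> plus such a period within \<open>L\<close>
    digits.\<close>
  define C where "C = card Y"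
  define l0 where "l0 = 2 * C + 1"
  have big: "2 * C < k ^ L" if "l0 \<le> L" for L
  proof -
    have "2 * C < k ^ l0" using less_power_self[OF k_ge_2, of l0] by (simp add: l0_def)
    also have "\<dots> \<le> k ^ L" using that k_pos by (intro power_increasing) auto
    finally show ?thesis .
  qed
  define P where "P L e \<longleftrightarrow> 1 \<le> e \<and> R L C y \<approx> R L (C + e) y" for L e
  define \<mu> where "\<mu> L = (LEAST e. P L e)" for L
  have ex: "\<exists>e\<le>C. P L e" if L: "l0 \<le> L" for L
  proof -
    have "card ((\<lambda>s. R L s y) ` {0..C}) \<le> C"
      unfolding C_def using y by (intro card_mono finite_Y) (auto simp: run_closed)
    then have "\<not> inj_on (\<lambda>s. R L s y) {0..C}" by (intro pigeonhole) simp
    then obtain a b where ab: "a \<le> C" "b \<le> C" "a \<noteq> b" "R L a y = R L b y"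
      by (auto simp: inj_on_def)
    define s s' where "s = min a b" and "s' = max a b"
    have s: "s < s'" "s' \<le> C" "R L s y = R L s' y"
      using ab by (auto simp: s_def s'_def min_def max_def)
    have "R L (s + (C - s)) y \<approx> R L (s' + (C - s)) y"
      using s big[OF L] y by (intro approx_shift) (auto simp: approx_refl run_closed)
    then have "P L (s' - s)" using s by (simp add: P_def add.commute)
    then show ?thesis using s by (intro exI[of _ "s' - s"]) auto
  qed
  have \<mu>_le: "\<mu> L \<le> e" if "P L e" for L e unfolding \<mu>_def using that by (rule Least_le)
  have \<mu>: "P L (\<mu> L)" if "l0 \<le> L" for L
    using ex[OF that] unfolding \<mu>_def by (blast intro: LeastI)
  have \<mu>C: "\<mu> L \<le> C" if "l0 \<le> L" for L
    using ex[OF that] \<mu>_le order_trans by blast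
  \<comment> \<open>One more digit turns the gap \<open>e\<close> into \<open>k * e\<close>. If the
    period of the next level divides this gap, the relation holds there and
    \<open>approx_if_next_level\<close> brings it back.\<close>
  have down: "P L e" if L: "l0 \<le> L" and e: "1 \<le> e" "e \<le> C" "\<mu> (Suc L) dvd k * e" for L e
  proof -
    obtain t where t: "k * e = \<mu> (Suc L) * t" using e(3) by blast
    have less: "C + e < k ^ L" using big[OF L] e by simp
    have CE: "C * k + t * \<mu> (Suc L) = (C + e) * k"
    proof -
      have "t * \<mu> (Suc L) = e * k" using t by (simp only: mult.commute)
      then show ?thesis by (simp only: add_mult_distrib)
    qed
    have "(C + e) * k < k ^ L * k" using less k_pos by (intro mult_strict_right_mono) auto
    then have less': "(C + e) * k < k ^ Suc L" by (simp only: power_Suc mult.commute)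
    have period: "R (Suc L) C y \<approx> R (Suc L) (C + \<mu> (Suc L)) y" using \<mu>[of "Suc L"] L by (simp only: P_def le_SucI)
    have "C \<le> C * k" using k_pos by simp
    from approx_multiples[OF y period this, of t, unfolded CE, OF less']
    have "R (Suc L) (C * k) y \<approx> R (Suc L) ((C + e) * k) y" .
    moreover have "C < k ^ L" using less by simp
    ultimately have "R L C y \<approx> R L (C + e) y"
      using less by (metis approx_if_next_level[OF y])
    then show ?thesis using e by (simp add: P_def)
  qed
  have \<mu>_Suc: "\<mu> L \<le> \<mu> (Suc L)" if L: "l0 \<le> L" for L
  proof (rule \<mu>_le[OF down[OF L]])
    show "1 \<le> \<mu> (Suc L)" using \<mu>[of "Suc L"] L unfolding P_def by simp
  qed (use \<mu>C[of "Suc L"] L in auto)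
  have \<mu>_mono: "\<mu> L \<le> \<mu> L'" if "l0 \<le> L" "L \<le> L'" for L L'
    using that(2)
  proof (induction L' rule: dec_induct)
    case (step n)
    then show ?case using \<mu>_Suc[of n] that(1) by simp
  qed simp
  have fin: "finite (\<mu> ` {l0..})" using \<mu>C by (intro finite_subset[of "\<mu> ` {l0..}" "{..C}"]) auto
  \<comment> \<open>Being nondecreasing and bounded by \<open>C\<close>, the least periods are
    constant once they reach their maximum.\<close>
  have "Max (\<mu> ` {l0..}) \<in> \<mu> ` {l0..}" using fin by (intro Max_in) auto
  then obtain l where l: "l0 \<le> l" "\<mu> l = Max (\<mu> ` {l0..})" by (elim imageE) simp
  have const: "\<mu> L = \<mu> l" if "l \<le> L" for L
    using \<mu>_mono[OF l(1) that] Max_ge[OF fin, of "\<mu> L"] l that by simp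
  define q where "q = \<mu> l"
  have q: "1 \<le> q" "q \<le> C" using \<mu>[OF l(1)] \<mu>C[OF l(1)] by (auto simp: q_def P_def)
  have "coprime q k"
  proof -
    \<comment> \<open>\<open>q\<close> divides \<open>k * (q div g)\<close>, so by
      \<open>down\<close> already \<open>q div g\<close> is a period one level below, where the
      least period is again \<open>q\<close>.\<close>
    define g where "g = gcd q k"
    have g: "g dvd q" "g dvd k" "g > 0" using q by (auto simp: g_def)
    obtain e where e: "q = g * e" using g(1) by blast
    have "q dvd k * e" using g(2) e by auto
    moreover have "1 \<le> e" using q e by (cases e) auto
    moreover have "e \<le> C" using q(2) e g(3) mult_le_mono1[of 1 g e] by linarith
    ultimately have "P l e" using down[OF l(1), of e] const[of "Suc l"] by (simp add: q_def)
    then have "q \<le> e" using \<mu>_le by (simp add: q_def)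
    then have "g * e \<le> 1 * e" using e by simp
    then have "g = 1" using g(3) q e by (simp only: mult_le_cancel2) auto
    then show ?thesis by (simp add: g_def coprime_iff_gcd_eq_1)
  qed
  moreover have "R L s y \<approx> R L s' y"
    if "l \<le> L" "C \<le> s" "C \<le> s'" "s < k ^ L" "s' < k ^ L" "s mod q = s' mod q" for L s s'
  proof -
    have *: "R L s y \<approx> R L s' y"
      if le: "C \<le> s" "s' < k ^ L" "s mod q = s' mod q" "s \<le> s'" for s s'
    proof -
      have "q dvd s' - s"
        using iffD1[OF mod_eq_dvd_iff_nat[OF le(4)] le(3)[symmetric]] .
      then obtain t where "s' - s = q * t" by (rule dvdE)
      then have "s' = s + t * q" using le(4) by (simp add: mult.commute[of q])
      moreover have "R L C y \<approx> R L (C + q) y"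
      proof -
        have "P L q" using \<mu>[OF order_trans[OF l(1) \<open>l \<le> L\<close>]] const[OF \<open>l \<le> L\<close>]
          by (simp only: q_def)
        then show ?thesis unfolding P_def ..
      qed
      ultimately show ?thesis
        using approx_multiples[OF y _ le(1), of L q t] le(2) by metis
    qed
    show ?thesis
    proof (cases "s \<le> s'")
      case True
      then show ?thesis using *[of s s'] that by metis
    next
      case False
      then have "R L s' y \<approx> R L s y" using *[of s' s] that by (metis nle_le)
      then show ?thesis by (rule approx_sym[OF run_closed[OF y]])
    qed
  qed
  moreover have "q > 0" using q by simp
  ultimately show ?thesis unfolding C_def by blast
qed

end

section \<open>Contraction\<close>

text \<open>Digit splitting in every coordinate of a tuple at once, stated for a general bijection
  so that it covers both boxes of naturals and boxes of integers.\<close>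

lemma sum_PiE_split:
  assumes "bij_betw (\<lambda>(a, b). f a b) (S \<times> T) U"
  shows "sum F (I \<rightarrow>\<^sub>E U) = (\<Sum>a\<in>I \<rightarrow>\<^sub>E S. \<Sum>b\<in>I \<rightarrow>\<^sub>E T. F (\<lambda>i\<in>I. f (a i) (b i)))"
proof -
  define g where "g = inv_into (S \<times> T) (\<lambda>(a, b). f a b)"
  have g: "g u \<in> S \<times> T" "f (fst (g u)) (snd (g u)) = u" if "u \<in> U" for u
    using that assms inv_into_into[of u "\<lambda>(a, b). f a b" "S \<times> T"] f_inv_into_f[of u "\<lambda>(a, b). f a b" "S \<times> T"]
    by (auto simp: bij_betw_def g_def case_prod_beta)
  have gf: "g (f a b) = (a, b)" if "a \<in> S" "b \<in> T" for a b
    using that assms inv_into_f_f[of "\<lambda>(a, b). f a b" "S \<times> T" "(a, b)"] by (auto simp: bij_betw_def g_def)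
  have fU: "f a b \<in> U" if "a \<in> S" "b \<in> T" for a b
    using assms that by (auto simp: bij_betw_def)
  have "(\<Sum>a\<in>I \<rightarrow>\<^sub>E S. \<Sum>b\<in>I \<rightarrow>\<^sub>E T. F (\<lambda>i\<in>I. f (a i) (b i)))
    = (\<Sum>(a, b)\<in>(I \<rightarrow>\<^sub>E S) \<times> (I \<rightarrow>\<^sub>E T). F (\<lambda>i\<in>I. f (a i) (b i)))"
    by (rule sum.cartesian_product)
  also have "\<dots> = sum F (I \<rightarrow>\<^sub>E U)"
  proof (rule sum.reindex_bij_witness[where
      j = "\<lambda>(a, b). \<lambda>i\<in>I. f (a i) (b i)" and i = "\<lambda>u. (\<lambda>i\<in>I. fst (g (u i)), \<lambda>i\<in>I. snd (g (u i)))"])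
    fix ab assume ab: "ab \<in> (I \<rightarrow>\<^sub>E S) \<times> (I \<rightarrow>\<^sub>E T)"
    obtain a b where [simp]: "ab = (a, b)" by fastforce
    have *: "a i \<in> S" "b i \<in> T" if "i \<in> I" for i using ab that by auto
    show "(\<lambda>u. (\<lambda>i\<in>I. fst (g (u i)), \<lambda>i\<in>I. snd (g (u i)))) ((\<lambda>(a, b). \<lambda>i\<in>I. f (a i) (b i)) ab) = ab"
      using ab * gf by (auto intro!: ext simp: PiE_def extensional_def)
    show "(\<lambda>(a, b). \<lambda>i\<in>I. f (a i) (b i)) ab \<in> I \<rightarrow>\<^sub>E U" using * fU by auto
  next
    fix u assume u: "u \<in> I \<rightarrow>\<^sub>E U"
    then have *: "u i \<in> U" if "i \<in> I" for i using that by auto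
    show "(\<lambda>(a, b). \<lambda>i\<in>I. f (a i) (b i)) (\<lambda>i\<in>I. fst (g (u i)), \<lambda>i\<in>I. snd (g (u i))) = u"
      using u * g by (auto intro!: ext simp: PiE_def extensional_def)
    show "(\<lambda>i\<in>I. fst (g (u i)), \<lambda>i\<in>I. snd (g (u i))) \<in> (I \<rightarrow>\<^sub>E S) \<times> (I \<rightarrow>\<^sub>E T)"
      using * g by (auto simp: mem_Times_iff)
  qed auto
  finally show ?thesis by simp
qed

lemma bij_betw_digits:
  "K' > 0 \<Longrightarrow> bij_betw (\<lambda>(a, b). a * K' + b) ({..<K} \<times> {..<K'}) {..<K * K' :: nat}"
proof (rule bij_betw_byWitness[where f' = "\<lambda>u. (u div K', u mod K')"])
  assume K': "K' > 0"
  show "(\<lambda>(a, b). a * K' + b) ` ({..<K} \<times> {..<K'}) \<subseteq> {..<K * K'}"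
  proof
    fix u assume "u \<in> (\<lambda>(a, b). a * K' + b) ` ({..<K} \<times> {..<K'})"
    then obtain a b where u: "u = a * K' + b" and "a < K" "b < K'" by auto
    then have "a * K' + b < Suc a * K'" by simp
    also have "\<dots> \<le> K * K'" using \<open>a < K\<close> by (intro mult_right_mono) auto
    finally show "u \<in> {..<K * K'}" by (simp add: u)
  qed
  show "(\<lambda>u. (u div K', u mod K')) ` {..<K * K'} \<subseteq> {..<K} \<times> {..<K'}"
    using K' by (auto simp: less_mult_imp_div_less)
qed auto

lemma norm_cnj_funpow: "norm ((cnj ^^ n) z) = norm z"
  by (induction n) auto

lemma prod_norm_le_power:
  fixes f :: "'a \<Rightarrow> complex"
  assumes "finite A" "\<And>x. x \<in> A \<Longrightarrow> norm (f x) \<le> B"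
  shows "norm (\<Prod>x\<in>A. f x) \<le> B ^ card A"
proof -
  have "norm (\<Prod>x\<in>A. f x) = (\<Prod>x\<in>A. norm (f x))" by (rule prod_norm[symmetric])
  also have "\<dots> \<le> (\<Prod>x\<in>A. B)" using assms by (intro prod_mono) auto
  finally show ?thesis by simp
qed

section \<open>Sums over parallelepipeds of words and their contraction\<close>

context transitive_automaton
begin

definition cubesum :: "('y \<Rightarrow> complex) \<Rightarrow> nat \<Rightarrow> nat \<Rightarrow> ((nat \<Rightarrow> nat) \<Rightarrow> nat \<Rightarrow> 'y) \<Rightarrow> complex" where
  "cubesum b d L z = (\<Sum>m\<in>box d (k ^ L). \<Prod>\<omega>\<in>cube d. (cnj ^^ (\<Sum>i=1..d. \<omega> i)) (b (step d L m z \<omega> 0)))"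

text \<open>Configurations are total functions, so this takes the place of equality.\<close>

definition agree :: "nat \<Rightarrow> ((nat \<Rightarrow> nat) \<Rightarrow> nat \<Rightarrow> 'y) \<Rightarrow> ((nat \<Rightarrow> nat) \<Rightarrow> nat \<Rightarrow> 'y) \<Rightarrow> bool" where
  "agree d z z' \<longleftrightarrow> (\<forall>\<omega>\<in>cube d. \<forall>r\<le>d. z \<omega> r = z' \<omega> r)"

lemma agree_step: "agree d z z' \<Longrightarrow> m \<in> box d (k ^ L) \<Longrightarrow> agree d (step d L m z) (step d L m z')"
  unfolding agree_def by (intro ballI allI impI step_cong) auto

lemma agree_trans: "agree d z z' \<Longrightarrow> agree d z' z'' \<Longrightarrow> agree d z z''"
  by (simp add: agree_def)

lemma cubesum_cong: "agree d z z' \<Longrightarrow> cubesum b d L z = cubesum b d L z'"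
  unfolding cubesum_def
  using agree_step[of d z z' _ L] by (intro sum.cong prod.cong refl) (simp add: agree_def)

lemma cubesum_add:
  "cubesum b d (L + L') z = (\<Sum>m\<in>box d (k ^ L). cubesum b d L' (step d L m z))"
proof -
  have "cubesum b d (L + L') z = (\<Sum>m\<in>box d (k ^ L). \<Sum>m'\<in>box d (k ^ L').
    \<Prod>\<omega>\<in>cube d. (cnj ^^ (\<Sum>i=1..d. \<omega> i)) (b (step d (L + L') (pathcat d L' m m') z \<omega> 0)))"
    unfolding cubesum_def box_def pathcat_def power_add
    by (rule sum_PiE_split[OF bij_betw_digits]) (simp add: k_pos)
  then show ?thesis by (simp add: cubesum_def step_step)
qed

abbreviation shift_at :: "(nat \<Rightarrow> nat) \<Rightarrow> ('y \<Rightarrow> 'y) \<Rightarrow> ((nat \<Rightarrow> nat) \<Rightarrow> nat \<Rightarrow> 'y) \<Rightarrow> (nat \<Rightarrow> nat) \<Rightarrow> nat \<Rightarrow> 'y" where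
  "shift_at \<omega>' h z \<equiv> (\<lambda>\<omega> r. single \<omega>' h \<omega> (z \<omega> r))"

lemma single_Aut: "h \<in> Aut \<Longrightarrow> single \<omega>' h \<omega> \<in> Aut"
  by (simp add: single_def)

lemma step_shift_at:
  assumes "config d z" "m \<in> box d (k ^ L)" "h \<in> Aut"
  shows "agree d (step d L m (shift_at \<omega>' h z)) (shift_at \<omega>' h (step d L m z))"
  unfolding agree_def
proof (intro ballI allI impI)
  fix \<omega> r assume "\<omega> \<in> cube d" "r \<le> d"
  then show "step d L m (shift_at \<omega>' h z) \<omega> r = shift_at \<omega>' h (step d L m z) \<omega> r"
    by (rule step_equivariant[OF assms(1,2) single_Aut[OF assms(3)]])
qed

text \<open>Along a fixed path the shift by \<open>h\<close> changes only the factor at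
  \<open>\<omega>'\<close>; summed over \<open>h\<close> this factor is a sum of \<open>b\<close>
  over an \<open>H\<close>-orbit, possibly conjugated.\<close>

lemma cubesum_shift_vanish:
  assumes b: "\<And>y. y \<in> Y \<Longrightarrow> (\<Sum>h\<in>H. b (h y)) = 0" and z: "config d z" and \<omega>': "\<omega>' \<in> cube d"
  shows "(\<Sum>h\<in>H. cubesum b d L (shift_at \<omega>' h z)) = 0"
proof -
  have conj_sum: "(cnj ^^ n) (\<Sum>h\<in>H. f h) = (\<Sum>h\<in>H. (cnj ^^ n) (f h))" for n f
    by (induction n) auto
  have conj_zero: "(cnj ^^ n) 0 = 0" for n by (induction n) auto
  define F where "F \<omega> y = (cnj ^^ (\<Sum>i=1..d. \<omega> i)) (b y)" for \<omega> :: "nat \<Rightarrow> nat" and y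
  have "(\<Sum>h\<in>H. \<Prod>\<omega>\<in>cube d. F \<omega> (step d L m (shift_at \<omega>' h z) \<omega> 0)) = 0"
    if m: "m \<in> box d (k ^ L)" for m
  proof -
    define z1 where "z1 = step d L m z"
    have z1: "config d z1" using z m by (simp add: z1_def step_config)
    have "(\<Prod>\<omega>\<in>cube d. F \<omega> (step d L m (shift_at \<omega>' h z) \<omega> 0))
      = F \<omega>' (h (z1 \<omega>' 0)) * (\<Prod>\<omega>\<in>cube d - {\<omega>'}. F \<omega> (z1 \<omega> 0))" if h: "h \<in> H" for h
    proof -
      have "(\<Prod>\<omega>\<in>cube d. F \<omega> (step d L m (shift_at \<omega>' h z) \<omega> 0))
        = (\<Prod>\<omega>\<in>cube d. F \<omega> (shift_at \<omega>' h z1 \<omega> 0))"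
        using step_shift_at[OF z m H_Aut[OF h], of \<omega>'] by (intro prod.cong refl) (simp add: agree_def z1_def)
      also have "\<dots> = F \<omega>' (shift_at \<omega>' h z1 \<omega>' 0) * (\<Prod>\<omega>\<in>cube d - {\<omega>'}. F \<omega> (shift_at \<omega>' h z1 \<omega> 0))"
        using finite_cube \<omega>' by (rule prod.remove)
      also have "(\<Prod>\<omega>\<in>cube d - {\<omega>'}. F \<omega> (shift_at \<omega>' h z1 \<omega> 0)) = (\<Prod>\<omega>\<in>cube d - {\<omega>'}. F \<omega> (z1 \<omega> 0))"
        using z1 by (intro prod.cong refl) (auto simp: single_def config_def)
      finally show ?thesis by (simp add: single_def)
    qed
    then have "(\<Sum>h\<in>H. \<Prod>\<omega>\<in>cube d. F \<omega> (step d L m (shift_at \<omega>' h z) \<omega> 0))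
      = (\<Sum>h\<in>H. F \<omega>' (h (z1 \<omega>' 0))) * (\<Prod>\<omega>\<in>cube d - {\<omega>'}. F \<omega> (z1 \<omega> 0))"
      by (simp add: sum_distrib_right)
    also have "(\<Sum>h\<in>H. F \<omega>' (h (z1 \<omega>' 0))) = 0"
      using b[of "z1 \<omega>' 0"] z1 \<omega>' by (simp add: F_def conj_zero config_def flip: conj_sum)
    finally show ?thesis by simp
  qed
  then show ?thesis
    unfolding cubesum_def F_def[symmetric] by (subst sum.swap) (simp add: sum.neutral)
qed

text \<open>For \<open>F = H\<close> such a family of paths cancels: its ends are the translates of
  one configuration at one vertex, over which \<open>cubesum_shift_vanish\<close> sums.\<close>

definition covers :: "nat \<Rightarrow> (nat \<Rightarrow> nat) \<Rightarrow> nat \<Rightarrow> ('y \<Rightarrow> 'y) set \<Rightarrow> ((nat \<Rightarrow> nat) \<Rightarrow> nat \<Rightarrow> 'y) \<Rightarrow> bool" where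
  "covers d \<omega>' L F z \<longleftrightarrow> (\<exists>z'. config d z' \<and>
     (\<forall>h\<in>F. \<exists>m\<in>box d (k ^ L). agree d (step d L m z) (shift_at \<omega>' h z')))"

lemma covers_agree: "covers d \<omega>' L F z \<Longrightarrow> agree d z' z \<Longrightarrow> covers d \<omega>' L F z'"
  unfolding covers_def by (meson agree_step agree_trans)

text \<open>Appended zeros move the target \<open>z'\<close> along and equivariance keeps the
  shifts, so families of different lengths can be brought to a common length.\<close>

lemma covers_extend:
  assumes "config d z" "F \<subseteq> Aut" "covers d \<omega>' L F z"
  shows "covers d \<omega>' (L + L') F z"
proof -
  obtain z' where z': "config d z'" and
    m: "\<And>h. h \<in> F \<Longrightarrow> \<exists>m\<in>box d (k ^ L). agree d (step d L m z) (shift_at \<omega>' h z')"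
    using assms(3) unfolding covers_def by blast
  define p where "p = (\<lambda>i\<in>{..d}. 0::nat)"
  have p: "p \<in> box d (k ^ L')" using power_k_pos by (auto simp: p_def box_def)
  have "\<exists>m\<in>box d (k ^ (L + L')). agree d (step d (L + L') m z) (shift_at \<omega>' h (step d L' p z'))"
    if h: "h \<in> F" for h
  proof -
    obtain m where m: "m \<in> box d (k ^ L)" "agree d (step d L m z) (shift_at \<omega>' h z')" using m[OF h] by blast
    have "agree d (step d L' p (step d L m z)) (shift_at \<omega>' h (step d L' p z'))"
      using agree_step[OF m(2) p] step_shift_at[OF z' p] assms(2) h by (blast intro: agree_trans)
    then have "agree d (step d (L + L') (pathcat d L' m p) z) (shift_at \<omega>' h (step d L' p z'))"
      by (simp add: agree_def step_step)
    then show ?thesis using pathcat_box[OF m(1) p] by blast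
  qed
  then show ?thesis using step_config[OF z' p] unfolding covers_def by blast
qed

text \<open>Use freeness at the target \<open>z'\<close>: the old elements continue along
  \<open>p\<close>, while \<open>g\<close> is reached by the path of \<open>one\<close> continued
  along \<open>p'\<close>. Hence the demand that \<open>one\<close> be in \<open>F\<close>.\<close>

lemma covers_insert:
  assumes z: "config d z" and F: "F \<subseteq> Aut" "one \<in> F" "covers d \<omega>' L F z"
    and g: "free_shift d (single \<omega>' g)" "g \<in> Aut"
  shows "\<exists>L'. covers d \<omega>' L' (insert g F) z"
proof -
  obtain z' where z': "config d z'" and
    m: "\<And>h. h \<in> F \<Longrightarrow> \<exists>m\<in>box d (k ^ L). agree d (step d L m z) (shift_at \<omega>' h z')"
    using F(3) unfolding covers_def by blast
  obtain L' p p' where p: "p \<in> box d (k ^ L')" "p' \<in> box d (k ^ L')"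
    and e: "agree d (step d L' p' z') (shift_at \<omega>' g (step d L' p z'))"
    using g(1) z' unfolding free_shift_def differ_def agree_def by blast
  have "\<exists>m\<in>box d (k ^ (L + L')). agree d (step d (L + L') m z) (shift_at \<omega>' h (step d L' p z'))"
    if h: "h \<in> insert g F" for h
  proof (cases "h = g")
    case True
    obtain m where m: "m \<in> box d (k ^ L)" "agree d (step d L m z) (shift_at \<omega>' one z')" using m[OF F(2)] by blast
    have "agree d (shift_at \<omega>' one z') z'" using z' by (auto simp: agree_def single_def config_def)
    then have "agree d (step d L' p' (step d L m z)) (shift_at \<omega>' h (step d L' p z'))"
      using agree_step[OF _ p(2)] m(2) e True by (blast intro: agree_trans)
    then have "agree d (step d (L + L') (pathcat d L' m p') z) (shift_at \<omega>' h (step d L' p z'))"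
      by (simp add: agree_def step_step)
    then show ?thesis using pathcat_box[OF m(1) p(2)] by blast
  next
    case False
    then have h: "h \<in> F" using h by simp
    obtain m where m: "m \<in> box d (k ^ L)" "agree d (step d L m z) (shift_at \<omega>' h z')" using m[OF h] by blast
    have "agree d (step d L' p (step d L m z)) (shift_at \<omega>' h (step d L' p z'))"
      using agree_step[OF m(2) p(1)] step_shift_at[OF z' p(1)] F(1) h by (blast intro: agree_trans)
    then have "agree d (step d (L + L') (pathcat d L' m p) z) (shift_at \<omega>' h (step d L' p z'))"
      by (simp add: agree_def step_step)
    then show ?thesis using pathcat_box[OF m(1) p(1)] by blast
  qed
  then have "covers d \<omega>' (L + L') (insert g F) z" using step_config[OF z' p(1)] unfolding covers_def by blast
  then show ?thesis ..
qed

lemma covers_H: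
  assumes z: "config d z" and \<omega>': "\<omega>' \<in> cube d"
  shows "\<exists>L. covers d \<omega>' L H z"
proof -
  have "\<exists>L. covers d \<omega>' L (insert one F) z" if "F \<subseteq> H" for F
    using finite_subset[OF that finite_H] that
  proof (induction F rule: finite_induct)
    case empty
    have "agree d (step d 0 (\<lambda>i\<in>{..d}. 0) z) (shift_at \<omega>' one z)"
      using z by (auto simp: agree_def single_def config_def step_def vert_restrict vert_def)
    moreover have "(\<lambda>i\<in>{..d}. 0) \<in> box d (k ^ 0)" by (auto simp: box_def)
    ultimately have "covers d \<omega>' 0 {one} z" using z unfolding covers_def by blast
    then show ?case ..
  next
    case (insert g F)
    then obtain L where L: "covers d \<omega>' L (insert one F) z" by auto
    have "g \<in> H" "insert one F \<subseteq> Aut" using insert H_Aut by auto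
    moreover have "free_shift d (single \<omega>' g)" using \<open>g \<in> H\<close> \<omega>' by (simp add: H_def vertex_group_def)
    ultimately show ?case
      using covers_insert[OF z _ _ L, of g] H_Aut by (auto simp: insert_commute)
  qed
  from this[of H] one_H show ?thesis by (simp add: insert_absorb)
qed

text \<open>There are finitely many configurations up to \<open>agree\<close>, and the sum of their
  lengths suits all. \<open>L \<ge> 1\<close> ensures that each contraction consumes digits.\<close>

lemma covers_H_uniform:
  assumes \<omega>': "\<omega>' \<in> cube d"
  shows "\<exists>L\<ge>1. \<forall>z. config d z \<longrightarrow> covers d \<omega>' L H z"
proof -
  define Z where "Z = (cube d \<times> {..d}) \<rightarrow>\<^sub>E Y"
  have fin: "finite Z" by (simp add: Z_def finite_PiE finite_cube finite_Y)
  have "\<forall>\<zeta>. \<exists>L. \<zeta> \<in> Z \<longrightarrow> covers d \<omega>' L H (\<lambda>\<omega> r. \<zeta> (\<omega>, r))"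
  proof
    fix \<zeta>
    show "\<exists>L. \<zeta> \<in> Z \<longrightarrow> covers d \<omega>' L H (\<lambda>\<omega> r. \<zeta> (\<omega>, r))"
    proof (cases "\<zeta> \<in> Z")
      case True
      then have "config d (\<lambda>\<omega> r. \<zeta> (\<omega>, r))" by (auto simp: Z_def config_def)
      then show ?thesis using covers_H[OF _ \<omega>'] by blast
    qed simp
  qed
  then obtain f where f: "\<And>\<zeta>. \<zeta> \<in> Z \<Longrightarrow> covers d \<omega>' (f \<zeta>) H (\<lambda>\<omega> r. \<zeta> (\<omega>, r))" by metis
  define L where "L = (\<Sum>\<zeta>\<in>Z. f \<zeta>) + 1"
  have "covers d \<omega>' L H z" if z: "config d z" for z
  proof -
    define \<zeta> where "\<zeta> = (\<lambda>(\<omega>, r)\<in>cube d \<times> {..d}. z \<omega> r)"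
    have \<zeta>: "\<zeta> \<in> Z" using z by (auto simp: \<zeta>_def Z_def config_def)
    have "agree d z (\<lambda>\<omega> r. \<zeta> (\<omega>, r))" by (simp add: agree_def \<zeta>_def)
    then have c: "covers d \<omega>' (f \<zeta>) H z" using f[OF \<zeta>] covers_agree by blast
    have "f \<zeta> \<le> L" using member_le_sum[OF \<zeta>, of f] fin by (simp add: L_def)
    then obtain L' where L': "L = f \<zeta> + L'" using le_Suc_ex by blast
    show ?thesis unfolding L' using H_Aut by (intro covers_extend[OF z _ c]) auto
  qed
  then show ?thesis by (intro exI[of _ L]) (simp add: L_def)
qed

text \<open>The paths indexed by \<open>H\<close> cancel among themselves, and they are distinct by
  freeness. At least one path thus drops out of the trivial bound.\<close>

lemma cubesum_contract:
  assumes b: "\<And>y. y \<in> Y \<Longrightarrow> (\<Sum>h\<in>H. b (h y)) = 0" and \<omega>': "\<omega>' \<in> cube d"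
    and z: "config d z" and c: "covers d \<omega>' L H z"
    and S: "\<And>z. config d z \<Longrightarrow> norm (cubesum b d L' z) \<le> S"
  shows "norm (cubesum b d (L + L') z) \<le> (real (k ^ L) ^ (d + 1) - 1) * S"
proof -
  obtain z' where z': "config d z'" and
    "\<forall>h\<in>H. \<exists>m\<in>box d (k ^ L). agree d (step d L m z) (shift_at \<omega>' h z')"
    using c unfolding covers_def by blast
  then obtain f where f: "\<And>h. h \<in> H \<Longrightarrow> f h \<in> box d (k ^ L)"
    "\<And>h. h \<in> H \<Longrightarrow> agree d (step d L (f h) z) (shift_at \<omega>' h z')" by metis
  have z0: "z' \<omega>' 0 \<in> Y" using z' \<omega>' by (simp add: config_def)
  have inj: "inj_on f H"
  proof (rule inj_onI)
    fix g h assume gh: "g \<in> H" "h \<in> H" "f g = f h"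
    have "g (z' \<omega>' 0) = h (z' \<omega>' 0)"
      using f(2)[OF gh(1)] f(2)[OF gh(2)] gh(3) \<omega>' by (auto simp: agree_def single_def)
    then show "g = h" using gh z0 by (auto intro: Aut_eqI H_Aut)
  qed
  have "(\<Sum>m\<in>f ` H. cubesum b d L' (step d L m z)) = (\<Sum>h\<in>H. cubesum b d L' (step d L (f h) z))"
    using inj by (simp add: sum.reindex)
  also have "\<dots> = (\<Sum>h\<in>H. cubesum b d L' (shift_at \<omega>' h z'))"
    using f(2) by (intro sum.cong cubesum_cong refl)
  also have "\<dots> = 0" by (rule cubesum_shift_vanish[OF b z' \<omega>'])
  finally have zero: "(\<Sum>m\<in>f ` H. cubesum b d L' (step d L m z)) = 0" .
  have sub: "f ` H \<subseteq> box d (k ^ L)" using f(1) by blast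
  have "cubesum b d (L + L') z = (\<Sum>m\<in>box d (k ^ L) - f ` H. cubesum b d L' (step d L m z))"
    unfolding cubesum_add sum.subset_diff[OF sub finite_box] zero by simp
  also have "norm \<dots> \<le> real (card (box d (k ^ L) - f ` H)) * S"
    using z step_config S by (intro order_trans[OF norm_sum] sum_bounded_above) auto
  also have "\<dots> \<le> (real (k ^ L) ^ (d + 1) - 1) * S"
  proof (rule mult_right_mono)
    have "card (f ` H) \<ge> 1" using one_H finite_H by (simp add: Suc_le_eq card_gt_0_iff) blast
    moreover have "card (f ` H) \<le> card (box d (k ^ L))" using sub finite_box by (intro card_mono)
    ultimately have "real (card (box d (k ^ L) - f ` H)) \<le> real (card (box d (k ^ L))) - 1"
      using sub finite_H by (simp add: card_Diff_subset)
    then show "real (card (box d (k ^ L) - f ` H)) \<le> real (k ^ L) ^ (d + 1) - 1"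
      by (simp add: card_box)
    show "0 \<le> S" using S[OF z] norm_ge_zero order_trans by blast
  qed
  finally show ?thesis .
qed

lemma cubesum_trivial:
  assumes "\<And>y. y \<in> Y \<Longrightarrow> norm (b y) \<le> B" "config d z"
  shows "norm (cubesum b d L z) \<le> real (k ^ L) ^ (d + 1) * B ^ card (cube d)"
proof -
  have "norm (cubesum b d L z) \<le> real (card (box d (k ^ L))) * B ^ card (cube d)"
    unfolding cubesum_def
    using step_config[OF assms(2)] assms(1)
    by (intro order_trans[OF norm_sum] sum_bounded_above prod_norm_le_power finite_cube)
      (auto simp: norm_cnj_funpow config_def)
  then show ?thesis by (simp add: card_box)
qed

lemma cubesum_decay:
  assumes b: "\<And>y. y \<in> Y \<Longrightarrow> (\<Sum>h\<in>H. b (h y)) = 0"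
  shows "\<exists>C c. 0 < c \<and> 0 \<le> C \<and> (\<forall>L z. config d z \<longrightarrow>
    norm (cubesum b d L z) \<le> C * real (k ^ L) ^ (d + 1) * real (k ^ L) powr (- c))"
proof -
  \<comment> \<open>Any one vertex will do, since the cancellation happens in a single
    factor.\<close>
  define \<omega>' where "\<omega>' = (\<lambda>i\<in>{1..d}. 0::nat)"
  have \<omega>': "\<omega>' \<in> cube d" by (auto simp: \<omega>'_def cube_def)
  obtain M where M: "M \<ge> 1" "\<And>z. config d z \<Longrightarrow> covers d \<omega>' M H z"
    using covers_H_uniform[OF \<omega>'] by blast
  define B where "B = (\<Sum>y\<in>Y. norm (b y))"
  have B: "norm (b y) \<le> B" if "y \<in> Y" for y
    using member_le_sum[OF that, of "\<lambda>y. norm (b y)"] finite_Y by (simp add: B_def)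
  have B0: "B \<ge> 0" by (simp add: B_def sum_nonneg)
  define B' where "B' = B ^ card (cube d)"
  have B'0: "B' \<ge> 0" using B0 by (simp add: B'_def)
  define X where "X L = real (k ^ L) ^ (d + 1)" for L
  have X_add: "X (L + L') = X L * X L'" for L L' by (simp add: X_def power_add power_mult_distrib)
  have X_pos: "X L > 0" for L using k_pos by (simp add: X_def)
  \<comment> \<open>The gain for a block of \<open>M\<close> digits: one of its \<open>X M\<close>
    paths is lost.\<close>
  define \<rho> where "\<rho> = 1 - 1 / X M"
  have "X M > 1"
  proof -
    have "1 < real (k ^ M)" using k_ge_2 M(1) by (simp add: one_less_power)
    then show ?thesis unfolding X_def by (rule one_less_power) simp
  qed
  then have \<rho>: "0 < \<rho>" "\<rho> < 1" by (auto simp: \<rho>_def)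
  have bound: "norm (cubesum b d L z) \<le> X L * B' * \<rho> ^ (L div M)" if "config d z" for L z
    using that
  proof (induction L arbitrary: z rule: less_induct)
    case (less L)
    show ?case
    proof (cases "L < M")
      case True
      then show ?thesis using cubesum_trivial[OF B less.prems, where L = L] by (simp add: X_def B'_def)
    next
      case False
      then obtain L' where L': "L = M + L'" using le_Suc_ex not_le by blast
      have "norm (cubesum b d (M + L') z) \<le> (X M - 1) * (X L' * B' * \<rho> ^ (L' div M))"
        unfolding X_def using less.IH[of L'] M L' less.prems
        by (intro cubesum_contract[OF b \<omega>']) (auto simp: X_def)
      also have "\<dots> = X (M + L') * B' * \<rho> ^ Suc (L' div M)"
        using X_pos[of M] by (simp add: X_add \<rho>_def field_simps)
      also have "Suc (L' div M) = L div M" using M(1) by (simp add: L')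
      finally show ?thesis by (simp add: L')
    qed
  qed
  \<comment> \<open>Chosen so that \<open>\<rho> powr (L / M)\<close> is
    \<open>(k ^ L) powr (- c)\<close>; the factor \<open>1 / \<rho>\<close> in \<open>dec\<close>
    pays for rounding \<open>L / M\<close> down.\<close>
  define c where "c = - ln \<rho> / (M * ln k)"
  have lnk: "ln (real k) > 0" using k_ge_2 by simp
  have c: "c > 0" using \<rho> M(1) lnk by (simp add: c_def divide_neg_pos)
  have dec: "\<rho> ^ (L div M) \<le> (1 / \<rho>) * real (k ^ L) powr (- c)" for L
  proof -
    have "real (k ^ L) powr (- c) = exp (- c * (real L * ln k))"
      using k_pos by (simp add: powr_def ln_realpow)
    also have "- c * (real L * ln k) = (real L / real M) * ln \<rho>"
      using lnk M(1) by (simp add: c_def)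
    also have "exp \<dots> = \<rho> powr (real L / real M)" using \<rho> by (simp add: powr_def)
    finally have 1: "real (k ^ L) powr (- c) = \<rho> powr (real L / real M)" .
    have "real L / real M \<le> real (L div M) + 1"
    proof -
      have "L \<le> (L div M + 1) * M"
        using M(1) mod_less_divisor[of M L] div_mult_mod_eq[of L M] unfolding add_mult_distrib by linarith
      then have "real L \<le> real ((L div M + 1) * M)" by (simp only: of_nat_le_iff)
      then show ?thesis using M(1) by (simp add: field_simps)
    qed
    then have "\<rho> powr (real (L div M) + 1) \<le> \<rho> powr (real L / real M)"
      using \<rho> by (simp add: powr_mono')
    moreover have "\<rho> powr (real (L div M) + 1) = \<rho> ^ (L div M) * \<rho>"
      using \<rho> by (simp add: powr_add powr_realpow)
    ultimately show ?thesis using \<rho> 1 by (simp add: field_simps)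
  qed
  have "norm (cubesum b d L z) \<le> (B' / \<rho>) * real (k ^ L) ^ (d + 1) * real (k ^ L) powr (- c)"
    if "config d z" for L z
  proof -
    have "X L * B' * \<rho> ^ (L div M) \<le> X L * B' * ((1 / \<rho>) * real (k ^ L) powr (- c))"
      using dec X_pos B'0 by (intro mult_left_mono) (auto simp: less_imp_le)
    with bound[OF that, of L] show ?thesis by (simp add: X_def mult_ac)
  qed
  then show ?thesis using c \<rho> B'0 by (intro exI[of _ "B' / \<rho>"] exI[of _ c]) auto
qed

end

section \<open>Gowers norms on intervals\<close>

definition ivert :: "nat \<Rightarrow> (nat \<Rightarrow> int) \<Rightarrow> (nat \<Rightarrow> nat) \<Rightarrow> int" where
  "ivert d n \<omega> = n 0 + (\<Sum>i=1..d. int (\<omega> i) * n i)"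

definition cubeprod :: "nat \<Rightarrow> ((nat \<Rightarrow> nat) \<Rightarrow> complex) \<Rightarrow> complex" where
  "cubeprod d g = (\<Prod>\<omega>\<in>cube d. (cnj ^^ (\<Sum>i=1..d. \<omega> i)) (g \<omega>))"

lemma funpow_cnj_0 [simp]: "(cnj ^^ n) 0 = 0"
  by (induction n) auto

lemma cubeprod_zero: "\<omega> \<in> cube d \<Longrightarrow> g \<omega> = 0 \<Longrightarrow> cubeprod d g = 0"
  unfolding cubeprod_def using finite_cube by (rule prod_zero[OF _ bexI]) auto

lemma cubeprod_cong: "(\<And>\<omega>. \<omega> \<in> cube d \<Longrightarrow> g \<omega> = g' \<omega>) \<Longrightarrow> cubeprod d g = cubeprod d g'"
  unfolding cubeprod_def by (intro prod.cong refl) simp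

section \<open>From cyclic groups to parallelepipeds of integers\<close>

lemma finprod_integer_mod_group:
  assumes "p > 0" "finite I"
  shows "(\<Otimes>\<^bsub>integer_mod_group p\<^esub>i\<in>I. n i [^]\<^bsub>integer_mod_group p\<^esub> (\<omega> i :: nat))
    = (\<Sum>i\<in>I. int (\<omega> i) * n i) mod int p"
proof -
  interpret comm_group "integer_mod_group p" by simp
  show ?thesis using assms(2)
  proof (induction I rule: finite_induct)
    case (insert i I)
    have "(\<lambda>i. n i [^]\<^bsub>integer_mod_group p\<^esub> (\<omega> i)) \<in> J \<rightarrow> carrier (integer_mod_group p)" for J
      using assms(1) by (auto simp: carrier_integer_mod_group)
    with insert show ?case
      by (subst finprod_insert) (auto simp: mod_add_eq Pi_iff)
  qed simp
qed

lemma gowers_norm_integer_mod_group: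
  assumes "p > 0"
  shows "gowers_norm (integer_mod_group p) d f = root (2 ^ d) (Re (
    (\<Sum>n\<in>{..d} \<rightarrow>\<^sub>E {0..<int p}. cubeprod d (\<lambda>\<omega>. f (ivert d n \<omega> mod int p)))
    / of_nat p ^ (d + 1)))"
  using assms
  unfolding gowers_norm_def finprod_integer_mod_group[OF assms finite_atLeastAtMost]
    mult_integer_mod_group mod_add_right_eq cubeprod_def cube_def ivert_def carrier_integer_mod_group
  by simp

definition zero_vertex :: "nat \<Rightarrow> nat \<Rightarrow> nat" where
  "zero_vertex d = (\<lambda>i\<in>{1..d}. 0)"

definition unit_vertex :: "nat \<Rightarrow> nat \<Rightarrow> nat \<Rightarrow> nat" where
  "unit_vertex d j = (\<lambda>i\<in>{1..d}. if i = j then 1 else 0)"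

lemma zero_vertex_cube: "zero_vertex d \<in> cube d" and unit_vertex_cube: "unit_vertex d j \<in> cube d"
  by (auto simp: zero_vertex_def unit_vertex_def cube_def)

lemma ivert_zero_vertex: "ivert d n (zero_vertex d) = n 0"
  by (simp add: ivert_def zero_vertex_def)

lemma ivert_unit_vertex:
  assumes "j \<in> {1..d}" shows "ivert d n (unit_vertex d j) = n 0 + n j"
proof -
  have "(\<Sum>i=1..d. int (unit_vertex d j i) * n i) = (\<Sum>i=1..d. if i = j then n i else 0)"
    by (intro sum.cong refl) (simp add: unit_vertex_def)
  then show ?thesis using assms by (simp add: ivert_def)
qed

text \<open>A parallelepiped is described by the vertex \<open>x 0\<close> and its neighbours \<open>x i\<close>.\<close>

definition edges :: "nat \<Rightarrow> (nat \<Rightarrow> int) \<Rightarrow> nat \<Rightarrow> int" where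
  "edges d x = (\<lambda>i\<in>{..d}. if i = 0 then x 0 else x i - x 0)"

definition interval_cubes :: "nat \<Rightarrow> nat \<Rightarrow> (int \<Rightarrow> complex) \<Rightarrow> complex" where
  "interval_cubes d N f = (\<Sum>x\<in>{..d} \<rightarrow>\<^sub>E {0..<int N}. cubeprod d (\<lambda>\<omega>. f (ivert d (edges d x) \<omega>)))"

lemma ivert_edges_bounds:
  assumes x: "x \<in> {..d} \<rightarrow>\<^sub>E {0..<int N}" and \<omega>: "\<omega> \<in> cube d" and N: "N > 0"
  shows "- (int d * int N) \<le> ivert d (edges d x) \<omega>" "ivert d (edges d x) \<omega> < (int d + 1) * int N"
proof -
  have x': "0 \<le> x i \<and> x i < int N" if "i \<le> d" for i using x that by auto
  have b: "- int N \<le> int (\<omega> i) * edges d x i \<and> int (\<omega> i) * edges d x i \<le> int N" if i: "i \<in> {1..d}" for i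
  proof -
    have "\<omega> i = 0 \<or> \<omega> i = 1" using cube_le_1[OF \<omega> i] by linarith
    then show ?thesis using x'[of i] x'[of 0] i by (auto simp: edges_def)
  qed
  have "(\<Sum>i=1..d. - int N) \<le> (\<Sum>i=1..d. int (\<omega> i) * edges d x i)"
    using b by (intro sum_mono) auto
  moreover have "(\<Sum>i=1..d. int (\<omega> i) * edges d x i) \<le> (\<Sum>i=1..d. int N)"
    using b by (intro sum_mono) auto
  moreover have "edges d x 0 = x 0" by (simp add: edges_def)
  ultimately show "- (int d * int N) \<le> ivert d (edges d x) \<omega>" "ivert d (edges d x) \<omega> < (int d + 1) * int N"
    using x'[of 0] by (auto simp: ivert_def algebra_simps)
qed

text \<open>A nonzero product forces the corners \<open>n 0\<close> and \<open>n 0 + n i\<close>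
  into the interval, which confines all vertices by \<open>ivert_edges_bounds\<close>;
  \<open>p > 2 * d * N\<close> then excludes that a vertex wraps around into the interval.\<close>

lemma cyclic_sum_eq_interval_cubes:
  assumes d: "d \<ge> 1" and N: "N > 0" and p: "p > 2 * d * N"
    and f: "\<And>x. x < 0 \<or> x \<ge> int N \<Longrightarrow> f x = 0"
  shows "(\<Sum>n\<in>{..d} \<rightarrow>\<^sub>E {0..<int p}. cubeprod d (\<lambda>\<omega>. f (ivert d n \<omega> mod int p))) = interval_cubes d N f"
proof -
  have dN: "N \<le> d * N" using d by simp
  have pN: "int N < int p" using p dN by linarith
  define P where "P n = cubeprod d (\<lambda>\<omega>. f (ivert d n \<omega> mod int p))" for n
  define r where "r x = (\<lambda>i\<in>{..d}. edges d x i mod int p)" for x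
  define s where "s n = (\<lambda>i\<in>{..d}. if i = 0 then n 0 else (n i + n 0) mod int p)" for n :: "nat \<Rightarrow> int"
  have vr: "ivert d (r x) \<omega> mod int p = ivert d (edges d x) \<omega> mod int p" for x \<omega>
  proof -
    have *: "(\<Sum>i=1..d. int (\<omega> i) * r x i) mod int p = (\<Sum>i=1..d. int (\<omega> i) * edges d x i) mod int p"
    proof -
      have "(\<Sum>i=1..d. int (\<omega> i) * r x i) mod int p = (\<Sum>i=1..d. (int (\<omega> i) * r x i) mod int p) mod int p"
        by (simp add: mod_sum_eq)
      also have "(\<Sum>i=1..d. (int (\<omega> i) * r x i) mod int p) = (\<Sum>i=1..d. (int (\<omega> i) * edges d x i) mod int p)"
        by (intro sum.cong refl) (simp add: r_def mod_mult_right_eq)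
      finally show ?thesis by (simp add: mod_sum_eq)
    qed
    have "(r x 0 + (\<Sum>i=1..d. int (\<omega> i) * r x i)) mod int p
        = (edges d x 0 + (\<Sum>i=1..d. int (\<omega> i) * edges d x i)) mod int p"
      by (rule mod_add_cong) (simp add: r_def, rule *)
    then show ?thesis by (simp add: ivert_def)
  qed
  have "sum P ({..d} \<rightarrow>\<^sub>E {0..<int p}) = (\<Sum>x\<in>{..d} \<rightarrow>\<^sub>E {0..<int p}. P (r x))"
  proof (rule sum.reindex_bij_witness[where i = r and j = s])
    fix n assume n: "n \<in> {..d} \<rightarrow>\<^sub>E {0..<int p}"
    have n': "0 \<le> n i" "n i < int p" if "i \<le> d" for i using n that by auto
    show "s n \<in> {..d} \<rightarrow>\<^sub>E {0..<int p}" using n' pN by (auto simp: s_def)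
    show rs: "r (s n) = n"
    proof (rule extensionalityI[of _ "{..d}"])
      fix i assume "i \<in> {..d}"
      then show "r (s n) i = n i" using n'[of i] n'[of 0]
        by (simp add: r_def s_def edges_def mod_diff_left_eq)
    qed (use n in \<open>auto simp: r_def PiE_def\<close>)
    show "P (r (s n)) = P n" by (simp add: rs)
  next
    fix x assume x: "x \<in> {..d} \<rightarrow>\<^sub>E {0..<int p}"
    have x': "0 \<le> x i" "x i < int p" if "i \<le> d" for i using x that by auto
    show "r x \<in> {..d} \<rightarrow>\<^sub>E {0..<int p}" using pN by (auto simp: r_def)
    show "s (r x) = x"
    proof (rule extensionalityI[of _ "{..d}"])
      fix i assume "i \<in> {..d}"
      then show "s (r x) i = x i" using x'[of i] x'[of 0]
        by (simp add: r_def s_def edges_def mod_simps)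
    qed (use x in \<open>auto simp: s_def PiE_def\<close>)
  qed
  also have "\<dots> = (\<Sum>x\<in>{..d} \<rightarrow>\<^sub>E {0..<int N}. P (r x))"
  proof (rule sum.mono_neutral_right)
    show "finite ({..d} \<rightarrow>\<^sub>E {0..<int p})" by (simp add: finite_PiE)
    show "{..d} \<rightarrow>\<^sub>E {0..<int N} \<subseteq> {..d} \<rightarrow>\<^sub>E {0..<int p}" using pN by (intro PiE_mono) auto
    show "\<forall>x\<in>({..d} \<rightarrow>\<^sub>E {0..<int p}) - ({..d} \<rightarrow>\<^sub>E {0..<int N}). P (r x) = 0"
    proof
      fix x assume x: "x \<in> ({..d} \<rightarrow>\<^sub>E {0..<int p}) - ({..d} \<rightarrow>\<^sub>E {0..<int N})"
      then obtain i where i: "i \<le> d" "int N \<le> x i" "0 \<le> x i" "x i < int p"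
        by (fastforce simp: PiE_iff)
      have "\<exists>\<omega>\<in>cube d. ivert d (edges d x) \<omega> = x i"
      proof (cases "i = 0")
        case True
        then show ?thesis using ivert_zero_vertex zero_vertex_cube
          by (intro bexI[of _ "zero_vertex d"]) (auto simp: edges_def)
      next
        case False
        then show ?thesis using ivert_unit_vertex[of i d] unit_vertex_cube i
          by (intro bexI[of _ "unit_vertex d i"]) (auto simp: edges_def)
      qed
      then obtain \<omega> where \<omega>: "\<omega> \<in> cube d" "ivert d (edges d x) \<omega> = x i" by blast
      then show "P (r x) = 0" unfolding P_def
        using i f by (intro cubeprod_zero[OF \<omega>(1)]) (simp add: vr)
    qed
  qed
  also have "\<dots> = interval_cubes d N f"
    unfolding interval_cubes_def P_def
  proof (intro sum.cong cubeprod_cong refl)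
    fix x \<omega> assume x: "x \<in> {..d} \<rightarrow>\<^sub>E {0..<int N}" and \<omega>: "\<omega> \<in> cube d"
    define w where "w = ivert d (edges d x) \<omega>"
    have dN': "int N \<le> int d * int N" using dN by (metis of_nat_le_iff of_nat_mult)
    have p': "2 * (int d * int N) < int p"
      using p by (metis mult.assoc of_nat_less_iff of_nat_mult of_nat_numeral)
    have w: "- (int d * int N) \<le> w" "w < int d * int N + int N"
      using ivert_edges_bounds[OF x \<omega> N] by (simp_all add: w_def algebra_simps)
    \<comment> \<open>A negative \<open>w\<close> is at least \<open>- d * N\<close> and wraps to a
      point above \<open>d * N \<ge> N\<close>, where \<open>f\<close> vanishes as it does at
      \<open>w\<close>. Otherwise \<open>w < (d + 1) * N \<le> 2 * d * N < p\<close>, without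
      wrapping.\<close>
    have "f (w mod int p) = f w"
    proof (cases "w < 0")
      case True
      have "w mod int p = w + int p"
        using True w p' dN' by (intro int_mod_pos_eq[of w "int p" "-1"]) auto
      then show ?thesis using True w p' dN' f[of w] f[of "w + int p"] by simp
    next
      case False
      then have "w mod int p = w" using w p' dN' by (intro mod_pos_pos_trivial) auto
      then show ?thesis by simp
    qed
    then show "f (ivert d (r x) \<omega> mod int p) = f (ivert d (edges d x) \<omega>)" by (simp add: vr w_def)
  qed
  finally show ?thesis by (simp add: P_def)
qed

text \<open>Edges outside the image of \<open>edges d\<close> have some corner outside the interval
  and contribute nothing. The free size \<open>J\<close> allows a box that splits evenly into
  blocks.\<close>

lemma interval_cubes_eq_box:
  assumes J: "int N \<le> J" and f: "\<And>x. x < 0 \<or> x \<ge> int N \<Longrightarrow> f x = 0"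
  shows "interval_cubes d N f = (\<Sum>n\<in>{..d} \<rightarrow>\<^sub>E {-J..<J}. cubeprod d (\<lambda>\<omega>. f (ivert d n \<omega>)))"
proof -
  define P where "P n = cubeprod d (\<lambda>\<omega>. f (ivert d n \<omega>))" for n
  have inj: "inj_on (edges d) ({..d} \<rightarrow>\<^sub>E {0..<int N})"
  proof (rule inj_onI)
    fix x y assume xy: "x \<in> {..d} \<rightarrow>\<^sub>E {0..<int N}" "y \<in> {..d} \<rightarrow>\<^sub>E {0..<int N}" "edges d x = edges d y"
    have 0: "x 0 = y 0" using fun_cong[OF xy(3), of 0] by (simp add: edges_def)
    show "x = y"
    proof (rule PiE_ext[OF xy(1,2)])
      fix i assume "i \<in> {..d}"
      then show "x i = y i" using fun_cong[OF xy(3), of i] 0 by (auto simp: edges_def split: if_splits)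
    qed
  qed
  have "interval_cubes d N f = sum P (edges d ` ({..d} \<rightarrow>\<^sub>E {0..<int N}))"
    using inj by (simp add: interval_cubes_def P_def sum.reindex)
  also have "\<dots> = sum P ({..d} \<rightarrow>\<^sub>E {-J..<J})"
  proof (rule sum.mono_neutral_left)
    show "finite ({..d} \<rightarrow>\<^sub>E {-J..<J})" by (simp add: finite_PiE)
    show "edges d ` ({..d} \<rightarrow>\<^sub>E {0..<int N}) \<subseteq> {..d} \<rightarrow>\<^sub>E {-J..<J}"
    proof
      fix n assume "n \<in> edges d ` ({..d} \<rightarrow>\<^sub>E {0..<int N})"
      then obtain x where x: "x \<in> {..d} \<rightarrow>\<^sub>E {0..<int N}" "n = edges d x" by blast
      have x': "0 \<le> x i \<and> x i < int N" if "i \<le> d" for i using x(1) that by auto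
      have "- J \<le> edges d x i \<and> edges d x i < J" if "i \<le> d" for i
        using x'[OF that] x'[of 0] J that by (auto simp: edges_def)
      then show "n \<in> {..d} \<rightarrow>\<^sub>E {-J..<J}" 
        unfolding x(2) by (intro PiE_I) (auto, simp add: edges_def)
    qed
    show "\<forall>n\<in>({..d} \<rightarrow>\<^sub>E {-J..<J}) - edges d ` ({..d} \<rightarrow>\<^sub>E {0..<int N}). P n = 0"
    proof (rule ballI, rule ccontr)
      fix n assume n: "n \<in> ({..d} \<rightarrow>\<^sub>E {-J..<J}) - edges d ` ({..d} \<rightarrow>\<^sub>E {0..<int N})" and "P n \<noteq> 0"
      then have v: "0 \<le> ivert d n \<omega> \<and> ivert d n \<omega> < int N" if "\<omega> \<in> cube d" for \<omega>
        using cubeprod_zero[OF that, of "\<lambda>\<omega>. f (ivert d n \<omega>)"] f[of "ivert d n \<omega>"]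
        by (auto simp: P_def not_le not_less)
      define x where "x = (\<lambda>i\<in>{..d}. if i = 0 then n 0 else n 0 + n i)"
      have "0 \<le> n 0 + n i \<and> n 0 + n i < int N" if "i \<in> {1..d}" for i
        using v[OF unit_vertex_cube[of d i]] ivert_unit_vertex[OF that, of n] by simp
      then have "x \<in> {..d} \<rightarrow>\<^sub>E {0..<int N}"
        using v[OF zero_vertex_cube] ivert_zero_vertex[of d n] by (auto simp: x_def)
      moreover have "edges d x = n"
        by (rule extensionalityI[of _ "{..d}"]) (use n in \<open>auto simp: edges_def x_def PiE_def\<close>)
      ultimately show False using n by blast
    qed
  qed
  finally show ?thesis by (simp add: P_def)
qed

lemma ambient_prime: "ambient_prime d N > 2 * d * N"
proof -
  obtain p :: nat where "prime p \<and> p > 2 * d * N" using bigger_prime by blast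
  then show ?thesis unfolding ambient_prime_def by (rule LeastI2) simp
qed

lemma restrict_interval_outside: "x < 0 \<or> x \<ge> int N \<Longrightarrow> restrict_interval N a x = 0"
  by (auto simp: restrict_interval_def)

text \<open>The powers of the ambient prime cancel in the quotient, which leaves a ratio of sums
  over parallelepipeds of integers.\<close>

lemma gowers_norm_interval_eq:
  assumes "d \<ge> 1" "N > 0"
  shows "gowers_norm_interval d N a = root (2 ^ d)
    (Re (interval_cubes d N (restrict_interval N a)) / Re (interval_cubes d N (restrict_interval N (\<lambda>_. 1))))"
proof -
  define p where "p = ambient_prime d N"
  have p: "p > 2 * d * N" by (simp add: p_def ambient_prime)
  have Re: "Re (z / of_nat p ^ (d + 1)) = Re z / real p ^ (d + 1)" for z
    by (metis Re_divide_of_real of_real_of_nat_eq of_real_power)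
  have "gowers_norm (integer_mod_group p) d (restrict_interval N b)
    = root (2 ^ d) (Re (interval_cubes d N (restrict_interval N b)) / real p ^ (d + 1))" for b
  proof -
    have "p > 0" using p by simp
    moreover have "(\<Sum>n\<in>{..d} \<rightarrow>\<^sub>E {0..<int p}. cubeprod d (\<lambda>\<omega>. restrict_interval N b (ivert d n \<omega> mod int p)))
      = interval_cubes d N (restrict_interval N b)"
      by (rule cyclic_sum_eq_interval_cubes[OF assms p restrict_interval_outside])
    ultimately show ?thesis by (simp only: gowers_norm_integer_mod_group Re)
  qed
  then show ?thesis using p
    by (simp add: gowers_norm_interval_def p_def[symmetric] flip: real_root_divide)
qed

section \<open>Cutting the interval into blocks\<close>

lemma bij_betw_int_digits:
  assumes "K > 0"
  shows "bij_betw (\<lambda>(a, b). a * int K + int b) ({-J..<J} \<times> {..<K}) {-(J * int K)..<J * int K}"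
proof (rule bij_betw_byWitness[where f' = "\<lambda>u. (u div int K, nat (u mod int K))"])
  show "\<forall>ab\<in>{-J..<J} \<times> {..<K}. (\<lambda>u. (u div int K, nat (u mod int K))) ((\<lambda>(a, b). a * int K + int b) ab) = ab"
    by auto
  show "\<forall>u\<in>{-(J * int K)..<J * int K}. (\<lambda>(a, b). a * int K + int b) (u div int K, nat (u mod int K)) = u"
    using assms by auto
  show "(\<lambda>(a, b). a * int K + int b) ` ({-J..<J} \<times> {..<K}) \<subseteq> {-(J * int K)..<J * int K}"
  proof
    fix u assume "u \<in> (\<lambda>(a, b). a * int K + int b) ` ({-J..<J} \<times> {..<K})"
    then obtain a b where u: "u = a * int K + int b" and ab: "-J \<le> a" "a < J" "b < K" by auto
    have "-J * int K \<le> a * int K" using ab by (intro mult_right_mono) auto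
    moreover have "(a + 1) * int K \<le> J * int K" using ab by (intro mult_right_mono) auto
    ultimately show "u \<in> {-(J * int K)..<J * int K}" using ab by (auto simp: u algebra_simps)
  qed
  show "(\<lambda>u. (u div int K, nat (u mod int K))) ` {-(J * int K)..<J * int K} \<subseteq> {-J..<J} \<times> {..<K}"
  proof (rule image_subsetI)
    fix u assume u: "u \<in> {-(J * int K)..<J * int K}"
    have K: "int K > 0" using assms by simp
    have "(-J * int K) div int K \<le> u div int K" using u K by (intro zdiv_mono1) auto
    moreover have "(-J * int K) div int K = -J" using K by (intro nonzero_mult_div_cancel_right) simp
    ultimately have "-J \<le> u div int K" by simp
    moreover have "u div int K < J"
    proof (rule ccontr)
      assume "\<not> u div int K < J"
      then have "J * int K \<le> u div int K * int K" by (intro mult_right_mono) auto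
      also have "\<dots> \<le> u" using div_mult_mod_eq[of u "int K"] pos_mod_sign[OF K, of u] by linarith
      finally show False using u by simp
    qed
    moreover have "nat (u mod int K) < K" using K by (simp add: nat_less_iff)
    ultimately show "(u div int K, nat (u mod int K)) \<in> {-J..<J} \<times> {..<K}" by simp
  qed
qed

lemma ivert_append:
  "ivert d (\<lambda>i\<in>{..d}. n i * int K + int (m i)) \<omega> = ivert d n \<omega> * int K + int (vert d m \<omega>)"
  by (simp add: ivert_def vert_def algebra_simps sum.distrib sum_distrib_left)

text \<open>The equation determines \<open>n 0\<close> from the other \<open>d\<close> coordinates,
  so exceptional blocks lose one dimension.\<close>

lemma card_ivert_eq:
  assumes "finite I"
  shows "card {n \<in> {..d} \<rightarrow>\<^sub>E I. ivert d n \<omega> = t} \<le> card I ^ d"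
proof -
  define A where "A = {n \<in> {..d} \<rightarrow>\<^sub>E I. ivert d n \<omega> = t}"
  have "card A \<le> card ({1..d} \<rightarrow>\<^sub>E I)"
  proof (rule card_inj_on_le[where f = "\<lambda>n. restrict n {1..d}"])
    show "inj_on (\<lambda>n. restrict n {1..d}) A"
    proof (rule inj_onI)
      fix n n' assume n: "n \<in> A" "n' \<in> A" "restrict n {1..d} = restrict n' {1..d}"
      have eq: "n i = n' i" if "i \<in> {1..d}" for i using fun_cong[OF n(3), of i] that by simp
      then have "(\<Sum>i=1..d. int (\<omega> i) * n i) = (\<Sum>i=1..d. int (\<omega> i) * n' i)"
        by (intro sum.cong refl) simp
      then have 0: "n 0 = n' 0" using n by (simp add: A_def ivert_def)
      have eq': "n i = n' i" if "i \<le> d" for i using eq[of i] 0 that by (cases "i = 0") auto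
      show "n = n'" by (rule PiE_ext[of n "{..d}" "\<lambda>_. I"]) (use n eq' in \<open>auto simp: A_def\<close>)
    qed
    show "(\<lambda>n. restrict n {1..d}) ` A \<subseteq> {1..d} \<rightarrow>\<^sub>E I" by (auto simp: A_def)
  qed (use assms in \<open>simp add: finite_PiE\<close>)
  then show ?thesis by (simp add: A_def card_PiE)
qed

lemma restrict_interval_inside: "x < N \<Longrightarrow> restrict_interval N a (int x) = a x"
  by (simp add: restrict_interval_def)

lemma norm_cubeprod_le:
  "(\<And>\<omega>. \<omega> \<in> cube d \<Longrightarrow> norm (g \<omega>) \<le> B) \<Longrightarrow> norm (cubeprod d g) \<le> B ^ card (cube d)"
  unfolding cubeprod_def by (intro prod_norm_le_power finite_cube) (simp add: norm_cnj_funpow)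

text \<open>Cut \<open>{0..<N}\<close> into blocks of length \<open>K\<close>.  All parallelepipeds of blocks avoiding the block \<open>0\<close>,
  where leading zeros matter, and the last, incomplete block contribute either \<open>0\<close> or at most \<open>S\<close>.\<close>

lemma interval_cubes_block_bound:
  fixes N :: nat
  assumes K: "K > 0" and B: "\<And>n. norm (a n) \<le> B"
    and S: "\<And>v. (\<And>\<omega>. \<omega> \<in> cube d \<Longrightarrow> v \<omega> \<ge> 1) \<Longrightarrow>
      norm (\<Sum>m\<in>box d K. cubeprod d (\<lambda>\<omega>. a (v \<omega> * K + vert d m \<omega>))) \<le> S"
  defines "J \<equiv> N div K + 1"
  shows "norm (interval_cubes d N (restrict_interval N a))
    \<le> real (card (cube d) * (d + 1) * 2) * real (2 * J) ^ d * (real K ^ (d + 1) * B ^ card (cube d))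
      + real (2 * J) ^ (d + 1) * S"
proof -
  define f where "f = restrict_interval N a"
  define Z where "Z = {..d} \<rightarrow>\<^sub>E {- int J..<int J}"
  have finZ: "finite Z" by (simp add: Z_def finite_PiE)
  have B0: "B \<ge> 0" using order_trans[OF norm_ge_zero B[of 0]] .
  have fB: "norm (f x) \<le> B" for x using B B0 by (auto simp: f_def restrict_interval_def)
  have S0: "S \<ge> 0" using order_trans[OF norm_ge_zero S[of "\<lambda>_. 1"]] by simp
  have JK: "int N \<le> int J * int K"
  proof -
    have "N \<le> J * K" using K mod_less_divisor[of K N] div_mult_mod_eq[of N K]
      unfolding J_def add_mult_distrib by linarith
    then show ?thesis by (simp only: of_nat_mult[symmetric] of_nat_le_iff)
  qed
  define inner where "inner n = (\<Sum>m\<in>box d K. cubeprod d (\<lambda>\<omega>. f (ivert d n \<omega> * int K + int (vert d m \<omega>))))" for n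
  have split: "interval_cubes d N f = (\<Sum>n\<in>Z. inner n)"
  proof -
    have "interval_cubes d N f = (\<Sum>n\<in>{..d} \<rightarrow>\<^sub>E {-(int J * int K)..<int J * int K}. cubeprod d (\<lambda>\<omega>. f (ivert d n \<omega>)))"
      unfolding f_def by (rule interval_cubes_eq_box[OF JK restrict_interval_outside])
    also have "\<dots> = (\<Sum>n\<in>Z. inner n)"
      unfolding Z_def inner_def box_def ivert_append[symmetric]
      by (rule sum_PiE_split[OF bij_betw_int_digits[OF K]])
    finally show ?thesis .
  qed
  \<comment> \<open>The lower digits may push a vertex up by a carry of at most \<open>d\<close>
    blocks; none of the blocks it can end in may be one of the two exceptional ones.\<close>
  define bad where "bad = {n \<in> Z. \<exists>\<omega>\<in>cube d. \<exists>r\<le>d. ivert d n \<omega> + int r \<in> {0, int (N div K)}}"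
  have card_bad: "card bad \<le> card (cube d) * (d + 1) * 2 * (2 * J) ^ d"
  proof -
    define I where "I = cube d \<times> {..d} \<times> {0, int (N div K)}"
    define A where "A q = {n \<in> Z. ivert d n (fst q) = snd (snd q) - int (fst (snd q))}" for q :: "(nat \<Rightarrow> nat) \<times> nat \<times> int"
    have "bad \<subseteq> (\<Union>q\<in>I. A q)"
    proof
      fix n assume "n \<in> bad"
      then obtain \<omega> r where r: "n \<in> Z" "\<omega> \<in> cube d" "r \<le> d" "ivert d n \<omega> + int r \<in> {0, int (N div K)}"
        unfolding bad_def by blast
      then have "(\<omega>, r, ivert d n \<omega> + int r) \<in> I" "n \<in> A (\<omega>, r, ivert d n \<omega> + int r)"
        unfolding I_def A_def by auto
      then show "n \<in> (\<Union>q\<in>I. A q)" by blast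
    qed
    have finI: "finite I" by (simp add: I_def finite_cube)
    have "card bad \<le> card (\<Union>q\<in>I. A q)"
      using \<open>bad \<subseteq> _\<close> finZ finI by (intro card_mono finite_UN_I) (auto simp: A_def)
    also have "\<dots> \<le> (\<Sum>q\<in>I. card (A q))" using finI by (rule card_UN_le)
    also have "\<dots> \<le> of_nat (card I) * (2 * J) ^ d"
    proof (rule sum_bounded_above)
      fix q
      have "card {- int J..<int J} = 2 * J" by simp
      then show "card (A q) \<le> (2 * J) ^ d" unfolding A_def Z_def
        using card_ivert_eq[of "{- int J..<int J}" d "fst q" "snd (snd q) - int (fst (snd q))"] by simp
    qed
    also have "of_nat (card I) \<le> card (cube d) * (d + 1) * 2"
    proof -
      have "card I = card (cube d) * ((d + 1) * card {0, int (N div K)})"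
        by (simp add: I_def card_cartesian_product)
      also have "\<dots> \<le> card (cube d) * ((d + 1) * 2)"
        by (intro mult_le_mono le_refl) (simp add: card_insert_if)
      finally show ?thesis by (simp add: mult.assoc)
    qed
    finally show ?thesis by simp
  qed
  have inner_bad: "norm (inner n) \<le> real K ^ (d + 1) * B ^ card (cube d)" for n
  proof -
    have "norm (inner n) \<le> real (card (box d K)) * B ^ card (cube d)"
      unfolding inner_def using fB
      by (intro order_trans[OF norm_sum] sum_bounded_above norm_cubeprod_le)
    then show ?thesis by (simp add: card_box)
  qed
  have inner_good: "norm (inner n) \<le> S" if n: "n \<in> Z - bad" for n
  proof -
    have avoid: "ivert d n \<omega> + int r \<noteq> 0" "ivert d n \<omega> + int r \<noteq> int (N div K)" if "\<omega> \<in> cube d" "r \<le> d" for \<omega> r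
      using n that unfolding bad_def by blast+
    have KN: "int (N div K) * int K \<le> int N" unfolding of_nat_mult[symmetric] of_nat_le_iff by simp
    show ?thesis
    \<comment> \<open>No carry lands on an exceptional block, so carries cannot move a vertex across
      one: either all vertices stay in complete blocks other than the first, or some vertex is
      outside the interval for every \<open>m\<close>.\<close>
    proof (cases "\<forall>\<omega>\<in>cube d. 0 < ivert d n \<omega> \<and> ivert d n \<omega> < int (N div K)")
      case True
      have "f (ivert d n \<omega> * int K + int (vert d m \<omega>)) = a (nat (ivert d n \<omega>) * K + vert d m \<omega>)"
        if m: "m \<in> box d K" and \<omega>: "\<omega> \<in> cube d" for m \<omega>
      proof -
        define \<beta> where "\<beta> = nat (ivert d n \<omega>)"
        have \<beta>: "ivert d n \<omega> = int \<beta>" using True \<omega> by (auto simp: \<beta>_def intro: less_imp_le)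
        have lt: "\<beta> + d < N div K"
        proof (rule ccontr)
          assume nlt: "\<not> \<beta> + d < N div K"
          have "\<beta> < N div K" using True \<omega> \<beta> by auto
          then have "N div K - \<beta> \<le> d" "int \<beta> + int (N div K - \<beta>) = int (N div K)" using nlt by auto
          then show False using avoid(2)[OF \<omega>] \<beta> by metis
        qed
        have "vert d m \<omega> div K \<le> d" using vert_carry_le[OF m \<omega>, of 0] by simp
        then have "vert d m \<omega> < (d + 1) * K" using div_less_iff_less_mult[OF K, of "vert d m \<omega>" "d + 1"] by simp
        then have "\<beta> * K + vert d m \<omega> < (\<beta> + d + 1) * K" by (simp add: algebra_simps)
        also have "\<dots> \<le> (N div K) * K" using lt by (intro mult_right_mono) auto
        also have "\<dots> \<le> N" by simp
        finally have lt': "\<beta> * K + vert d m \<omega> < N" .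
        have e: "ivert d n \<omega> * int K + int (vert d m \<omega>) = int (\<beta> * K + vert d m \<omega>)" using \<beta> by simp
        have "f (int (\<beta> * K + vert d m \<omega>)) = a (\<beta> * K + vert d m \<omega>)"
          unfolding f_def using lt' by (rule restrict_interval_inside)
        then show ?thesis unfolding e \<beta>_def[symmetric] .
      qed
      then have "inner n = (\<Sum>m\<in>box d K. cubeprod d (\<lambda>\<omega>. a (nat (ivert d n \<omega>) * K + vert d m \<omega>)))"
        unfolding inner_def by (intro sum.cong cubeprod_cong refl)
      also have "norm \<dots> \<le> S"
      proof (rule S)
        fix \<omega> assume "\<omega> \<in> cube d"
        then have "0 < ivert d n \<omega>" using True by blast
        then show "1 \<le> nat (ivert d n \<omega>)" by linarith
      qed
      finally show ?thesis .
    next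
      case False
      then obtain \<omega> where \<omega>: "\<omega> \<in> cube d" "ivert d n \<omega> \<le> 0 \<or> ivert d n \<omega> \<ge> int (N div K)" by force
      have "f (ivert d n \<omega> * int K + int (vert d m \<omega>)) = 0" if m: "m \<in> box d K" for m
      proof (cases "ivert d n \<omega> \<le> 0")
        case True
        \<comment> \<open>Otherwise the carry \<open>- ivert d n \<omega>\<close> would be
          admissible and land on block 0. So even the largest carry leaves the vertex
          negative.\<close>
        have "ivert d n \<omega> + int d < 0"
        proof (rule ccontr)
          assume "\<not> ivert d n \<omega> + int d < 0"
          then have "nat (- ivert d n \<omega>) \<le> d" "ivert d n \<omega> + int (nat (- ivert d n \<omega>)) = 0" using True by auto
          then show False using avoid(1)[OF \<omega>(1)] by blast
        qed
        then have "(ivert d n \<omega> + int d + 1) * int K \<le> 0" by (simp add: mult_le_0_iff)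
        moreover have "vert d m \<omega> div K \<le> d" using vert_carry_le[OF m \<omega>(1), of 0] by simp
        then have "vert d m \<omega> < (d + 1) * K" using div_less_iff_less_mult[OF K, of "vert d m \<omega>" "d + 1"] by simp
        then have "int (vert d m \<omega>) < (int d + 1) * int K"
          unfolding of_nat_less_iff[symmetric, where 'a = int] by (simp add: algebra_simps)
        ultimately have "ivert d n \<omega> * int K + int (vert d m \<omega>) < 0" by (simp add: algebra_simps)
        then show ?thesis unfolding f_def by (intro restrict_interval_outside) simp
      next
        case False
        then have "int (N div K) + 1 \<le> ivert d n \<omega>" using \<omega> avoid(2)[OF \<omega>(1), of 0] by simp
        then have "(int (N div K) + 1) * int K \<le> ivert d n \<omega> * int K" by (intro mult_right_mono) auto
        moreover have "int N \<le> (int (N div K) + 1) * int K" using JK by (simp add: J_def algebra_simps)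
        ultimately show ?thesis unfolding f_def by (intro restrict_interval_outside) simp
      qed
      then have "inner n = 0"
        unfolding inner_def using \<omega>(1) by (intro sum.neutral ballI) (rule cubeprod_zero)
      then show ?thesis using S0 by simp
    qed
  qed
  have "norm (\<Sum>n\<in>Z. inner n) \<le> norm (\<Sum>n\<in>bad. inner n) + norm (\<Sum>n\<in>Z - bad. inner n)"
    using finZ by (subst sum.subset_diff[of bad Z]) (auto simp: bad_def add.commute intro: norm_triangle_ineq)
  also have "norm (\<Sum>n\<in>bad. inner n) \<le> real (card bad) * (real K ^ (d + 1) * B ^ card (cube d))"
    using inner_bad by (intro order_trans[OF norm_sum] sum_bounded_above)
  also have "\<dots> \<le> real (card (cube d) * (d + 1) * 2 * (2 * J) ^ d) * (real K ^ (d + 1) * B ^ card (cube d))"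
    using card_bad B0 by (intro mult_right_mono) (simp_all only: of_nat_le_iff, simp)
  also have "norm (\<Sum>n\<in>Z - bad. inner n) \<le> real (card (Z - bad)) * S"
    using inner_good by (intro order_trans[OF norm_sum] sum_bounded_above)
  also have "\<dots> \<le> real (2 * J) ^ (d + 1) * S"
  proof (rule mult_right_mono[OF _ S0])
    have "card (Z - bad) \<le> card Z" using finZ by (intro card_mono) auto
    also have "card Z = (2 * J) ^ (d + 1)"
    proof -
      have "card {- int J..<int J} = 2 * J" by simp
      then show ?thesis unfolding Z_def card_PiE[OF finite_atMost] by (simp del: card_atLeastLessThan_int)
    qed
    finally show "real (card (Z - bad)) \<le> real (2 * J) ^ (d + 1)" unfolding of_nat_power[symmetric] of_nat_le_iff .
  qed
  finally show ?thesis unfolding f_def[symmetric] split by (simp only: of_nat_mult of_nat_power)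
qed

text \<open>Take \<open>K\<close> near the square root of \<open>N\<close>. The exceptional blocks
  give order \<open>N ^ d * K\<close>, which saves \<open>1 / 2\<close> in the exponent; the others
  save \<open>K powr (- c)\<close>, that is \<open>c / 2\<close>.\<close>

lemma interval_cubes_upper:
  assumes k: "k \<ge> 2" and B: "\<And>n. norm (a n) \<le> B" and c: "c > 0" and C: "C \<ge> 0"
    and S: "\<And>L v. (\<And>\<omega>. \<omega> \<in> cube d \<Longrightarrow> v \<omega> \<ge> 1) \<Longrightarrow>
      norm (\<Sum>m\<in>box d (k ^ L). cubeprod d (\<lambda>\<omega>. a (v \<omega> * k ^ L + vert d m \<omega>)))
        \<le> C * real (k ^ L) ^ (d + 1) * real (k ^ L) powr (- c)"
  shows "\<exists>A\<ge>0. \<forall>N\<ge>1. norm (interval_cubes d N (restrict_interval N a))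
    \<le> A * real N ^ (d + 1) * real N powr (- min (1 / 2) (c / 2))"
proof -
  define e where "e = min (1 / 2) (c / 2)"
  define B' where "B' = B ^ card (cube d)"
  define D where "D = real (card (cube d) * (d + 1) * 2)"
  define A where "A = D * B' * 4 ^ d + C * 4 ^ (d + 1) * real k powr c"
  have "B \<ge> 0" using order_trans[OF norm_ge_zero B[of 0]] .
  then have B'0: "B' \<ge> 0" by (simp add: B'_def)
  have D0: "D \<ge> 0" by (simp add: D_def)
  have "norm (interval_cubes d N (restrict_interval N a)) \<le> A * real N ^ (d + 1) * real N powr (- e)"
    if N: "N \<ge> 1" for N
  proof -
    have "2 \<le> k ^ 2" using power_mono[OF k, of 2] by simp
    \<comment> \<open>Bracketing \<open>N\<close> by powers of \<open>k ^ 2\<close> yields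
      \<open>K ^ 2 \<le> N < (k * K) ^ 2\<close> for \<open>K = k ^ L\<close>.\<close>
    then obtain L where L: "(k ^ 2) ^ L \<le> N" "N < (k ^ 2) ^ (L + 1)"
      using ex_power_ivl1[OF _ N] by blast
    define K where "K = k ^ L"
    define J where "J = N div K + 1"
    have K0: "K > 0" using k by (simp add: K_def)
    have "(k ^ 2) ^ L = K ^ 2" by (simp add: K_def mult.commute flip: power_mult)
    then have L1: "K ^ 2 \<le> N" using L(1) by simp
    have "(k ^ 2) ^ (L + 1) = (k * K) ^ 2" by (simp add: K_def mult.commute power_mult_distrib flip: power_mult)
    then have L2: "N < (k * K) ^ 2" using L(2) by simp
    have KN: "K \<le> N" using L1 K0 by (metis le_square le_trans power2_eq_square)
    have "J * K \<le> N + K" by (simp add: J_def add_mult_distrib)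
    then have "2 * J * K \<le> 4 * N" using KN by simp
    then have JK: "real (2 * J) * real K \<le> 4 * real N" by (metis of_nat_le_iff of_nat_mult of_nat_numeral)
    have sK: "real K \<le> real N powr (1 / 2)"
    proof -
      have "real K = sqrt (real K ^ 2)" by simp
      also have "\<dots> \<le> sqrt (real N)" using L1 by (intro real_sqrt_le_mono) (metis of_nat_le_iff of_nat_power)
      finally show ?thesis by (simp add: powr_half_sqrt)
    qed
    have sK': "real N powr (1 / 2) \<le> real k * real K"
    proof -
      have "sqrt (real N) \<le> sqrt ((real k * real K) ^ 2)"
        using L2 by (intro real_sqrt_le_mono) (metis less_imp_le of_nat_le_iff of_nat_mult of_nat_power)
      then show ?thesis by (simp add: powr_half_sqrt)
    qed
    have mono: "real N powr (- x) \<le> real N powr (- e)" if "e \<le> x" for x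
      using N that by (intro powr_mono) auto
    have T1: "real (2 * J) ^ d * (real K ^ (d + 1) * B') \<le> B' * 4 ^ d * (real N ^ (d + 1) * real N powr (- e))"
    proof -
      have "real (2 * J) ^ d * (real K ^ (d + 1) * B') = B' * ((real (2 * J) * real K) ^ d * real K)"
        by (simp add: power_mult_distrib)
      also have "\<dots> \<le> B' * ((4 * real N) ^ d * real N powr (1 / 2))"
        by (intro mult_left_mono[OF _ B'0] mult_mono[OF power_mono[OF JK] sK]) auto
      also have "real N powr (1 / 2) = real N * real N powr (- (1 / 2))"
        using N by (simp add: powr_minus_divide powr_half_sqrt real_div_sqrt)
      also have "B' * ((4 * real N) ^ d * (real N * real N powr (- (1 / 2))))
        \<le> B' * ((4 * real N) ^ d * (real N * real N powr (- e)))"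
        using B'0 by (intro mult_left_mono mono) (auto simp: e_def)
      finally show ?thesis by (simp add: power_mult_distrib mult_ac)
    qed
    have T2: "real (2 * J) ^ (d + 1) * (C * real K ^ (d + 1) * real K powr (- c))
      \<le> C * 4 ^ (d + 1) * real k powr c * (real N ^ (d + 1) * real N powr (- e))"
    proof -
      have Kc: "real K powr (- c) \<le> real k powr c * real N powr (- e)"
      proof -
        have "real N powr (c / 2) = (real N powr (1 / 2)) powr c" by (simp add: powr_powr)
        also have "\<dots> \<le> (real k * real K) powr c" using sK' c by (intro powr_mono2) auto
        also have "\<dots> = real k powr c * real K powr c" by (simp add: powr_mult)
        finally have "real K powr (- c) \<le> real k powr c * real N powr (- (c / 2))"
          using K0 N by (simp add: powr_minus field_simps)
        also have "\<dots> \<le> real k powr c * real N powr (- e)"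
          by (intro mult_left_mono mono) (auto simp: e_def)
        finally show ?thesis .
      qed
      have "real (2 * J) ^ (d + 1) * (C * real K ^ (d + 1) * real K powr (- c))
        = C * ((real (2 * J) * real K) ^ (d + 1) * real K powr (- c))"
        by (simp add: power_mult_distrib)
      also have "\<dots> \<le> C * ((4 * real N) ^ (d + 1) * (real k powr c * real N powr (- e)))"
        by (intro mult_left_mono[OF _ C] mult_mono[OF power_mono[OF JK] Kc]) auto
      finally show ?thesis by (simp only: power_mult_distrib mult_ac)
    qed
    have "norm (interval_cubes d N (restrict_interval N a))
      \<le> D * real (2 * J) ^ d * (real K ^ (d + 1) * B') + real (2 * J) ^ (d + 1) * (C * real K ^ (d + 1) * real K powr (- c))"
      unfolding D_def B'_def J_def
      by (rule interval_cubes_block_bound[OF K0 B]) (use S K_def in blast)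
    also have "D * real (2 * J) ^ d * (real K ^ (d + 1) * B')
      \<le> D * (B' * 4 ^ d * (real N ^ (d + 1) * real N powr (- e)))"
      unfolding mult.assoc[of D] using D0 by (intro mult_left_mono T1)
    also note T2
    finally show ?thesis by (simp add: A_def algebra_simps)
  qed
  moreover have "A \<ge> 0" using B'0 D0 C by (simp add: A_def)
  ultimately show ?thesis by (auto simp: e_def)
qed

text \<open>All terms are 0 or 1, and coordinates below \<open>N div (d + 1)\<close> keep the whole
  parallelepiped inside the interval.\<close>

lemma interval_cubes_one_lower:
  assumes N: "N > 0"
  shows "real (N div (d + 1)) ^ (d + 1) \<le> Re (interval_cubes d N (restrict_interval N (\<lambda>_. 1)))"
proof -
  define f where "f = restrict_interval N (\<lambda>_. 1)"
  define M where "M = N div (d + 1)"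
  have M: "(d + 1) * M \<le> N" unfolding M_def by (rule times_div_less_eq_dividend)
  have f01: "f x = 0 \<or> f x = 1" for x by (simp add: f_def restrict_interval_def)
  have cnj1: "(cnj ^^ j) 1 = 1" for j by (induction j) auto
  have nonneg: "0 \<le> Re (cubeprod d (\<lambda>\<omega>. f (g \<omega>)))" for g
  proof (cases "\<exists>\<omega>\<in>cube d. f (g \<omega>) = 0")
    case True
    then show ?thesis using cubeprod_zero by force
  next
    case False
    then have "cubeprod d (\<lambda>\<omega>. f (g \<omega>)) = 1"
      unfolding cubeprod_def using f01 cnj1 by (intro prod.neutral ballI) metis
    then show ?thesis by simp
  qed
  have one: "cubeprod d (\<lambda>\<omega>. f (ivert d n \<omega>)) = 1" if n: "n \<in> {..d} \<rightarrow>\<^sub>E {0..<int M}" for n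
  proof -
    have n': "0 \<le> n i" "n i \<le> int M - 1" if "i \<le> d" for i using n that by force+
    have "f (ivert d n \<omega>) = 1" if \<omega>: "\<omega> \<in> cube d" for \<omega>
    proof -
      have b: "0 \<le> int (\<omega> i) * n i \<and> int (\<omega> i) * n i \<le> int M - 1" if i: "i \<in> {1..d}" for i
      proof -
        have "\<omega> i = 0 \<or> \<omega> i = 1" using cube_le_1[OF \<omega> i] by linarith
        then show ?thesis using n'[of i] i by auto
      qed
      have "0 \<le> (\<Sum>i=1..d. int (\<omega> i) * n i)" using b by (intro sum_nonneg) auto
      moreover have "(\<Sum>i=1..d. int (\<omega> i) * n i) \<le> (\<Sum>i=1..d. int M - 1)" using b by (intro sum_mono) auto
      ultimately have "0 \<le> ivert d n \<omega>" "ivert d n \<omega> \<le> int M - 1 + int d * (int M - 1)"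
        using n'[of 0] by (auto simp: ivert_def)
      moreover have "int M - 1 + int d * (int M - 1) < int N"
      proof -
        have "(int d + 1) * int M \<le> int N" using M by (metis of_nat_1 of_nat_add of_nat_le_iff of_nat_mult)
        then show ?thesis by (simp add: algebra_simps)
      qed
      ultimately show ?thesis by (simp add: f_def restrict_interval_def)
    qed
    then show ?thesis unfolding cubeprod_def by (intro prod.neutral ballI) (simp add: cnj1)
  qed
  have "real M ^ (d + 1) = (\<Sum>n\<in>{..d} \<rightarrow>\<^sub>E {0..<int M}. Re (cubeprod d (\<lambda>\<omega>. f (ivert d n \<omega>))))"
    by (simp add: one card_PiE)
  also have "\<dots> \<le> (\<Sum>n\<in>{..d} \<rightarrow>\<^sub>E {- int N..<int N}. Re (cubeprod d (\<lambda>\<omega>. f (ivert d n \<omega>))))"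
  proof (rule sum_mono2)
    show "{..d} \<rightarrow>\<^sub>E {0..<int M} \<subseteq> {..d} \<rightarrow>\<^sub>E {- int N..<int N}"
      using div_le_dividend[of N "d + 1"] by (intro PiE_mono) (auto simp: M_def)
  qed (auto simp: finite_PiE nonneg)
  also have "\<dots> = Re (interval_cubes d N f)"
    unfolding f_def by (subst interval_cubes_eq_box[OF order_refl restrict_interval_outside]) auto
  finally show ?thesis by (simp only: f_def M_def)
qed

text \<open>The normalising sum has the full order \<open>N ^ (d + 1)\<close>, so the saving of the
  numerator survives; the root divides its exponent by \<open>2 ^ d\<close>.\<close>

lemma gowers_norm_interval_decay:
  assumes k: "k \<ge> 2" and d: "d \<ge> 1" and B: "\<And>n. norm (a n) \<le> B" and c: "c > 0" and C: "C \<ge> 0"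
    and S: "\<And>L v. (\<And>\<omega>. \<omega> \<in> cube d \<Longrightarrow> v \<omega> \<ge> 1) \<Longrightarrow>
      norm (\<Sum>m\<in>box d (k ^ L). cubeprod d (\<lambda>\<omega>. a (v \<omega> * k ^ L + vert d m \<omega>)))
        \<le> C * real (k ^ L) ^ (d + 1) * real (k ^ L) powr (- c)"
  shows "\<exists>e>0. (\<lambda>N. gowers_norm_interval d N a) \<in> O(\<lambda>N. real N powr (- e))"
proof -
  define e where "e = min (1 / 2) (c / 2)"
  have e: "e > 0" using c by (simp add: e_def)
  obtain A where A: "A \<ge> 0" "\<And>N. N \<ge> 1 \<Longrightarrow> norm (interval_cubes d N (restrict_interval N a))
    \<le> A * real N ^ (d + 1) * real N powr (- e)"
    using interval_cubes_upper[OF k B c C S] unfolding e_def by blast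
  define q where "q = (2::nat) ^ d"
  have q: "q > 0" by (simp add: q_def)
  define A' where "A' = A * real (2 * (d + 1)) ^ (d + 1)"
  have A': "A' \<ge> 0" using A(1) by (simp add: A'_def)
  \<comment> \<open>The threshold gives \<open>M = N div (d + 1) \<ge> 2\<close>, so that rounding
    costs at most a factor 2: \<open>N \<le> 2 * (d + 1) * M\<close>.\<close>
  have "norm (gowers_norm_interval d N a) \<le> root q A' * norm (real N powr (- (e / q)))"
    if N: "N \<ge> 2 * (d + 1)" for N
  proof -
    define T where "T = Re (interval_cubes d N (restrict_interval N a))"
    define T1 where "T1 = Re (interval_cubes d N (restrict_interval N (\<lambda>_. 1)))"
    define M where "M = N div (d + 1)"
    have "2 * (d + 1) div (d + 1) \<le> M" unfolding M_def by (rule div_le_mono[OF N])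
    moreover have "2 * (d + 1) div (d + 1) = 2" by (rule nonzero_mult_div_cancel_right) simp
    ultimately have "2 \<le> M" by simp
    have "N < (M + 1) * (d + 1)" unfolding M_def
      using dividend_less_div_times[of "d + 1" N] by (simp only: add_mult_distrib) simp
    also have "\<dots> \<le> M * (d + 1) + M * (d + 1)"
      unfolding add_mult_distrib using \<open>2 \<le> M\<close> by (intro add_left_mono mult_right_mono) auto
    finally have "N \<le> M * (2 * (d + 1))" by simp
    then have NM: "real N \<le> real M * real (2 * (d + 1))" by (simp only: of_nat_mult[symmetric] of_nat_le_iff)
    have M0: "real M > 0" using NM N by (cases "M = 0") auto
    have T1_ge: "real M ^ (d + 1) \<le> T1" unfolding T1_def M_def using N by (intro interval_cubes_one_lower) simp
    have T1: "T1 > 0" "real M ^ (d + 1) \<le> T1"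
      using less_le_trans[OF zero_less_power[OF M0] T1_ge] T1_ge .
    have "\<bar>T\<bar> \<le> A * real N ^ (d + 1) * real N powr (- e)"
      unfolding T_def using A(2)[of N] N abs_Re_le_cmod order_trans by fastforce
    also have "\<dots> \<le> A * (real M * real (2 * (d + 1))) ^ (d + 1) * real N powr (- e)"
      using NM A(1) by (intro mult_right_mono mult_left_mono power_mono) auto
    also have "\<dots> = real M ^ (d + 1) * (A' * real N powr (- e))"
      by (simp only: A'_def power_mult_distrib mult_ac)
    also have "\<dots> \<le> T1 * (A' * real N powr (- e))"
      using T1 A' by (intro mult_right_mono) auto
    finally have "\<bar>T / T1\<bar> \<le> A' * real N powr (- e)" using T1 by (simp add: field_simps)
    then have "root q \<bar>T / T1\<bar> \<le> root q (A' * real N powr (- e))" using q by simp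
    also have "\<dots> = root q A' * real N powr (- (e / q))"
      using q N by (simp add: real_root_mult root_powr_inverse powr_powr)
    finally show ?thesis using d N q
      by (simp add: gowers_norm_interval_eq T_def T1_def q_def flip: real_root_abs)
  qed
  then have "(\<lambda>N. gowers_norm_interval d N a) \<in> O(\<lambda>N. real N powr (- (e / q)))"
    by (intro bigoI[where c = "root q A'"] eventually_sequentiallyI[of "2 * (d + 1)"])
  then show ?thesis using e q by (intro exI[of _ "e / q"]) simp
qed

section \<open>The two parts\<close>

definition word_value :: "nat \<Rightarrow> nat list \<Rightarrow> nat" where
  "word_value k w = foldl (\<lambda>x j. x * k + j) 0 w"

lemma foldl_eq_run:
  assumes "k > 0" "w \<in> lists {..<k}"
  shows "foldl \<delta> y w = run k \<delta> (length w) (word_value k w) y \<and> word_value k w < k ^ length w"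
  using assms(2)
proof (induction w rule: rev_induct)
  case (snoc j w)
  then have w: "foldl \<delta> y w = run k \<delta> (length w) (word_value k w) y" "word_value k w < k ^ length w" "j < k"
    by auto
  have v: "word_value k (w @ [j]) = word_value k w * k + j" by (simp add: word_value_def)
  have "word_value k w * k ^ 1 + j < k ^ (length w + 1)" using w by (intro number_append_less) auto
  then show ?case using w by (simp add: v)
qed (simp add: word_value_def)

lemma run_eq_foldl: "k > 0 \<Longrightarrow> \<exists>w\<in>lists {..<k}. \<forall>y. run k \<delta> L x y = foldl \<delta> y w"
proof (induction L arbitrary: x)
  case (Suc L)
  then obtain w where "w \<in> lists {..<k}" "\<forall>y. run k \<delta> L (x div k) y = foldl \<delta> y w" by blast
  then show ?case using Suc.prems by (intro bexI[of _ "w @ [x mod k]"]) auto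
qed (auto intro: bexI[of _ "[]"])

lemma base_expansion_lists: "base_expansion k n \<in> lists {..<k}"
proof (induction n rule: less_induct)
  case (less n)
  then show ?case using div_less_dividend[of k n] by (subst base_expansion.simps) auto
qed

lemma word_value_base_expansion: "k \<ge> 2 \<Longrightarrow> word_value k (base_expansion k n) = n"
proof (induction n rule: less_induct)
  case (less n)
  show ?case
  proof (cases "n = 0")
    case True
    then show ?thesis by (simp add: base_expansion.simps word_value_def)
  next
    case False
    then have "word_value k (base_expansion k (n div k)) = n div k"
      using less div_less_dividend[of k n] by simp
    moreover have "base_expansion k n = base_expansion k (n div k) @ [n mod k]"
      using False less.prems by (subst base_expansion.simps) simp
    ultimately show ?thesis by (simp add: word_value_def)
  qed
qed

text \<open>As in the Myhill-Nerode construction, the classes of words under \<open>\<theta>\<close>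
  become states, here coded by numbers. It provides the automata of both \<open>a_fs\<close> and the
  structured part.\<close>

lemma automaton_of_congruence:
  fixes \<theta> :: "nat list \<Rightarrow> 'x" and g :: "'x \<Rightarrow> 'o"
  assumes fin: "finite (\<theta> ` lists {..<k})"
    and cong: "\<And>w w' j. w \<in> lists {..<k} \<Longrightarrow> w' \<in> lists {..<k} \<Longrightarrow> j < k \<Longrightarrow> \<theta> w = \<theta> w' \<Longrightarrow>
      \<theta> (w @ [j]) = \<theta> (w' @ [j])"
  shows "\<exists>A :: (nat, 'o) automaton. k_automaton k A \<and>
    produced_sequence k A = (\<lambda>n. g (\<theta> (base_expansion k n))) \<and>
    ((\<exists>u\<in>lists {..<k}. \<forall>w\<in>lists {..<k}. \<forall>w'\<in>lists {..<k}. \<theta> (w @ u) = \<theta> (w' @ u)) \<longrightarrow> synchronising k A)"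
proof -
  define X where "X = \<theta> ` lists {..<k}"
  obtain enc :: "'x \<Rightarrow> nat" where enc: "inj_on enc X"
    using finite_imp_inj_to_nat_seg[OF fin] unfolding X_def by blast
  have encD: "\<theta> w = \<theta> w'" if "w \<in> lists {..<k}" "w' \<in> lists {..<k}" "enc (\<theta> w) = enc (\<theta> w')" for w w'
    using enc that by (auto simp: X_def inj_on_def)
  define rep where "rep s = (SOME w. w \<in> lists {..<k} \<and> enc (\<theta> w) = s)" for s
  have rep: "rep (enc (\<theta> w)) \<in> lists {..<k} \<and> \<theta> (rep (enc (\<theta> w))) = \<theta> w" if "w \<in> lists {..<k}" for w
    using someI[of "\<lambda>v. v \<in> lists {..<k} \<and> enc (\<theta> v) = enc (\<theta> w)" w] encD that
    unfolding rep_def by blast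
  define A :: "(nat, 'o) automaton" where
    "A = \<lparr>states = enc ` X, init = enc (\<theta> []), delta = (\<lambda>s j. enc (\<theta> (rep s @ [j]))),
      out = (\<lambda>s. g (inv_into X enc s))\<rparr>"
  have dw: "delta_word A (enc (\<theta> w)) v = enc (\<theta> (w @ v))" if w: "w \<in> lists {..<k}" and "v \<in> lists {..<k}" for w v
    using that(2)
  proof (induction v rule: rev_induct)
    case (snoc j v)
    then have "delta_word A (enc (\<theta> w)) (v @ [j]) = delta A (enc (\<theta> (w @ v))) j"
      by (simp add: delta_word_def)
    also have "\<dots> = enc (\<theta> (rep (enc (\<theta> (w @ v))) @ [j]))" by (simp add: A_def)
    also have "\<dots> = enc (\<theta> ((w @ v) @ [j]))"
      using rep[of "w @ v"] w snoc.prems cong[of "rep (enc (\<theta> (w @ v)))" "w @ v" j] by simp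
    finally show ?case by simp
  qed (simp add: delta_word_def)
  have "k_automaton k A"
  proof -
    have "enc (\<theta> (rep s @ [j])) \<in> enc ` X" if s: "s \<in> enc ` X" and "j < k" for s j
    proof -
      obtain w where w: "w \<in> lists {..<k}" "s = enc (\<theta> w)" using s by (auto simp: X_def)
      then have "rep s @ [j] \<in> lists {..<k}" using rep[OF w(1)] \<open>j < k\<close> by simp
      then show ?thesis unfolding X_def by (intro imageI)
    qed
    then show ?thesis using fin by (auto simp: k_automaton_def A_def X_def)
  qed
  moreover have "produced_sequence k A = (\<lambda>n. g (\<theta> (base_expansion k n)))"
  proof
    fix n
    have "produced_sequence k A n = out A (enc (\<theta> ([] @ base_expansion k n)))"
      using dw[of "[]" "base_expansion k n"] base_expansion_lists by (simp add: produced_sequence_def A_def)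
    then show "produced_sequence k A n = g (\<theta> (base_expansion k n))"
      using enc base_expansion_lists by (simp add: A_def X_def)
  qed
  moreover have "synchronising k A"
    if "u \<in> lists {..<k}" "\<forall>w\<in>lists {..<k}. \<forall>w'\<in>lists {..<k}. \<theta> (w @ u) = \<theta> (w' @ u)" for u
    unfolding synchronising_def
  proof (intro bexI ballI)
    fix s s' assume "s \<in> states A" "s' \<in> states A"
    then obtain w w' where w: "w \<in> lists {..<k}" "w' \<in> lists {..<k}" and s: "s = enc (\<theta> w)" "s' = enc (\<theta> w')"
      by (auto simp: A_def X_def)
    have "\<theta> (w @ u) = \<theta> (w' @ u)" using that(2) w by blast
    then show "delta_word A s u = delta_word A s' u"
      unfolding s dw[OF w(1) that(1)] dw[OF w(2) that(1)] by (rule arg_cong)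
  qed (rule that)
  ultimately show ?thesis by blast
qed

text \<open>\<open>ev\<close> is the factor map onto the given automaton with transitions
  \<open>dS\<close> and outputs \<open>\<tau>\<close>; \<open>fixed\<close> is prolongability, which
  holds only after applying \<open>ev\<close>.\<close>

locale pointed_extension = synchronising_extension k Y \<delta> lu xu
  for k and Y :: "'y set" and \<delta> lu xu +
  fixes y0 :: 'y and ev :: "'y \<Rightarrow> 's" and dS :: "'s \<Rightarrow> nat \<Rightarrow> 's" and \<tau> :: "'s \<Rightarrow> complex"
  assumes y0: "y0 \<in> Y"
    and ev_\<delta>: "\<And>y j. y \<in> Y \<Longrightarrow> j < k \<Longrightarrow> ev (\<delta> y j) = dS (ev y) j"
    and fixed: "dS (ev y0) 0 = ev y0"
begin

definition state :: "nat \<Rightarrow> 'y" where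
  "state n = foldl \<delta> y0 (base_expansion k n)"

lemma state_run: "\<exists>l. n < k ^ l \<and> state n = R l n y0"
  using foldl_eq_run[OF k_pos base_expansion_lists, of \<delta> y0 n] word_value_base_expansion[OF k_ge_2, of n]
  by (auto simp: state_def)

lemma state_closed: "state n \<in> Y"
  using state_run[of n] y0 run_closed by metis

text \<open>With a nonzero leading block no zeros are lost: the expansion is that of
  \<open>B\<close> followed by all \<open>L\<close> digits of \<open>v\<close>.\<close>

lemma state_append:
  assumes "B \<ge> 1"
  shows "v < k ^ L \<Longrightarrow> state (B * k ^ L + v) = R L v (state B)"
proof (induction L arbitrary: v)
  case (Suc L)
  define n where "n = B * k ^ Suc L + v"
  have n: "n div k = B * k ^ L + v div k" "n mod k = v mod k"
  proof -
    have "n = v + k * (B * k ^ L)" by (simp add: n_def)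
    then show "n div k = B * k ^ L + v div k" "n mod k = v mod k"
      using k_pos by (simp_all only: div_mult_self2 mod_mult_self2 add.commute)
  qed
  have "v div k < k ^ L" using Suc.prems k_pos by (simp add: div_less_iff_less_mult mult.commute)
  then have "state (n div k) = R L (v div k) (state B)" unfolding n by (rule Suc.IH)
  moreover have "n \<noteq> 0" using assms power_k_pos[of "Suc L"] by (simp add: n_def del: power_Suc)
  then have "state n = \<delta> (state (n div k)) (n mod k)"
    unfolding state_def using k_ge_2 by (subst base_expansion.simps) simp
  ultimately have "state n = R (Suc L) v (state B)" by (simp add: n)
  then show ?case by (simp only: n_def)
qed simp

lemma ev_run: "y \<in> Y \<Longrightarrow> y' \<in> Y \<Longrightarrow> ev y = ev y' \<Longrightarrow> ev (R L x y) = ev (R L x y')"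
  by (induction L arbitrary: x) (auto simp: ev_\<delta> run_closed k_pos)

lemma ev_zeros: "ev (R i 0 y0) = ev y0"
  by (induction i) (auto simp: ev_\<delta> run_closed k_pos y0 fixed)

section \<open>Averages over \<open>H\<close> and leading zeros\<close>

definition favg :: "'y \<Rightarrow> complex" where
  "favg y = (\<Sum>h\<in>H. \<tau> (ev (h y))) / of_nat (card H)"

lemma card_H: "card H > 0"
  using finite_H one_H by (auto simp: card_gt_0_iff)

lemma favg_H:
  assumes h: "h \<in> H" and y: "y \<in> Y" shows "favg (h y) = favg y"
proof -
  have "inj_on (\<lambda>g. g \<cdot> h) H"
  proof (rule inj_onI)
    fix g g' assume g: "g \<in> H" "g' \<in> H" "g \<cdot> h = g' \<cdot> h"
    then have "g (h y) = g' (h y)" using y by (metis mul_apply)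
    then show "g = g'" using g h y by (auto intro!: Aut_eqI[of g g' "h y"] H_Aut intro: Aut_closed[OF H_Aut])
  qed
  moreover have "(\<lambda>g. g \<cdot> h) ` H \<subseteq> H" using h mul_H by blast
  ultimately have "bij_betw (\<lambda>g. g \<cdot> h) H H" using finite_H by (simp add: bij_betw_def endo_inj_surj)
  then have "(\<Sum>g\<in>H. \<tau> (ev ((g \<cdot> h) y))) = (\<Sum>g\<in>H. \<tau> (ev (g y)))"
    by (rule sum.reindex_bij_betw)
  then show ?thesis using y by (simp add: favg_def mul_apply)
qed

text \<open>Agreement at one state spreads along words to all states, by transitivity.\<close>

lemma ev_Aut:
  assumes "\<phi> \<in> Aut" "y \<in> Y" "ev (\<phi> y) = ev y" "y' \<in> Y"
  shows "ev (\<phi> y') = ev y'"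
proof -
  obtain L x where "R L x y = y'" using transitive assms by blast
  then show ?thesis using ev_run[of "\<phi> y" y L x] assms by (auto simp: Aut_run Aut_closed)
qed

text \<open>By \<open>ev_Aut\<close> the automorphism preserves \<open>ev\<close> everywhere, and
  conjugation by it permutes \<open>H\<close>, so both averages have the same terms.\<close>

lemma favg_stabiliser:
  assumes \<phi>: "\<phi> \<in> Aut" and y: "y \<in> Y" "ev (\<phi> y) = ev y"
  shows "favg (\<phi> y) = favg y"
proof -
  define c where "c h = \<phi> \<cdot> (h \<cdot> minv \<phi>)" for h
  have c: "c h (\<phi> y) = \<phi> (h y)" for h
    using \<phi> y by (simp add: c_def mul_apply Aut_closed minv_left)
  have "inj_on c H"
  proof (rule inj_onI)
    fix g g' assume g: "g \<in> H" "g' \<in> H" "c g = c g'"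
    then have "\<phi> (g y) = \<phi> (g' y)" using c by metis
    then have "g y = g' y" using g y Aut_bij[OF \<phi>] Aut_closed[OF H_Aut]
      by (auto simp: bij_betw_def inj_on_def)
    then show "g = g'" using g y by (auto intro: Aut_eqI H_Aut)
  qed
  moreover have "c ` H \<subseteq> H" using \<phi> conj_H by (auto simp: c_def)
  ultimately have "bij_betw c H H" using finite_H by (simp add: bij_betw_def endo_inj_surj)
  then have "(\<Sum>h\<in>H. \<tau> (ev (c h (\<phi> y)))) = (\<Sum>h\<in>H. \<tau> (ev (h (\<phi> y))))"
    by (rule sum.reindex_bij_betw)
  moreover have "(\<Sum>h\<in>H. \<tau> (ev (c h (\<phi> y)))) = (\<Sum>h\<in>H. \<tau> (ev (h y)))"
    using ev_Aut[OF \<phi> y] y Aut_closed[OF H_Aut] by (intro sum.cong refl) (simp add: c)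
  ultimately show ?thesis by (simp add: favg_def)
qed

definition related :: "'y \<Rightarrow> 'y \<Rightarrow> bool" where
  "related y y' \<longleftrightarrow> (\<exists>\<phi>\<in>Aut. y' = \<phi> y)"

lemma related_sym: "y \<in> Y \<Longrightarrow> related y y' \<Longrightarrow> related y' y"
  unfolding related_def by (metis minv_Aut minv_left)

lemma related_trans: "y \<in> Y \<Longrightarrow> related y y' \<Longrightarrow> related y' y'' \<Longrightarrow> related y y''"
  unfolding related_def by (metis mul_Aut mul_apply)

lemma related_refl: "y \<in> Y \<Longrightarrow> related y y"
  unfolding related_def by (rule bexI[of _ one]) auto

lemma related_run: "y \<in> Y \<Longrightarrow> related y y' \<Longrightarrow> related (R L x y) (R L x y')"
  unfolding related_def by (metis Aut_run)

text \<open>Zeros may move \<open>y0\<close> but not \<open>ev y0\<close>. Since reading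
  \<open>n\<close> synchronises, an automorphism relates the two results, and it is of the kind that
  \<open>favg_stabiliser\<close> treats.\<close>

lemma favg_padding:
  assumes l: "n < k ^ l" "l \<le> L"
    and syn: "\<And>y y'. y \<in> Y \<Longrightarrow> y' \<in> Y \<Longrightarrow> related (R l n y) (R l n y')"
  shows "favg (R L n y0) = favg (R l n y0) \<and> related (R l n y0) (R L n y0)"
proof -
  have *: "R L n y0 = R l n (R (L - l) 0 y0)"
    using run_append[OF k_pos l(1), of \<delta> "L - l" 0 y0] l(2) by simp
  have r: "related (R l n y0) (R L n y0)" unfolding * by (intro syn y0 run_closed)
  then obtain \<phi> where \<phi>: "\<phi> \<in> Aut" "R L n y0 = \<phi> (R l n y0)" by (auto simp: related_def)
  have "ev (R L n y0) = ev (R l n y0)"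
    unfolding * by (intro ev_run run_closed y0 ev_zeros)
  then have "favg (R L n y0) = favg (R l n y0)"
    unfolding \<phi>(2) by (intro favg_stabiliser \<phi> run_closed y0)
  with r show ?thesis by simp
qed

text \<open>Freeness identifies the automorphism between the two states with the element of
  \<open>H\<close> observed after the synchronising word.\<close>

lemma favg_approx:
  assumes "y \<in> Y" "related y y'" "y \<approx> y'"
  shows "favg y = favg y'"
proof -
  obtain \<psi> where \<psi>: "\<psi> \<in> Aut" "y' = \<psi> y" using assms(2) by (auto simp: related_def)
  obtain h where h: "h \<in> H" "R lu xu y' = h (R lu xu y)"
    using approxD[OF assms(3), of 0 0] by auto
  have "\<psi> (R lu xu y) = h (R lu xu y)" using \<psi> h assms(1) by (simp add: Aut_run)
  then have "\<psi> = h" by (intro Aut_eqI[OF \<psi>(1) H_Aut[OF h(1)] run_closed[OF assms(1)]])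
  then show ?thesis using favg_H[OF h(1) assms(1)] \<psi>(2) by simp
qed

text \<open>Words of different lengths are compared after padding both with zeros.  This does
  not change \<open>favg\<close>, because \<open>ev\<close> cannot see leading zeros.\<close>

lemma favg_periodic:
  "\<exists>q>0. coprime q k \<and> (\<forall>n n' l l'. n < k ^ l \<longrightarrow> n' < k ^ l' \<longrightarrow>
    (\<forall>y\<in>Y. \<forall>y'\<in>Y. related (R l n y) (R l n y')) \<longrightarrow> (\<forall>y\<in>Y. \<forall>y'\<in>Y. related (R l' n' y) (R l' n' y')) \<longrightarrow>
    related (R l n y0) (R l' n' y0) \<longrightarrow> n mod q = n' mod q \<longrightarrow> favg (R l n y0) = favg (R l' n' y0))"
proof -
  obtain q l1 where q: "q > 0" "coprime q k" and per: "\<And>L s s'. l1 \<le> L \<Longrightarrow> card Y \<le> s \<Longrightarrow> card Y \<le> s' \<Longrightarrow>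
    s < k ^ L \<Longrightarrow> s' < k ^ L \<Longrightarrow> s mod q = s' mod q \<Longrightarrow> R L s y0 \<approx> R L s' y0"
    using approx_periodic[OF y0] by blast
  have "\<delta> y0 1 \<in> Y" using y0 k_ge_2 by (intro \<delta>_closed) auto
  then obtain L2 x2 where x2: "x2 < k ^ L2" "R L2 x2 (\<delta> y0 1) = y0" using transitive y0 by blast
  have one: "R 1 1 y0 = \<delta> y0 1" using k_ge_2 by simp
  \<comment> \<open>A loop at \<open>y0\<close> that starts with the digit 1. As a prefix it
    preserves the state and makes the number as large as \<open>approx_periodic\<close>
    requires.\<close>
  define l3 V where "l3 = 1 + L2" and "V = 1 * k ^ L2 + x2"
  have V: "R l3 V y0 = y0" unfolding l3_def V_def run_append[OF k_pos x2(1)] one by (rule x2(2))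
  have V_less: "V < k ^ l3" unfolding l3_def V_def using k_ge_2 x2 by (intro number_append_less) auto
  have V_pos: "V \<ge> 1" using power_k_pos[of L2] unfolding V_def by linarith
  have "favg (R l n y0) = favg (R l' n' y0)"
    if n: "n < k ^ l" "n' < k ^ l'"
      and syn: "\<forall>y\<in>Y. \<forall>y'\<in>Y. related (R l n y) (R l n y')" "\<forall>y\<in>Y. \<forall>y'\<in>Y. related (R l' n' y) (R l' n' y')"
      and rel: "related (R l n y0) (R l' n' y0)" and mod: "n mod q = n' mod q" for n n' l l'
  proof -
    \<comment> \<open>Long enough to pad both words, to reach the periodic levels and to have
      \<open>card Y \<le> k ^ L\<close>.\<close>
    define L where "L = l + l' + l1 + card Y"
    have nL: "n < k ^ L" "n' < k ^ L"
      using n power_increasing[of l L k] power_increasing[of l' L k] k_pos by (auto simp: L_def)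
    have big: "card Y \<le> V * k ^ L + t" for t
    proof -
      have "card Y \<le> k ^ L" using less_power_self[OF k_ge_2, of L] by (simp add: L_def)
      also have "\<dots> \<le> V * k ^ L" using V_pos by simp
      finally show ?thesis by simp
    qed
    have "R (l3 + L) (V * k ^ L + n) y0 \<approx> R (l3 + L) (V * k ^ L + n') y0"
    proof (rule per)
      show "l1 \<le> l3 + L" by (simp add: L_def)
      show "(V * k ^ L + n) mod q = (V * k ^ L + n') mod q" using mod by (rule mod_add_cong[OF refl])
    qed (rule big number_append_less[OF V_less] nL)+
    then have ap: "R L n y0 \<approx> R L n' y0" by (simp only: run_append[OF k_pos nL(1)] run_append[OF k_pos nL(2)] V)
    have p: "favg (R L n y0) = favg (R l n y0) \<and> related (R l n y0) (R L n y0)"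
      by (rule favg_padding[OF n(1)]) (use syn in \<open>auto simp: L_def\<close>)
    have p': "favg (R L n' y0) = favg (R l' n' y0) \<and> related (R l' n' y0) (R L n' y0)"
      by (rule favg_padding[OF n(2)]) (use syn in \<open>auto simp: L_def\<close>)
    have Y: "R L x y0 \<in> Y" for L x by (rule run_closed[OF y0])
    have "related (R L n y0) (R l n y0)" using related_sym[OF Y] p by blast
    then have "related (R L n y0) (R L n' y0)"
      using related_trans[OF Y related_trans[OF Y _ rel]] p' by blast
    then show ?thesis using favg_approx[OF run_closed[OF y0] _ ap] p p' by simp
  qed
  then show ?thesis using q by (intro exI[of _ q] conjI allI impI)
qed

section \<open>The synchronising automaton and the structured part\<close>

definition synw :: "nat list \<Rightarrow> bool" where
  "synw w \<longleftrightarrow> (\<forall>y\<in>Y. \<forall>y'\<in>Y. related (foldl \<delta> y w) (foldl \<delta> y' w))"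

definition orbit :: "'y \<Rightarrow> 'y set" where
  "orbit y = {y'. related y y'}"

text \<open>Before a synchronising word has been read \<open>\<theta>\<close> remembers the state of the automaton, afterwards only
  its orbit.\<close>

definition \<theta> :: "nat list \<Rightarrow> 'y \<Rightarrow> 'y set" where
  "\<theta> w = (\<lambda>y\<in>Y. if synw w then orbit (foldl \<delta> y w) else {foldl \<delta> y w})"

lemma foldl_closed:
  assumes "w \<in> lists {..<k}" "y \<in> Y"
  shows "foldl \<delta> y w \<in> Y"
  using run_closed[OF assms(2)] foldl_eq_run[OF k_pos assms(1), of \<delta> y] by simp

lemma foldl_related: "w \<in> lists {..<k} \<Longrightarrow> y \<in> Y \<Longrightarrow> related y y' \<Longrightarrow> related (foldl \<delta> y w) (foldl \<delta> y' w)"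
  using foldl_eq_run[OF k_pos, of w] related_run by metis

lemma orbit_eq: "y \<in> Y \<Longrightarrow> y' \<in> Y \<Longrightarrow> related y y' \<Longrightarrow> orbit y = orbit y'"
  unfolding orbit_def using related_sym related_trans by blast

text \<open>In both cases the value of \<open>\<theta>\<close> at \<open>y\<close> contains the
  endpoint of its own word and lies within the orbit of that endpoint.\<close>

lemma \<theta>_related:
  assumes "w \<in> lists {..<k}" "w' \<in> lists {..<k}" "\<theta> w = \<theta> w'" "y \<in> Y"
  shows "related (foldl \<delta> y w) (foldl \<delta> y w')"
proof -
  have Y: "foldl \<delta> y w \<in> Y" "foldl \<delta> y w' \<in> Y" using assms foldl_closed by auto
  have "foldl \<delta> y w' \<in> \<theta> w' y" using Y assms(4) related_refl by (simp add: \<theta>_def orbit_def)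
  then have "foldl \<delta> y w' \<in> \<theta> w y" using assms(3) by simp
  then show ?thesis using Y assms(4) related_refl by (auto simp: \<theta>_def orbit_def split: if_splits)
qed

lemma \<theta>_synw:
  assumes w: "w \<in> lists {..<k}" "w' \<in> lists {..<k}" "\<theta> w = \<theta> w'" and "synw w"
  shows "synw w'"
  unfolding synw_def
proof (intro ballI)
  fix y y' assume y: "y \<in> Y" "y' \<in> Y"
  have "related (foldl \<delta> y w') (foldl \<delta> y w)"
    using \<theta>_related[OF w(2,1) w(3)[symmetric] y(1)] .
  moreover have "related (foldl \<delta> y w) (foldl \<delta> y' w)" using assms(4) y by (simp add: synw_def)
  moreover have "related (foldl \<delta> y' w) (foldl \<delta> y' w')" by (rule \<theta>_related[OF w y(2)])
  ultimately show "related (foldl \<delta> y w') (foldl \<delta> y' w')"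
    using related_trans[OF foldl_closed[OF w(2) y(1)]] by blast
qed

lemma synw_append1: "w \<in> lists {..<k} \<Longrightarrow> synw w \<Longrightarrow> v \<in> lists {..<k} \<Longrightarrow> synw (w @ v)"
  unfolding synw_def by (simp add: foldl_related foldl_closed)

lemma synw_append2: "w \<in> lists {..<k} \<Longrightarrow> synw v \<Longrightarrow> synw (w @ v)"
  unfolding synw_def by (simp add: foldl_closed)

text \<open>\<open>\<theta>\<close> determines by \<open>\<theta>_synw\<close> whether a word
  synchronises. If so, a letter maps orbits into orbits; if not, the endpoints coincide and so do
  their successors.\<close>

lemma \<theta>_cong:
  assumes w: "w \<in> lists {..<k}" "w' \<in> lists {..<k}" "\<theta> w = \<theta> w'" and j: "j < k"
  shows "\<theta> (w @ [j]) = \<theta> (w' @ [j])"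
proof (cases "synw w")
  case True
  have j': "[j] \<in> lists {..<k}" using j by simp
  have s: "synw (w @ [j])" "synw (w' @ [j])"
    using synw_append1[OF w(1) True j'] synw_append1[OF w(2) \<theta>_synw[OF w True] j'] .
  have "orbit (foldl \<delta> y (w @ [j])) = orbit (foldl \<delta> y (w' @ [j]))" if y: "y \<in> Y" for y
  proof (rule orbit_eq)
    show "related (foldl \<delta> y (w @ [j])) (foldl \<delta> y (w' @ [j]))"
      using foldl_related[OF j' foldl_closed[OF w(1) y] \<theta>_related[OF w y]] by simp
  qed (use y w j' in \<open>auto intro!: foldl_closed simp del: foldl_append\<close>)
  then show ?thesis using s by (auto simp: \<theta>_def fun_eq_iff restrict_def)
next
  case False
  then have s: "\<not> synw w'" using \<theta>_synw[OF w(2,1) w(3)[symmetric]] by blast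
  have e: "foldl \<delta> y w = foldl \<delta> y w'" if "y \<in> Y" for y
    using fun_cong[OF w(3), of y] that False s by (simp add: \<theta>_def)
  then have "synw (w @ [j]) = synw (w' @ [j])" by (simp add: synw_def)
  then show ?thesis using e by (auto simp: \<theta>_def fun_eq_iff restrict_def)
qed

lemma synw_state:
  assumes "synw (base_expansion k n)"
  shows "\<exists>l. n < k ^ l \<and> state n = R l n y0 \<and> (\<forall>y\<in>Y. \<forall>y'\<in>Y. related (R l n y) (R l n y'))"
  using assms foldl_eq_run[OF k_pos base_expansion_lists, of \<delta> _ n] word_value_base_expansion[OF k_ge_2, of n]
  by (auto simp: state_def synw_def)

lemma strongly_structured_favg: "strongly_structured k (\<lambda>n. favg (state n))"
proof -
  have fin\<theta>: "finite (\<theta> ` lists {..<k})"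
  proof (rule finite_subset)
    have "orbit y \<subseteq> Y" if "y \<in> Y" for y using that by (auto simp: orbit_def related_def Aut_closed)
    then have "\<theta> w \<in> Y \<rightarrow>\<^sub>E Pow Y" if "w \<in> lists {..<k}" for w
      unfolding \<theta>_def using foldl_closed[OF that] by (intro restrict_PiE_iff[THEN iffD2] ballI) simp
    then show "\<theta> ` lists {..<k} \<subseteq> Y \<rightarrow>\<^sub>E Pow Y" by blast
    show "finite (Y \<rightarrow>\<^sub>E Pow Y)" by (simp add: finite_PiE finite_Y)
  qed
  obtain code :: "('y \<Rightarrow> 'y set) \<Rightarrow> nat" where code: "inj_on code (\<theta> ` lists {..<k})"
    using finite_imp_inj_to_nat_seg[OF fin\<theta>] by blast
  define a_fs where "a_fs = (\<lambda>n. code (\<theta> (base_expansion k n)))"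
  obtain u where u: "u \<in> lists {..<k}" "\<And>y. R lu xu y = foldl \<delta> y u" using run_eq_foldl[OF k_pos] by blast
  have synu: "synw u" using sync u(2) by (simp add: synw_def related_def)
  have fs: "forwards_synchronising k a_fs"
  proof -
    have "\<theta> (w @ u) = \<theta> (w' @ u)" if w: "w \<in> lists {..<k}" "w' \<in> lists {..<k}" for w w'
    proof -
      have "orbit (foldl \<delta> y (w @ u)) = orbit (foldl \<delta> y (w' @ u))" if "y \<in> Y" for y
        using synu that w u(1) by (intro orbit_eq) (auto simp: synw_def foldl_closed)
      then show ?thesis
        using synw_append2[OF _ synu] w by (auto simp: \<theta>_def fun_eq_iff restrict_def)
    qed
    then have syn: "\<exists>u\<in>lists {..<k}. \<forall>w\<in>lists {..<k}. \<forall>w'\<in>lists {..<k}. \<theta> (w @ u) = \<theta> (w' @ u)"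
      using u(1) by blast
    from automaton_of_congruence[OF fin\<theta> \<theta>_cong, of code] obtain A :: "(nat, nat) automaton"
      where A: "k_automaton k A" "produced_sequence k A = a_fs" and "synchronising k A"
      using syn unfolding a_fs_def by blast
    then show ?thesis unfolding forwards_synchronising_def by (intro exI[of _ A]) simp
  qed
  have automatic: "k_automatic k (\<lambda>n. favg (state n))"
  proof -
    have "finite (foldl \<delta> y0 ` lists {..<k})"
      using foldl_closed y0 by (intro finite_subset[OF _ finite_Y]) auto
    moreover have "foldl \<delta> y0 (w @ [j]) = foldl \<delta> y0 (w' @ [j])"
      if "foldl \<delta> y0 w = foldl \<delta> y0 w'" for w w' j using that by simp
    ultimately obtain A :: "(nat, complex) automaton"
      where "k_automaton k A" "produced_sequence k A = (\<lambda>n. favg (foldl \<delta> y0 (base_expansion k n)))"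
      using automaton_of_congruence[of "foldl \<delta> y0" k favg] by blast
    then show ?thesis unfolding k_automatic_def state_def by (intro exI[of _ A]) simp
  qed
  obtain q where q: "q > 0" "coprime q k" and per: "\<And>n n' l l'. n < k ^ l \<Longrightarrow> n' < k ^ l' \<Longrightarrow>
    \<forall>y\<in>Y. \<forall>y'\<in>Y. related (R l n y) (R l n y') \<Longrightarrow> \<forall>y\<in>Y. \<forall>y'\<in>Y. related (R l' n' y) (R l' n' y') \<Longrightarrow>
    related (R l n y0) (R l' n' y0) \<Longrightarrow> n mod q = n' mod q \<Longrightarrow> favg (R l n y0) = favg (R l' n' y0)"
    using favg_periodic by (elim exE conjE) metis
  \<comment> \<open>Any \<open>n\<close> with the given residue and value can be chosen, since
    \<open>key\<close> shows that the result does not depend on it.\<close>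
  define F where "F pc = favg (state (SOME n. n mod q = fst pc \<and> a_fs n = snd pc))" for pc
  have key: "favg (state n) = favg (state n')" if n: "n mod q = n' mod q" "a_fs n = a_fs n'" for n n'
  proof -
    let ?w = "base_expansion k n" and ?w' = "base_expansion k n'"
    have w: "?w \<in> lists {..<k}" "?w' \<in> lists {..<k}" by (rule base_expansion_lists)+
    have \<theta>: "\<theta> ?w = \<theta> ?w'"
      using n(2) inj_onD[OF code] w unfolding a_fs_def by blast
    show ?thesis
    \<comment> \<open>Periodicity is available for synchronising words only; for the others
      \<open>\<theta>\<close> still remembers the state itself.\<close>
    proof (cases "synw ?w")
      case True
      obtain l where l: "n < k ^ l" "state n = R l n y0" "\<forall>y\<in>Y. \<forall>y'\<in>Y. related (R l n y) (R l n y')"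
        using synw_state[OF True] by blast
      obtain l' where l': "n' < k ^ l'" "state n' = R l' n' y0" "\<forall>y\<in>Y. \<forall>y'\<in>Y. related (R l' n' y) (R l' n' y')"
        using synw_state[OF \<theta>_synw[OF w \<theta> True]] by blast
      have "related (state n) (state n')" unfolding state_def by (rule \<theta>_related[OF w \<theta> y0])
      then show ?thesis using per[OF l(1) l'(1) l(3) l'(3) _ n(1)] l(2) l'(2) by simp
    next
      case False
      then have "\<not> synw ?w'" using \<theta>_synw[OF w(2,1) \<theta>[symmetric]] by blast
      then have "state n = state n'" using fun_cong[OF \<theta>, of y0] False y0 by (simp add: \<theta>_def state_def)
      then show ?thesis by simp
    qed
  qed
  have F: "favg (state n) = F (n mod q, a_fs n)" for n
    unfolding F_def using someI[of "\<lambda>n'. n' mod q = n mod q \<and> a_fs n' = a_fs n" n] by (intro key) auto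
  have q': "\<exists>m>0. coprime m k \<and> (\<forall>n. (n + m) mod q = n mod q)" using q by (intro exI[of _ q]) simp
  have "\<exists>a_per a_fs F. (\<exists>m>0. coprime m k \<and> (\<forall>n. a_per (n + m) = (a_per n :: nat))) \<and>
      forwards_synchronising k a_fs \<and> (\<forall>n. favg (state n) = F (a_per n, a_fs n :: nat))"
    by (rule exI[of _ "\<lambda>n. n mod q"], rule exI[of _ a_fs], rule exI[of _ F]) (use q' fs F in simp)
  with automatic show ?thesis unfolding strongly_structured_def by (rule conjI)
qed

section \<open>The Gowers uniform part\<close>

definition dev :: "'y \<Rightarrow> complex" where
  "dev y = \<tau> (ev y) - favg y"

lemma dev_sum:
  assumes y: "y \<in> Y" shows "(\<Sum>h\<in>H. dev (h y)) = 0"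
proof -
  have "(\<Sum>h\<in>H. dev (h y)) = (\<Sum>h\<in>H. \<tau> (ev (h y))) - (\<Sum>h\<in>H. favg y)"
    unfolding dev_def sum_subtractf using favg_H y by simp
  also have "(\<Sum>h\<in>H. favg y) = (\<Sum>h\<in>H. \<tau> (ev (h y)))" using card_H by (simp add: favg_def)
  finally show ?thesis by simp
qed

lemma highly_gowers_uniform_dev: "highly_gowers_uniform (\<lambda>n. dev (state n))"
proof -
  define B where "B = (\<Sum>y\<in>Y. norm (dev y))"
  have B: "norm (dev (state n)) \<le> B" for n
    using member_le_sum[OF state_closed[of n], where f = "\<lambda>y. norm (dev y)"] finite_Y by (simp add: B_def)
  have "\<exists>e>0. (\<lambda>N. gowers_norm_interval d N (\<lambda>n. dev (state n))) \<in> O(\<lambda>N. real N powr (- e))" if d: "d \<ge> 1" for d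
  proof -
    obtain C c where c: "0 < c" "0 \<le> C" and dec: "\<And>L z. config d z \<Longrightarrow>
      norm (cubesum dev d L z) \<le> C * real (k ^ L) ^ (d + 1) * real (k ^ L) powr (- c)"
      using cubesum_decay[of dev d, OF dev_sum] by blast
    show ?thesis
    proof (rule gowers_norm_interval_decay[OF k_ge_2 d B c])
      fix L and v :: "(nat \<Rightarrow> nat) \<Rightarrow> nat" assume v: "\<And>\<omega>. \<omega> \<in> cube d \<Longrightarrow> 1 \<le> v \<omega>"
      \<comment> \<open>The states after the upper digits, with carry \<open>r\<close> added to
        them; \<open>v \<omega> \<ge> 1\<close> lets \<open>state_append\<close> read the lower
        digits from there.\<close>
      define z where "z \<omega> r = state (v \<omega> + r)" for \<omega> :: "nat \<Rightarrow> nat" and r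
      have "config d z" by (simp add: config_def z_def state_closed)
      moreover have "cubesum dev d L z =
        (\<Sum>m\<in>box d (k ^ L). cubeprod d (\<lambda>\<omega>. dev (state (v \<omega> * k ^ L + vert d m \<omega>))))"
      proof -
        have "state (v \<omega> * k ^ L + vert d m \<omega>) = step d L m z \<omega> 0" if "\<omega> \<in> cube d" for m \<omega>
        proof -
          let ?x = "vert d m \<omega>"
          have "v \<omega> * k ^ L + ?x = (v \<omega> + ?x div k ^ L) * k ^ L + ?x mod k ^ L"
            by (simp only: add_mult_distrib add.assoc div_mult_mod_eq)
          then have "state (v \<omega> * k ^ L + ?x) = R L (?x mod k ^ L) (state (v \<omega> + ?x div k ^ L))"
            using state_append[of "v \<omega> + ?x div k ^ L" "?x mod k ^ L" L] v[OF that] power_k_pos[of L] by simp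
          then show ?thesis by (simp add: step_def z_def run_mod k_pos)
        qed
        then show ?thesis unfolding cubesum_def cubeprod_def by (intro sum.cong prod.cong refl) simp
      qed
      ultimately show "norm (\<Sum>m\<in>box d (k ^ L). cubeprod d (\<lambda>\<omega>. dev (state (v \<omega> * k ^ L + vert d m \<omega>))))
        \<le> C * real (k ^ L) ^ (d + 1) * real (k ^ L) powr (- c)"
        using dec by metis
    qed
  qed
  moreover have "Bseq (\<lambda>n. dev (state n))" using B by (intro BseqI') auto
  ultimately show ?thesis by (simp add: highly_gowers_uniform_def)
qed

end

section \<open>The extension of a given automaton\<close>

lemma delta_word_append: "delta_word A s (v @ w) = delta_word A (delta_word A s v) w"
  by (simp add: delta_word_def)

lemma delta_word_closed:
  assumes "k_automaton k A" "w \<in> lists {..<k}" "s \<in> states A"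
  shows "delta_word A s w \<in> states A"
  using assms(2)
proof (induction w rule: rev_induct)
  case (snoc j w)
  then show ?case using assms(1) by (auto simp: delta_word_def k_automaton_def Pi_iff)
qed (use assms in \<open>simp add: delta_word_def\<close>)

definition transf :: "('s, 'o) automaton \<Rightarrow> nat list \<Rightarrow> 's \<Rightarrow> 's" where
  "transf A w = (\<lambda>s\<in>states A. delta_word A s w)"

definition tdelta :: "('s, 'o) automaton \<Rightarrow> ('s \<Rightarrow> 's) \<Rightarrow> nat \<Rightarrow> 's \<Rightarrow> 's" where
  "tdelta A y j = (\<lambda>s\<in>states A. delta A (y s) j)"

lemma tdelta_transf: "tdelta A (transf A v) j = transf A (v @ [j])"
  by (auto simp: tdelta_def transf_def delta_word_def)

lemma foldl_tdelta: "foldl (tdelta A) (transf A v) w = transf A (v @ w)"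
proof (induction w rule: rev_induct)
  case (snoc j w)
  then show ?case by (simp add: tdelta_transf)
qed simp

text \<open>Take \<open>u\<close> of minimal rank: then \<open>w @ u\<close> permutes the image of \<open>u\<close>, so some power of it acts as the identity there.\<close>

lemma minimal_word:
  assumes A: "k_automaton k A"
  shows "\<exists>u\<in>lists {..<k}. \<forall>w\<in>lists {..<k}. \<exists>v\<in>lists {..<k}. transf A (u @ w @ v) = transf A u"
proof -
  let ?S = "states A"
  have fin: "finite ?S" using A by (simp add: k_automaton_def)
  have "\<exists>u. u \<in> lists {..<k} \<and> (\<forall>v. v \<in> lists {..<k} \<longrightarrow> card (transf A u ` ?S) \<le> card (transf A v ` ?S))"
    by (rule ex_has_least_nat[of "\<lambda>u. u \<in> lists {..<k}" "[]"]) simp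
  then obtain u where u: "u \<in> lists {..<k}"
    and min: "\<And>v. v \<in> lists {..<k} \<Longrightarrow> card (transf A u ` ?S) \<le> card (transf A v ` ?S)" by blast
  define T where "T = transf A u ` ?S"
  have finT: "finite T" using fin by (simp add: T_def)
  have "\<exists>v\<in>lists {..<k}. transf A (u @ w @ v) = transf A u" if w: "w \<in> lists {..<k}" for w
  proof -
    \<comment> \<open>\<open>\<sigma>\<close> maps \<open>T\<close> into itself, and onto because no
      word has smaller rank than \<open>u\<close>.\<close>
    define \<sigma> where "\<sigma> t = delta_word A t (w @ u)" for t
    have \<sigma>T: "\<sigma> ` T = transf A (u @ w @ u) ` ?S"
      by (auto simp: T_def \<sigma>_def transf_def delta_word_append image_image)
    have "\<sigma> ` T \<subseteq> T"
    proof
      fix t assume "t \<in> \<sigma> ` T"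
      then obtain s where s: "s \<in> ?S" "t = delta_word A (delta_word A s (u @ w)) u"
        unfolding \<sigma>T by (auto simp: transf_def delta_word_append)
      moreover have "delta_word A s (u @ w) \<in> ?S" using u w s by (intro delta_word_closed[OF A]) auto
      ultimately show "t \<in> T" by (auto simp: T_def transf_def)
    qed
    moreover have "card T \<le> card (\<sigma> ` T)"
      unfolding \<sigma>T using min[of "u @ w @ u"] u w by (simp add: T_def)
    ultimately have surj: "\<sigma> ` T = T" using finT by (meson card_seteq)
    have surj_pow: "(\<sigma> ^^ n) ` T = T" for n
    proof (induction n)
      case (Suc n)
      then show ?case unfolding funpow.simps image_comp[symmetric] using surj by simp
    qed simp
    \<comment> \<open>Two powers of \<open>\<sigma>\<close> agree on the finite set
      \<open>T\<close>; cancelling the smaller one, which is onto, leaves a positive power that is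
      the identity there.\<close>
    have "\<not> inj_on (\<lambda>n. restrict (\<sigma> ^^ n) T) (UNIV :: nat set)"
    proof
      assume inj: "inj_on (\<lambda>n. restrict (\<sigma> ^^ n) T) (UNIV :: nat set)"
      have "restrict (\<sigma> ^^ n) T \<in> T \<rightarrow>\<^sub>E T" for n 
        using surj_pow[of n] by (intro restrict_PiE_iff[THEN iffD2] ballI) blast
      then have "range (\<lambda>n. restrict (\<sigma> ^^ n) T) \<subseteq> T \<rightarrow>\<^sub>E T" by blast
      then have "finite (range (\<lambda>n. restrict (\<sigma> ^^ n) T))"
        by (rule finite_subset) (simp add: finite_PiE finT)
      from finite_imageD[OF this inj] show False by simp
    qed
    then obtain i j where ij: "i \<noteq> j" "restrict (\<sigma> ^^ i) T = restrict (\<sigma> ^^ j) T"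
      unfolding inj_on_def by blast
    define a b where "a = min i j" and "b = max i j"
    have ab: "a < b" "restrict (\<sigma> ^^ a) T = restrict (\<sigma> ^^ b) T"
      using ij by (auto simp: a_def b_def min_def max_def)
    define n where "n = b - a - 1"
    have n: "b = Suc n + a" using ab(1) by (simp add: n_def)
    have fix_T: "(\<sigma> ^^ Suc n) t = t" if t: "t \<in> T" for t
    proof -
      obtain t' where t': "t' \<in> T" "t = (\<sigma> ^^ a) t'" using surj_pow[of a] t by blast
      have "(\<sigma> ^^ Suc n) t = (\<sigma> ^^ b) t'" unfolding n funpow_add t'(2) by simp
      also have "\<dots> = (\<sigma> ^^ a) t'" using fun_cong[OF ab(2), of t'] t'(1) by simp
      finally show ?thesis using t'(2) by simp
    qed
    \<comment> \<open>With this choice \<open>u @ w @ v\<close> is \<open>u\<close> followed by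
      \<open>Suc n\<close> copies of \<open>w @ u\<close>.\<close>
    define v where "v = u @ concat (replicate n (w @ u))"
    have pow: "(\<sigma> ^^ n) t = delta_word A t (concat (replicate n (w @ u)))" for n t
    proof (induction n arbitrary: t)
      case (Suc n)
      have "(\<sigma> ^^ Suc n) t = (\<sigma> ^^ n) (\<sigma> t)" by (simp only: funpow_Suc_right o_apply)
      then show ?case using Suc by (simp add: \<sigma>_def delta_word_append)
    qed (simp add: delta_word_def)
    have "transf A (u @ w @ v) = transf A u"
    proof (rule extensionalityI[of _ ?S])
      fix s assume s: "s \<in> ?S"
      have "(\<sigma> ^^ Suc n) (delta_word A s u) = delta_word A s u"
        using s by (intro fix_T) (auto simp: T_def transf_def)
      then show "transf A (u @ w @ v) s = transf A u s"
        unfolding pow using s by (simp add: transf_def v_def delta_word_append)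
    qed (auto simp: transf_def)
    moreover have "v \<in> lists {..<k}" using u w by (auto simp: v_def split: if_splits)
    ultimately show ?thesis by blast
  qed
  then show ?thesis using u by blast
qed

theorem theorem4p1:
  fixes k :: nat and A :: "('s, complex) automaton" and a :: "nat \<Rightarrow> complex"
  assumes "k \<ge> 2"
    and "k_automaton k A"
    and "strongly_connected k A"
    and "prolongable A"
    and "a = produced_sequence k A"
  shows "\<exists>a_str a_uni :: nat \<Rightarrow> complex.
           (\<forall>n. a n = a_str n + a_uni n) \<and>
           strongly_structured k a_str \<and>
           highly_gowers_uniform a_uni"
proof -
  note k = assms(1) and A = assms(2)
  have k0: "k > 0" using k by simp
  define s0 where "s0 = init A"
  have s0: "s0 \<in> states A" using A by (simp add: s0_def k_automaton_def)
  have fin: "finite (states A)" using A by (simp add: k_automaton_def)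
  obtain u where u: "u \<in> lists {..<k}"
    and return: "\<And>w. w \<in> lists {..<k} \<Longrightarrow> \<exists>v\<in>lists {..<k}. transf A (u @ w @ v) = transf A u"
    using minimal_word[OF A] by blast
  \<comment> \<open>By \<open>return\<close> each of these maps can be led back to
    \<open>transf A u\<close>, from which all the others are reached.\<close>
  define Y where "Y = (\<lambda>w. transf A (u @ w)) ` lists {..<k}"
  have run: "run k (tdelta A) (length w) (word_value k w) (transf A v) = transf A (v @ w)"
    if "w \<in> lists {..<k}" for v w
    using foldl_eq_run[OF k0 that, of "tdelta A" "transf A v"] foldl_tdelta[of A v w] by simp
  have transf_append: "transf A (v @ w) = transf A (v' @ w)" if "transf A v = transf A v'" for v v' w
    using that by (simp only: foldl_tdelta[symmetric])
  interpret transitive_automaton k Y "tdelta A"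
  proof
    have closed: "transf A w \<in> states A \<rightarrow>\<^sub>E states A" if "w \<in> lists {..<k}" for w
      using delta_word_closed[OF A that] by (simp add: transf_def)
    have "Y \<subseteq> states A \<rightarrow>\<^sub>E states A" unfolding Y_def using u by (intro image_subsetI closed) simp
    then show "finite Y" by (rule finite_subset) (simp add: finite_PiE fin)
    show "tdelta A y j \<in> Y" if y: "y \<in> Y" and j: "j < k" for y j
    proof -
      obtain w where "w \<in> lists {..<k}" "y = transf A (u @ w)" using y by (auto simp: Y_def)
      then have "tdelta A y j = transf A (u @ (w @ [j]))" "w @ [j] \<in> lists {..<k}"
        using j by (auto simp: tdelta_transf)
      then show ?thesis unfolding Y_def by blast
    qed
    show "\<exists>L x. x < k ^ L \<and> run k (tdelta A) L x y = y'" if y: "y \<in> Y" "y' \<in> Y" for y y'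
    proof -
      obtain w where w: "w \<in> lists {..<k}" "y = transf A (u @ w)" using y by (auto simp: Y_def)
      obtain w' where w': "w' \<in> lists {..<k}" "y' = transf A (u @ w')" using y by (auto simp: Y_def)
      obtain v where v: "v \<in> lists {..<k}" "transf A (u @ w @ v) = transf A u" using return[OF w(1)] by blast
      have vw: "v @ w' \<in> lists {..<k}" using v w' by simp
      have "transf A ((u @ w) @ (v @ w')) = y'"
        using transf_append[OF v(2), of w'] w'(2) by simp
      then have "run k (tdelta A) (length (v @ w')) (word_value k (v @ w')) y = y'"
        using run[OF vw, of "u @ w"] w(2) by simp
      then show ?thesis using foldl_eq_run[OF k0 vw, of "tdelta A" y] by blast
    qed
  qed (rule k)
  define lu xu where "lu = length u" and "xu = word_value k u"
  have run_u: "R lu xu (transf A v) = transf A (v @ u)" for v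
    unfolding lu_def xu_def by (rule run[OF u])
  \<comment> \<open>Precomposition with the action of \<open>u @ w\<close> commutes with reading,
    since reading composes on the other side.\<close>
  define \<phi> where "\<phi> w = (\<lambda>y\<in>Y. \<lambda>s\<in>states A. y (delta_word A s (u @ w)))" for w
  have \<phi>_transf: "\<phi> w (transf A (u @ x)) = transf A (u @ w @ u @ x)"
    if "w \<in> lists {..<k}" "x \<in> lists {..<k}" for w x
  proof -
    have "transf A (u @ x) \<in> Y" using that by (auto simp: Y_def)
    moreover have "delta_word A s (u @ w) \<in> states A" if "s \<in> states A" for s
      using \<open>w \<in> _\<close> u that by (intro delta_word_closed[OF A]) auto
    ultimately show ?thesis by (auto simp: \<phi>_def transf_def delta_word_append fun_eq_iff)
  qed
  have \<phi>: "\<phi> w \<in> Aut" if w: "w \<in> lists {..<k}" for w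
  proof -
    have "\<phi> w y \<in> Y \<and> (\<forall>j<k. \<phi> w (tdelta A y j) = tdelta A (\<phi> w y) j)" if y: "y \<in> Y" for y
    proof -
      obtain x where x: "x \<in> lists {..<k}" "y = transf A (u @ x)" using y by (auto simp: Y_def)
      have "\<phi> w y = transf A (u @ (w @ u @ x))" unfolding x(2) by (rule \<phi>_transf[OF w x(1)])
      moreover have "w @ u @ x \<in> lists {..<k}" using w u x by simp
      moreover have "\<phi> w (tdelta A y j) = tdelta A (\<phi> w y) j" if "j < k" for j
      proof -
        have "x @ [j] \<in> lists {..<k}" using x that by simp
        from \<phi>_transf[OF w this] \<phi>_transf[OF w x(1)] show ?thesis by (simp add: x(2) tdelta_transf)
      qed
      ultimately show ?thesis unfolding Y_def by blast
    qed
    then show ?thesis by (auto simp: Aut_def) (auto simp: \<phi>_def)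
  qed
  interpret synchronising_extension k Y "tdelta A" lu xu
  proof
    show "xu < k ^ lu" unfolding xu_def lu_def by (rule conjunct2[OF foldl_eq_run[OF k0 u]])
    fix y y' assume y: "y \<in> Y" "y' \<in> Y"
    obtain w where w: "w \<in> lists {..<k}" "y = transf A (u @ w)" using y by (auto simp: Y_def)
    obtain w' where w': "w' \<in> lists {..<k}" "y' = transf A (u @ w')" using y by (auto simp: Y_def)
    have p: "transf A u \<in> Y" unfolding Y_def by (rule image_eqI[of _ _ "[]"]) auto
    \<comment> \<open>Appending \<open>u\<close> to \<open>u @ w\<close> gives the same word as
      putting \<open>u @ w\<close> before \<open>u\<close>, so reading \<open>u\<close> always ends
      in the orbit of \<open>transf A u\<close>.\<close>
    have e: "R lu xu y = \<phi> w (transf A u)" "R lu xu y' = \<phi> w' (transf A u)"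
      unfolding w(2) w'(2) run_u using \<phi>_transf[OF w(1), of "[]"] \<phi>_transf[OF w'(1), of "[]"] by simp_all
    have "R lu xu y' = compose Y (\<phi> w') (minv (\<phi> w)) (R lu xu y)"
      unfolding e mul_apply[OF Aut_closed[OF \<phi>[OF w(1)] p]] minv_left[OF \<phi>[OF w(1)] p] ..
    then show "\<exists>\<psi>\<in>Aut. R lu xu y' = \<psi> (R lu xu y)"
      using mul_Aut[OF \<phi>[OF w'(1)] minv_Aut[OF \<phi>[OF w(1)]]] by blast
  qed
  have "delta_word A s0 u \<in> states A" using u s0 by (intro delta_word_closed[OF A])
  \<comment> \<open>Evaluation at \<open>s0\<close> is to be the factor map, so the starting map
    must send \<open>s0\<close> to itself; strong connectivity leads back from where
    \<open>u\<close> takes \<open>s0\<close>.\<close>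
  then obtain w0 where w0: "w0 \<in> lists {..<k}" "delta_word A (delta_word A s0 u) w0 = s0"
    using assms(3) s0 unfolding strongly_connected_def by blast
  define y0 where "y0 = transf A (u @ w0)"
  have ev_y0: "y0 s0 = s0" using s0 w0(2) by (simp add: y0_def transf_def delta_word_append)
  interpret pointed_extension k Y "tdelta A" lu xu y0 "\<lambda>y. y s0" "delta A" "out A"
  proof
    show "y0 \<in> Y" using w0 by (simp add: y0_def Y_def)
    show "tdelta A y j s0 = delta A (y s0) j" for y j using s0 by (simp add: tdelta_def)
    show "delta A (y0 s0) 0 = y0 s0"
      using assms(4) unfolding ev_y0 by (simp add: prolongable_def s0_def)
  qed
  have "a n = favg (state n) + dev (state n)" for n
  proof -
    have "state n s0 = delta_word A s0 (u @ w0 @ base_expansion k n)"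
    proof -
      have "state n = transf A ((u @ w0) @ base_expansion k n)"
        unfolding state_def unfolding y0_def foldl_tdelta ..
      then show ?thesis using s0 by (simp add: transf_def)
    qed
    also have "\<dots> = delta_word A s0 (base_expansion k n)" using w0(2) by (simp add: delta_word_append)
    finally have "a n = out A (state n s0)" by (simp add: assms(5) produced_sequence_def s0_def)
    then show ?thesis by (simp add: dev_def)
  qed
  then show ?thesis using strongly_structured_favg highly_gowers_uniform_dev
    by (intro exI[of _ "\<lambda>n. favg (state n)"] exI[of _ "\<lambda>n. dev (state n)"] conjI allI)
qed

end
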